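(* Let $q$ be an odd prime power, let $Q^-(5,q)$ be an elliptic quadric of $\mathrm{PG}(5,q)$, and let $\mathcal{S}$ be a pseudo-oval of $\mathrm{PG}(5,q)$ consisting of lines of $Q^-(5,q)$. Then: (a) for each $l\in\mathcal{S}$, the set $\mathcal{S}\setminus\{l\}$ is a $\{0,4,5\}$-clique and a $\{1\}$-design of the association scheme $\mathfrak{X}_l$; (b) the following are equivalent: (i) $\mathcal{S}\setminus\{l\}$ is a $\{0,5\}$-clique of $\mathfrak{X}_l$ for each $l\in\mathcal{S}$; (ii) $\mathcal{S}\setminus\{l\}$ is a $\{1,5\}$-design of $\mathfrak{X}_l$ for each $l\in\mathcal{S}$; (iii) $\mathcal{S}$ is a pseudo-conic.
   Context: A pseudo-oval of $\mathrm{PG}(5,q)$ is a set of $q^2+1$ lines such that any three distinct ones span the whole space. A pseudo-conic is a pseudo-oval projectively equivalent to the set of $q^2+1$ lines obtained from the points of a non-degenerate conic of $\mathrm{PG}(2,q^2)$ by regarding the $\mathrm{GF}(q^2)$-space $\mathrm{GF}(q^2)^3$ as the $\mathrm{GF}(q)$-space $\mathrm{GF}(q)^6$ (each point becomes a line of $\mathrm{PG}(5,q)$). Let $\perp$ be the polarity of $Q^-(5,q)$. Dimensions below are vector-space dimensions over $\mathrm{GF}(q)$ (lines are 2-dimensional). Three pairwise disjoint lines $l_1,l_2,l_3$ of $Q^-(5,q)$ spanning the whole space are in perspective if, putting $T_i=l_i^\perp$, $s_k=T_i\cap T_j$ and $\Sigma_k=\langle s_k,l_k\rangle$ for $\{i,j,k\}=\{1,2,3\}$,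 the intersection $\Sigma_1\cap\Sigma_2\cap\Sigma_3$ is a line (2-dimensional). For a fixed line $l$ of $Q^-(5,q)$, $\mathfrak{X}_l$ is the following structure on the set $\mathcal{X}'$ of the $q^5$ lines of $Q^-(5,q)$ disjoint from $l$, with relations: $R'_0$ the diagonal; $R'_1=\{(m,n): m,n \text{ meet in a point}\}$; $R'_2=\{(m,n): \dim\langle l,m,n\rangle=4\}$; $R'_3=\{(m,n): m,n \text{ disjoint and } \dim\langle l,m,n\rangle=5\}$; $R'_4=\{(m,n): l,m,n \text{ span the whole space and are not in perspective}\}$; $R'_5=\{(m,n): l,m,n \text{ span the whole space and are in perspective}\}$. It is a symmetric 5-class association scheme with adjacency matrices $A_0,\dots,A_5$; its primitive idempotents $E_0,\dots,E_5$ are ordered so that $E_j=q^{-5}\sum_{i=0}^5\mathcal{Q}(i,j)A_i$, where $\mathcal{Q}$ is the matrix with rows $(1,\ (q-1)(q+1)^2,\ q^3(q-1),\ q(q-1)^2(q+1),\ \tfrac12q^2(q-1)^3,\ \tfrac12q^2(q+1)(q-1)^2)$, $(1,\ q^2-q-1,\ \tfrac{q^3(q-1)}{q+1},\ -q(q-1),\ -\tfrac{q^2(q-1)^2}{2(q+1)},\ -\tfrac12q^2(q-1))$, $(1,\ (q-1)(q+1)^2,\ -q^3,\ q(q-1)^2(q+1),\ -\tfrac12q^2(q-1)^2,\ -\tfrac12q^2(q+1)(q-1))$, $(1,\ q^2-q-1,\ -\tfrac{q^3}{q+1},\ -q(q-1),\ \tfrac{q^2(q-1)}{2(q+1)},\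 \tfrac{q^2}{2})$, $(1,\ -q-1,\ 0,\ q,\ -\tfrac{q^2}{2},\ \tfrac{q^2}{2})$, $(1,\ -q-1,\ 0,\ q,\ \tfrac12q^2(q-1),\ -\tfrac12q^2(q-1))$. For $M\subseteq\{0,\dots,5\}$ with $0\in M$, a nonempty $Y\subseteq\mathcal{X}'$ is an $M$-clique if $R'_i\cap Y^2=\varnothing$ for all $i\notin M$. For $T\subseteq\{1,\dots,5\}$, $Y$ is a $T$-design if $\chi_Y E_j=0$ for all $j\in T$, where $\chi_Y$ is the characteristic (row) vector of $Y$. *)

theory Defs
  imports "HOL-Analysis.Analysis"
begin

section \<open>The quadratic extension of a finite field\<close>

text \<open>
  \<open>'a quad_ext\<close> is the field with \<open>CARD('a)\<^sup>2\<close> elements, realised as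
  \<open>'a[X] / (X\<^sup>2 - u X - v)\<close> for a choice of \<open>(u, v)\<close> making this polynomial irreducible;
  \<open>Quad a b\<close> is the class of \<open>a + b X\<close>.
\<close>

datatype 'a quad_ext = Quad (quad_fst: 'a) (quad_snd: 'a)

definition quad_par :: "'a::{field,finite} \<times> 'a"
  where "quad_par = (SOME p. \<forall>x. x\<^sup>2 \<noteq> fst p * x + snd p)"

lemma quad_par_no_root: "x\<^sup>2 \<noteq> fst quad_par * x + snd (quad_par :: 'a::{field,finite} \<times> 'a)"
proof -
  let ?f = "\<lambda>(x::'a, y). (x + y, - (x * y))"
  have "\<not> inj ?f"
  proof
    assume "inj ?f"
    moreover have "?f (0, 1) = ?f (1, 0)" by simp
    ultimately have "(0::'a, 1::'a) = (1, 0)" by (rule injD)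
    then show False by simp
  qed
  then have "\<not> surj ?f"
    using finite_UNIV_surj_inj[of ?f] by auto
  then obtain p where p: "p \<notin> range ?f" by blast
  have "x\<^sup>2 \<noteq> fst p * x + snd p" for x :: 'a
  proof
    assume "x\<^sup>2 = fst p * x + snd p"
    then have "?f (x, fst p - x) = p"
      by (cases p) (simp add: algebra_simps power2_eq_square)
    with p show False by (metis rangeI)
  qed
  then have "\<exists>p :: 'a \<times> 'a. \<forall>x. x\<^sup>2 \<noteq> fst p * x + snd p" by blast
  from someI_ex[OF this] show ?thesis by (simp add: quad_par_def)
qed

instance quad_ext :: (finite) finite
proof
  have "(UNIV :: 'a quad_ext set) = (\<lambda>(a, b). Quad a b) ` UNIV"
    by (auto simp: image_iff) (metis quad_ext.exhaust)
  then show "finite (UNIV :: 'a quad_ext set)" by (metis finite finite_imageI)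
qed

instantiation quad_ext :: ("{field,finite}") field
begin

definition "0 = Quad 0 0"
definition "1 = Quad 1 0"
definition "x + y = Quad (quad_fst x + quad_fst y) (quad_snd x + quad_snd y)"
definition "- x = Quad (- quad_fst x) (- quad_snd x)"
definition "x - y = Quad (quad_fst x - quad_fst y) (quad_snd x - quad_snd y)"
definition "x * y =
  Quad (quad_fst x * quad_fst y + snd quad_par * (quad_snd x * quad_snd y))
       (quad_fst x * quad_snd y + quad_snd x * quad_fst y
          + fst quad_par * (quad_snd x * quad_snd y))"

text \<open>\<open>n\<close> is the norm of \<open>x = a + b X\<close>, and \<open>a + u b - b X\<close> is its conjugate.\<close>
definition "inverse x =
  (let a = quad_fst x; b = quad_snd x; u = fst quad_par; v = snd quad_par;
       n = a\<^sup>2 + u * a * b - v * b\<^sup>2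
   in Quad ((a + u * b) / n) (- b / n))"
definition "x div (y :: 'a quad_ext) = x * inverse y"

instance
proof
  fix x y z :: "'a quad_ext"
  note defs = zero_quad_ext_def one_quad_ext_def plus_quad_ext_def uminus_quad_ext_def
    minus_quad_ext_def times_quad_ext_def
  show "x + y + z = x + (y + z)" "x + y = y + x" "0 + x = x" "- x + x = 0"
    "x - y = x + - y" "x * y * z = x * (y * z)" "x * y = y * x" "1 * x = x"
    "(x + y) * z = x * z + y * z" "(0 :: 'a quad_ext) \<noteq> 1"
    by (simp_all add: defs algebra_simps)
  show "inverse (0 :: 'a quad_ext) = 0"
    by (simp add: defs inverse_quad_ext_def)
  show "x div y = x * inverse y"
    by (rule divide_quad_ext_def)
  assume "x \<noteq> 0"
  obtain a b where x: "x = Quad a b" by (cases x)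
  obtain u v where par: "quad_par = (u, v :: 'a)" by (cases "quad_par :: 'a \<times> 'a")
  define n where "n = a\<^sup>2 + u * a * b - v * b\<^sup>2"
  have n: "n \<noteq> 0"
  proof (cases "b = 0")
    case True
    with \<open>x \<noteq> 0\<close> show ?thesis by (simp add: x n_def zero_quad_ext_def)
  next
    case False
    have "(- a / b)\<^sup>2 \<noteq> u * (- a / b) + v"
      using quad_par_no_root[of "- a / b"] by (simp add: par)
    with False show ?thesis
      by (auto simp: n_def field_simps power2_eq_square)
  qed
  have inv: "inverse x = Quad ((a + u * b) / n) (- b / n)"
    by (simp add: inverse_quad_ext_def x par n_def Let_def)
  have "(a + u * b) * a - v * (b * b) = n" by (simp add: n_def algebra_simps power2_eq_square)
  then have "(a + u * b) / n * a + v * (- b / n * b) = 1"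
    using n by (simp add: field_simps)
  moreover have "(a + u * b) / n * b + - b / n * a + u * (- b / n * b) = 0"
    using n by (simp add: field_simps)
  ultimately show "inverse x * x = 1"
    unfolding inv by (simp add: times_quad_ext_def x one_quad_ext_def par)
qed

end

lemma card_quad_ext: "CARD('a::finite quad_ext) = CARD('a)\<^sup>2"
proof -
  have "bij (\<lambda>(a, b). Quad a (b::'a))"
    by (auto simp: bij_def inj_on_def image_iff) (metis quad_ext.exhaust)
  then have "CARD('a \<times> 'a) = CARD('a quad_ext)" by (rule bij_betw_same_card)
  then show ?thesis by (simp add: power2_eq_square)
qed

text \<open>The space \<open>GF(q\<^sup>2)\<^sup>n\<close> regarded as a \<open>GF(q)\<close>-space, by restriction of scalars.\<close>
definition restr_scale :: "'a::{field,finite} \<Rightarrow> 'a quad_ext ^ 'n \<Rightarrow> 'a quad_ext ^ 'n"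
  where "restr_scale c x = Quad c 0 *s x"

lemma vector_space_restr_scale: "vector_space restr_scale"
  by unfold_locales
    (simp_all add: restr_scale_def vec_eq_iff one_quad_ext_def plus_quad_ext_def
      times_quad_ext_def algebra_simps)


section \<open>Quadratic forms\<close>

text \<open>
  Projective subspaces are represented by the corresponding vector subspaces, so that a
  line of \<open>PG(5,q)\<close> is a subspace of vector space dimension 2 of \<open>'a ^ 6\<close>, and two lines
  are disjoint iff they meet in \<open>{0}\<close>. A quadric is represented by a quadratic form.
\<close>

definition polar :: "('k::field ^ 'n \<Rightarrow> 'k) \<Rightarrow> 'k ^ 'n \<Rightarrow> 'k ^ 'n \<Rightarrow> 'k"
  where "polar Q x y = Q (x + y) - Q x - Q y"

definition quadratic_form :: "('k::field ^ 'n \<Rightarrow> 'k) \<Rightarrow> bool"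
  where "quadratic_form Q \<longleftrightarrow>
    (\<forall>c x. Q (c *s x) = c\<^sup>2 * Q x) \<and>
    (\<forall>y. Vector_Spaces.linear (*s) (*) (\<lambda>x. polar Q x y))"

definition nondegenerate :: "('k::field ^ 'n \<Rightarrow> 'k) \<Rightarrow> bool"
  where "nondegenerate Q \<longleftrightarrow> (\<forall>x. Q x = 0 \<and> (\<forall>y. polar Q x y = 0) \<longrightarrow> x = 0)"

text \<open>The subspaces of vector space dimension \<open>k\<close> contained in the quadric.\<close>
definition singular_subspaces :: "('k::field ^ 'n \<Rightarrow> 'k) \<Rightarrow> nat \<Rightarrow> ('k ^ 'n) set set"
  where "singular_subspaces Q k =
    {U. vec.subspace U \<and> vec.dim U = k \<and> (\<forall>x\<in>U. Q x = 0)}"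

definition witt_index :: "('k::field ^ 'n \<Rightarrow> 'k) \<Rightarrow> nat"
  where "witt_index Q = Max {k. singular_subspaces Q k \<noteq> {}}"

text \<open>\<open>Q\<^sup>-(5,q)\<close>: the non-degenerate quadrics of \<open>PG(5,q)\<close> containing lines but no planes.\<close>
definition elliptic :: "('a::field ^ 6 \<Rightarrow> 'a) \<Rightarrow> bool"
  where "elliptic Q \<longleftrightarrow> quadratic_form Q \<and> nondegenerate Q \<and> witt_index Q = 2"

definition perp :: "('k::field ^ 'n \<Rightarrow> 'k) \<Rightarrow> ('k ^ 'n) set \<Rightarrow> ('k ^ 'n) set"
  where "perp Q U = {x. \<forall>y\<in>U. polar Q x y = 0}"


section \<open>Pseudo-ovals and pseudo-conics\<close>

definition pseudo_oval :: "('a::{field,finite} ^ 6) set set \<Rightarrow> bool"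
  where "pseudo_oval S \<longleftrightarrow>
    (\<forall>l\<in>S. vec.subspace l \<and> vec.dim l = 2) \<and>
    card S = CARD('a)\<^sup>2 + 1 \<and>
    (\<forall>l\<in>S. \<forall>m\<in>S. \<forall>n\<in>S. l \<noteq> m \<and> l \<noteq> n \<and> m \<noteq> n \<longrightarrow> vec.span (l \<union> m \<union> n) = UNIV)"

text \<open>
  \<open>\<phi>\<close> combines an identification of \<open>GF(q\<^sup>2)\<^sup>3\<close> with \<open>GF(q)\<^sup>6\<close> and a projectivity of \<open>PG(5,q)\<close>;
  both range over all linear bijections.
\<close>
definition pseudo_conic :: "('a::{field,finite} ^ 6) set set \<Rightarrow> bool"
  where "pseudo_conic S \<longleftrightarrow> pseudo_oval S \<and>
    (\<exists>(C :: 'a quad_ext ^ 3 \<Rightarrow> 'a quad_ext) (\<phi> :: 'a quad_ext ^ 3 \<Rightarrow> 'a ^ 6).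
       quadratic_form C \<and> nondegenerate C \<and>
       Vector_Spaces.linear restr_scale (*s) \<phi> \<and> bij \<phi> \<and>
       S = (\<lambda>p. \<phi> ` p) ` singular_subspaces C 1)"


section \<open>The association scheme\<close>

definition in_perspective ::
    "('a::field ^ 6 \<Rightarrow> 'a) \<Rightarrow> ('a ^ 6) set \<Rightarrow> ('a ^ 6) set \<Rightarrow> ('a ^ 6) set \<Rightarrow> bool"
  where "in_perspective Q l1 l2 l3 \<longleftrightarrow>
    l1 \<in> singular_subspaces Q 2 \<and> l2 \<in> singular_subspaces Q 2 \<and> l3 \<in> singular_subspaces Q 2 \<and>
    l1 \<inter> l2 = {0} \<and> l1 \<inter> l3 = {0} \<and> l2 \<inter> l3 = {0} \<and>
    vec.span (l1 \<union> l2 \<union> l3) = UNIV \<and>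
    (let T1 = perp Q l1; T2 = perp Q l2; T3 = perp Q l3;
         s1 = T2 \<inter> T3; s2 = T1 \<inter> T3; s3 = T1 \<inter> T2
     in vec.dim (vec.span (s1 \<union> l1) \<inter> vec.span (s2 \<union> l2) \<inter> vec.span (s3 \<union> l3)) = 2)"

definition scheme_points :: "('a::field ^ 6 \<Rightarrow> 'a) \<Rightarrow> ('a ^ 6) set \<Rightarrow> ('a ^ 6) set set"
  where "scheme_points Q l = {m \<in> singular_subspaces Q 2. l \<inter> m = {0}}"

text \<open>
  The condition \<open>m \<noteq> n\<close> in the relation with index 2 is needed because \<open>\<langle>l,m,m\<rangle>\<close> also
  has dimension 4.
\<close>
definition scheme_rel ::
    "('a::field ^ 6 \<Rightarrow> 'a) \<Rightarrow> ('a ^ 6) set \<Rightarrow> nat \<Rightarrow> (('a ^ 6) set \<times> ('a ^ 6) set) set"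
  where "scheme_rel Q l i =
    {(m, n). m \<in> scheme_points Q l \<and> n \<in> scheme_points Q l \<and>
      [m = n,
       vec.dim (m \<inter> n) = 1,
       m \<noteq> n \<and> vec.dim (l \<union> m \<union> n) = 4,
       m \<inter> n = {0} \<and> vec.dim (l \<union> m \<union> n) = 5,
       vec.span (l \<union> m \<union> n) = UNIV \<and> \<not> in_perspective Q l m n,
       vec.span (l \<union> m \<union> n) = UNIV \<and> in_perspective Q l m n] ! i}"

text \<open>Row \<open>i\<close>, column \<open>j\<close> of the dual eigenmatrix.\<close>
definition dual_eigenmatrix :: "real \<Rightarrow> nat \<Rightarrow> nat \<Rightarrow> real"
  where "dual_eigenmatrix q i j =
    [[1, (q-1)*(q+1)^2, q^3*(q-1), q*(q-1)^2*(q+1), q^2*(q-1)^3/2, q^2*(q+1)*(q-1)^2/2],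
     [1, q^2-q-1, q^3*(q-1)/(q+1), -q*(q-1), -(q^2*(q-1)^2/(2*(q+1))), -(q^2*(q-1)/2)],
     [1, (q-1)*(q+1)^2, -(q^3), q*(q-1)^2*(q+1), -(q^2*(q-1)^2/2), -(q^2*(q+1)*(q-1)/2)],
     [1, q^2-q-1, -(q^3/(q+1)), -q*(q-1), q^2*(q-1)/(2*(q+1)), q^2/2],
     [1, -q-1, 0, q, -(q^2/2), q^2/2],
     [1, -q-1, 0, q, q^2*(q-1)/2, -(q^2*(q-1)/2)]] ! i ! j"

text \<open>Matrices with rows and columns indexed by lines are represented as binary functions.\<close>

definition adj_matrix ::
    "('a::field ^ 6 \<Rightarrow> 'a) \<Rightarrow> ('a ^ 6) set \<Rightarrow> nat \<Rightarrow> ('a ^ 6) set \<Rightarrow> ('a ^ 6) set \<Rightarrow> real"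
  where "adj_matrix Q l i m n = of_bool ((m, n) \<in> scheme_rel Q l i)"

definition idempotent_matrix ::
    "('a::{field,finite} ^ 6 \<Rightarrow> 'a) \<Rightarrow> ('a ^ 6) set \<Rightarrow> nat \<Rightarrow> ('a ^ 6) set \<Rightarrow> ('a ^ 6) set \<Rightarrow> real"
  where "idempotent_matrix Q l j m n =
    1 / real CARD('a) ^ 5 *
      (\<Sum>i\<le>5. dual_eigenmatrix (real CARD('a)) i j * adj_matrix Q l i m n)"

definition scheme_clique ::
    "('a::field ^ 6 \<Rightarrow> 'a) \<Rightarrow> ('a ^ 6) set \<Rightarrow> nat set \<Rightarrow> ('a ^ 6) set set \<Rightarrow> bool"
  where "scheme_clique Q l M Y \<longleftrightarrow>
    Y \<noteq> {} \<and> Y \<subseteq> scheme_points Q l \<and> (\<forall>i\<in>{0..5} - M. scheme_rel Q l i \<inter> Y \<times> Y = {})"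

definition scheme_design ::
    "('a::{field,finite} ^ 6 \<Rightarrow> 'a) \<Rightarrow> ('a ^ 6) set \<Rightarrow> nat set \<Rightarrow> ('a ^ 6) set set \<Rightarrow> bool"
  where "scheme_design Q l T Y \<longleftrightarrow>
    Y \<noteq> {} \<and> Y \<subseteq> scheme_points Q l \<and>
    (\<forall>j\<in>T. \<forall>n\<in>scheme_points Q l.
       (\<Sum>m\<in>scheme_points Q l. indicator Y m * idempotent_matrix Q l j m n) = 0)"

end

theory Submission
  imports Defs
begin

text \<open>
  Fix \<open>l = \<langle>e1, e2\<rangle>\<close> and a line \<open>\<langle>o1, o2\<rangle>\<close> of the quadric with bases dual under the polar form \<open>B\<close>; then
  \<open>V = l \<oplus> \<langle>o1, o2\<rangle> \<oplus> U\<^sub>0\<close> with \<open>U\<^sub>0\<close> an anisotropic plane of \<open>q\<^sup>2\<close> vectors. A line \<open>m\<close> disjoint from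
  \<open>l\<close> has a unique basis dual to \<open>e1, e2\<close>; let \<open>h1 m, h2 m \<in> U\<^sub>0\<close> be its \<open>U\<^sub>0\<close>-components. The relation of
  \<open>m\<close> and \<open>n\<close> is determined by the rank of \<open>(h1 m - h1 n, h2 m - h2 n)\<close> and by whether the matrix of \<open>B\<close>
  between the dual bases is symmetric, which expresses the perspective condition.

  For \<open>Y = S - {l}\<close> the differences have rank 2, so \<open>m \<mapsto> a h1 m + b h2 m\<close> is a bijection from \<open>Y\<close> onto
  \<open>U\<^sub>0\<close> for all \<open>(a, b) \<noteq> (0, 0)\<close>; counting gives the design property for \<open>E\<^sub>1\<close>. The entries of \<open>E\<^sub>5\<close> at
  elements of \<open>Y\<close> force all pairs to be in perspective. Conversely, if all pairs are in perspective,
  then \<open>h2 m = \<tau> (h1 m)\<close> for a self-adjoint \<open>\<tau>\<close> on \<open>U\<^sub>0\<close> without eigenvectors, the \<open>E\<^sub>5\<close> condition becomes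
  a count of the points of an affine line of \<open>U\<^sub>0\<close>, and \<open>\<tau>\<close> generates a copy of \<open>GF(q\<^sup>2)\<close> over which \<open>S\<close> is
  the conic \<open>x z = g y\<^sup>2\<close>. For a pseudo-conic, the form \<open>B\<close> between two points \<open>K s\<close> and \<open>K e\<close> of the conic
  over \<open>K = GF(q\<^sup>2)\<close> is \<open>(x, y) \<mapsto> L (x y)\<close> for a functional \<open>L\<close>, and symmetry of the product yields the
  perspective condition.
\<close>

section \<open>Counting and quadratic forms over finite fields\<close>

text \<open>Translation by 1 permutes the field, so comparing the sum of all elements with the sum
  of their translates shows that the number of elements is 0 in the field. If 2 were 0, an odd
  number would be 1 there.\<close>

lemma two_neq_zero:
  assumes "odd CARD('k::{field,finite})"
  shows "(2::'k) \<noteq> 0"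
proof
  assume 2: "(2::'k) = 0"
  have "(\<Sum>x\<in>(UNIV::'k set). x) = (\<Sum>x\<in>(UNIV::'k set). x + 1)"
    by (rule sum.reindex_bij_witness[where i = "\<lambda>x. x + 1" and j = "\<lambda>x. x - 1"]) auto
  then have "(of_nat CARD('k) :: 'k) = 0"
    by (simp add: sum.distrib)
  moreover obtain k where "CARD('k) = 2 * k + 1"
    using assms by (rule oddE)
  ultimately show False
    using 2 by simp
qed

text \<open>Every non-empty fibre is a translate of the kernel.\<close>

lemma card_eq_card_range_times_card_kernel:
  fixes f :: "'v::{ab_group_add,finite} \<Rightarrow> 'w::ab_group_add"
  assumes "\<And>x y. f (x + y) = f x + f y"
  shows "CARD('v) = card (range f) * card {x. f x = 0}"
proof -
  have *: "card {x. f x = y} = card {x. f x = 0}" if y: "y \<in> range f" for y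
  proof -
    obtain a where a: "y = f a" using y by auto
    have m: "f (x - a) = f x - f a" for x
      using assms[of "x - a" a] by simp
    have "bij_betw (\<lambda>x. x - a) {x. f x = y} {x. f x = 0}"
      by (rule bij_betw_byWitness[where f' = "\<lambda>x. x + a"]) (auto simp: assms m a)
    then show ?thesis by (rule bij_betw_same_card)
  qed
  have "CARD('v) = (\<Sum>y\<in>range f. card {x. f x = y})"
    by (subst card_UN_disjoint[symmetric]) (auto intro!: arg_cong[where f = card])
  also have "\<dots> = card (range f) * card {x. f x = 0}"
    by (simp add: *)
  finally show ?thesis .
qed

lemma card_subspace:
  fixes U :: "('k::{field,finite} ^ 'n) set"
  assumes U: "vec.subspace U"
  shows "card U = CARD('k) ^ vec.dim U"
proof -
  obtain B where B: "B \<subseteq> U" "vec.independent B" "U \<subseteq> vec.span B" "card B = vec.dim U"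
    using vec.basis_exists by blast
  have UB: "U = vec.span B"
    using B U by (simp add: vec.span_minimal subset_antisym)
  have fin: "finite B" by simp
  let ?f = "\<lambda>c. \<Sum>v\<in>B. c v *s v"
  have "bij_betw ?f (B \<rightarrow>\<^sub>E UNIV) U"
  proof (rule bij_betwI')
    fix c d assume c: "c \<in> B \<rightarrow>\<^sub>E (UNIV::'k set)" and d: "d \<in> B \<rightarrow>\<^sub>E (UNIV::'k set)"
    show "(?f c = ?f d) = (c = d)"
    proof
      assume "?f c = ?f d"
      then have "(\<Sum>v\<in>B. (c v - d v) *s v) = 0"
        by (simp add: vec.scale_left_diff_distrib sum_subtractf)
      then have "\<forall>v\<in>B. c v - d v = 0"
        by (rule_tac ballI) (rule vec.independentD[OF B(2) fin subset_refl])
      then have "\<And>v. v \<in> B \<Longrightarrow> c v = d v" by simp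
      with c d show "c = d" by (rule PiE_ext)
    qed auto
  next
    fix c show "?f c \<in> U"
      unfolding UB by (intro vec.span_sum vec.span_scale vec.span_base)
  next
    fix y assume "y \<in> U"
    then obtain c where "y = ?f c"
      using UB vec.span_finite[OF fin] by auto
    then have "y = ?f (restrict c B)" by simp
    moreover have "restrict c B \<in> B \<rightarrow>\<^sub>E UNIV" by auto
    ultimately show "\<exists>x\<in>B \<rightarrow>\<^sub>E UNIV. y = ?f x" by blast
  qed
  then have "card U = card (B \<rightarrow>\<^sub>E (UNIV::'k set))"
    by (simp add: bij_betw_same_card)
  then show ?thesis
    using B(4) fin by (simp add: card_PiE)
qed

lemma card_gt_1: "1 < CARD('k::{field,finite})"
proof -
  have "card {0, 1::'k} \<le> CARD('k)" by (rule card_mono) auto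
  then show ?thesis by simp
qed

text \<open>Most dimensions below are found by counting vectors; since q > 1, the exponent of q is
  determined by the count.\<close>

lemma dim_eq_iff_card_eq:
  fixes U :: "('k::{field,finite} ^ 'n) set"
  assumes "vec.subspace U"
  shows "vec.dim U = d \<longleftrightarrow> card U = CARD('k) ^ d"
  using card_subspace[OF assms] card_gt_1[where 'k='k] by simp

section \<open>Subspaces generated by two vectors\<close>

definition lin :: "'k::field ^ 'n \<Rightarrow> 'k ^ 'n \<Rightarrow> ('k ^ 'n) set"
  where "lin a b = range (\<lambda>(x, y). x *s a + y *s b)"

lemma lin_memI [intro]: "x *s a + y *s b \<in> lin a b"
  by (auto simp: lin_def)

lemma lin_memE:
  assumes "v \<in> lin a b"
  obtains x y where "v = x *s a + y *s b"
  using assms by (auto simp: lin_def)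

lemma lin_generators: "a \<in> lin a b" "b \<in> lin a b"
  using lin_memI[of 1 a 0 b] lin_memI[of 0 a 1 b] by simp_all

lemma subspace_lin: "vec.subspace (lin a b)"
proof (rule vec.subspaceI)
  show "0 \<in> lin a b" using lin_memI[of 0 a 0 b] by simp
next
  fix v w assume "v \<in> lin a b" "w \<in> lin a b"
  then obtain x y x' y' where "v = x *s a + y *s b" "w = x' *s a + y' *s b"
    by (auto elim!: lin_memE)
  then have "v + w = (x + x') *s a + (y + y') *s b"
    by (simp add: vec.scale_left_distrib)
  then show "v + w \<in> lin a b" by (metis lin_memI)
next
  fix c v assume "v \<in> lin a b"
  then obtain x y where "v = x *s a + y *s b"
    by (auto elim!: lin_memE)
  then have "c *s v = (c * x) *s a + (c * y) *s b"
    by (simp add: vec.scale_right_distrib)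
  then show "c *s v \<in> lin a b" by (metis lin_memI)
qed

lemma lin_subset: "vec.subspace U \<Longrightarrow> a \<in> U \<Longrightarrow> b \<in> U \<Longrightarrow> lin a b \<subseteq> U"
  by (auto simp: lin_def intro!: vec.subspace_add vec.subspace_scale)

lemma card_lin:
  fixes a b :: "'k::{field,finite} ^ 'n"
  assumes "\<And>x y. x *s a + y *s b = 0 \<Longrightarrow> x = 0 \<and> y = 0"
  shows "card (lin a b) = CARD('k)\<^sup>2"
proof -
  have "inj (\<lambda>(x, y). x *s a + y *s b)"
  proof (rule injI, clarsimp)
    fix x y x' y' assume "x *s a + y *s b = x' *s a + y' *s b"
    then have "(x - x') *s a + (y - y') *s b = 0"
      by (simp add: vec.scale_left_diff_distrib algebra_simps)
    then show "x = x' \<and> y = y'" using assms by fastforce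
  qed
  then show ?thesis by (simp add: lin_def card_image power2_eq_square)
qed

lemma dim_lin:
  fixes a b :: "'k::{field,finite} ^ 'n"
  assumes "\<And>x y. x *s a + y *s b = 0 \<Longrightarrow> x = 0 \<and> y = 0"
  shows "vec.dim (lin a b) = 2"
  using card_lin[OF assms] by (simp add: dim_eq_iff_card_eq subspace_lin)

lemma lin_eq:
  fixes a b :: "'k::{field,finite} ^ 'n"
  assumes "vec.subspace U" "vec.dim U = 2" "a \<in> U" "b \<in> U"
    and "\<And>x y. x *s a + y *s b = 0 \<Longrightarrow> x = 0 \<and> y = 0"
  shows "U = lin a b"
  using lin_subset[OF assms(1,3,4)] dim_lin[OF assms(5)] assms(1,2)
  by (metis vec.subspace_dim_equal order_refl subspace_lin)

section \<open>Non-degenerate quadratic spaces with 2 invertible\<close>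

locale quadratic_space =
  fixes Q :: "'k::{field,finite} ^ 'n \<Rightarrow> 'k"
  assumes form: "quadratic_form Q"
    and nondeg: "nondegenerate Q"
    and two: "(2::'k) \<noteq> 0"
begin

abbreviation B where "B \<equiv> polar Q"

lemma Q_scale [simp]: "Q (c *s x) = c\<^sup>2 * Q x"
  using form by (simp add: quadratic_form_def)

lemma Q_zero [simp]: "Q 0 = 0"
  using Q_scale[of 0 0] by simp

lemma Q_add: "Q (x + y) = Q x + Q y + B x y"
  by (simp add: polar_def)

lemma B_commute: "B x y = B y x"
  by (simp add: polar_def add.commute)

lemma B_self [simp]: "B x x = 2 * Q x"
proof -
  have "x + x = 2 *s x"
    by (metis one_add_one vec.scale_left_distrib vec.scale_one)
  then show ?thesis by (simp add: polar_def)
qed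

lemma B_left: "B (x + x') y = B x y + B x' y" "B (c *s x) y = c * B x y"
  using form by (simp_all add: quadratic_form_def Vector_Spaces.linear_iff)

lemma B_right: "B y (x + x') = B y x + B y x'" "B y (c *s x) = c * B y x"
  by (simp_all add: B_left B_commute[of y])

lemma B_0 [simp]: "B 0 y = 0" "B y 0 = 0"
  using B_left(2)[of 0 0 y] B_right(2)[of y 0 0] by simp_all

lemma B_minus [simp]: "B (- x) y = - B x y" "B y (- x) = - B y x"
  using B_left(2)[of "-1" x y] B_right(2)[of y "-1" x] by simp_all

lemma B_diff: "B (x - x') y = B x y - B x' y" "B y (x - x') = B y x - B y x'"
  using B_left(1)[of x "- x'" y] B_right(1)[of y x "- x'"] by simp_all

lemmas B_linear = B_left B_right B_diff

lemma Q_minus [simp]: "Q (- x) = Q x"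
  using Q_scale[of "-1" x] by simp

lemma Q_diff: "Q (x - y) = Q x + Q y - B x y"
  using Q_add[of x "- y"] by simp

text \<open>\<open>nondegenerate\<close> speaks only of singular vectors in the radical; as
  \<open>B x x = 2 * Q x\<close> and 2 is invertible, every vector of the radical is
  singular.\<close>

lemma radical: "(\<And>y. B x y = 0) \<Longrightarrow> x = 0"
  using nondeg two B_self[of x] unfolding nondegenerate_def by (metis mult_eq_0_iff)

lemma subspace_perp: "vec.subspace (perp Q U)"
  by (rule vec.subspaceI) (auto simp: perp_def B_linear)

lemma perp_lin: "x \<in> perp Q (lin a b) \<longleftrightarrow> B x a = 0 \<and> B x b = 0"
  by (auto simp: perp_def B_linear lin_generators elim!: lin_memE)

lemma B_singular:
  assumes "U \<in> singular_subspaces Q k" "x \<in> U" "y \<in> U"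
  shows "B x y = 0"
  using assms by (auto simp: singular_subspaces_def polar_def vec.subspace_add)

lemma lin_singular:
  assumes "Q a = 0" "Q b = 0" "B a b = 0"
    and "\<And>x y. x *s a + y *s b = 0 \<Longrightarrow> x = 0 \<and> y = 0"
  shows "lin a b \<in> singular_subspaces Q 2"
  using assms dim_lin[OF assms(4)] subspace_lin[of a b]
  by (auto simp: singular_subspaces_def Q_add B_linear elim!: lin_memE)

end

locale elliptic_quadric =
  fixes Q :: "'a::{field,finite} ^ 6 \<Rightarrow> 'a"
  assumes elliptic: "elliptic Q"
    and odd: "odd CARD('a)"

sublocale elliptic_quadric \<subseteq> quadratic_space Q
  using elliptic two_neq_zero[OF odd] by unfold_locales (auto simp: elliptic_def)

context elliptic_quadric
begin

lemma dim_singular_le: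
  assumes "singular_subspaces Q k \<noteq> {}"
  shows "k \<le> 2"
proof -
  \<comment> \<open>\<open>Max\<close> bounds its elements only on a finite set, and the dimension 6
    of the whole space makes the set finite.\<close>
  have "{k. singular_subspaces Q k \<noteq> {}} \<subseteq> {..6}"
  proof
    fix k assume "k \<in> {k. singular_subspaces Q k \<noteq> {}}"
    then obtain U where "U \<in> singular_subspaces Q k" by blast
    then have "k = vec.dim U" by (simp add: singular_subspaces_def)
    also have "\<dots> \<le> vec.dim (UNIV :: ('a^6) set)" by (rule vec.dim_subset) simp
    also have "vec.dim (UNIV :: ('a^6) set) = 6"
      by (subst dim_eq_iff_card_eq) simp_all
    finally show "k \<in> {..6}" by simp
  qed
  then have "finite {k. singular_subspaces Q k \<noteq> {}}"
    by (rule finite_subset) simp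
  then have "k \<le> Max {k. singular_subspaces Q k \<noteq> {}}"
    using assms by (intro Max_ge) auto
  then show ?thesis using elliptic by (simp add: elliptic_def witt_index_def)
qed

text \<open>Otherwise \<open>l\<close> and \<open>x\<close> would generate a totally singular
  subspace of dimension 3, which Witt index 2 excludes. This is how ellipticity enters the geometry
  of lines disjoint from \<open>l\<close>.\<close>

lemma singular_in_line:
  assumes l: "l \<in> singular_subspaces Q 2" and x: "Q x = 0" and xl: "x \<in> perp Q l"
  shows "x \<in> l"
proof (rule ccontr)
  assume n: "x \<notin> l"
  have sub: "vec.subspace l" and dim: "vec.dim l = 2" and sing: "\<And>y. y \<in> l \<Longrightarrow> Q y = 0"
    using l by (auto simp: singular_subspaces_def)
  have span: "vec.span l = l" using sub by simp
  have "vec.dim (vec.span (insert x l)) = 3"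
    using n dim by (simp add: vec.dim_insert span)
  moreover have "Q y = 0" if y: "y \<in> vec.span (insert x l)" for y
  proof -
    obtain c where c: "y - c *s x \<in> l"
      using y span by (auto simp: vec.span_insert)
    then have "B x (y - c *s x) = 0"
      using xl by (simp add: perp_def)
    then have "Q (c *s x + (y - c *s x)) = 0"
      using x sing[OF c] by (simp only: Q_add) (simp add: B_left)
    then show ?thesis by simp
  qed
  ultimately have "vec.span (insert x l) \<in> singular_subspaces Q 3"
    by (simp add: singular_subspaces_def)
  then show False using dim_singular_le[of 3] by auto
qed

end

section \<open>Lines disjoint from a line of the quadric\<close>

text \<open>A form of \<open>in_perspective\<close> that needs neither the spanning condition nor dimensions:
  identify \<open>m\<close> with \<open>n\<close> through the dual of \<open>l\<close>; then \<open>B\<close> restricted to \<open>m \<times> n\<close> is symmetric.\<close>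

definition perspective ::
    "('k::field ^ 'n \<Rightarrow> 'k) \<Rightarrow> ('k ^ 'n) set \<Rightarrow> ('k ^ 'n) set \<Rightarrow> ('k ^ 'n) set \<Rightarrow> bool"
  where "perspective Q l m n \<longleftrightarrow>
    (\<forall>x\<in>m. \<forall>x'\<in>m. \<forall>y\<in>n. \<forall>y'\<in>n.
       x - y \<in> perp Q l \<and> x' - y' \<in> perp Q l \<longrightarrow> polar Q x y' = polar Q x' y)"

section \<open>Two hyperbolic pairs and their anisotropic complement\<close>

locale frame = elliptic_quadric Q for Q :: "'a::{field,finite} ^ 6 \<Rightarrow> 'a" +
  fixes e1 e2 o1 o2 :: "'a ^ 6"
  assumes singular [simp]: "Q e1 = 0" "Q e2 = 0" "Q o1 = 0" "Q o2 = 0"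
    and ee [simp]: "B e1 e2 = 0" and oo [simp]: "B o1 o2 = 0"
    and eo [simp]: "B e1 o1 = 1" "B e1 o2 = 0" "B e2 o1 = 0" "B e2 o2 = 1"
begin

lemma frame_products [simp]:
  "B e2 e1 = 0" "B o2 o1 = 0" "B o1 e1 = 1" "B o2 e1 = 0" "B o1 e2 = 0" "B o2 e2 = 1"
  by (metis B_commute ee oo eo)+

abbreviation l where "l \<equiv> lin e1 e2"

lemma e_independent: "x *s e1 + y *s e2 = 0 \<Longrightarrow> x = 0 \<and> y = 0"
proof -
  assume *: "x *s e1 + y *s e2 = 0"
  show ?thesis
    using arg_cong[OF *, of "\<lambda>v. B v o1"] arg_cong[OF *, of "\<lambda>v. B v o2"]
    by (simp add: B_linear)
qed

lemma o_independent: "x *s o1 + y *s o2 = 0 \<Longrightarrow> x = 0 \<and> y = 0"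
proof -
  assume *: "x *s o1 + y *s o2 = 0"
  show ?thesis
    using arg_cong[OF *, of "\<lambda>v. B v e1"] arg_cong[OF *, of "\<lambda>v. B v e2"]
    by (simp add: B_linear)
qed

lemma l_singular: "l \<in> singular_subspaces Q 2"
  by (rule lin_singular) (auto dest: e_independent)

lemma o_singular: "lin o1 o2 \<in> singular_subspaces Q 2"
  by (rule lin_singular) (auto dest: o_independent)

lemma l_coords: "x \<in> l \<Longrightarrow> x = B x o1 *s e1 + B x o2 *s e2"
  by (auto simp: B_linear elim!: lin_memE)

lemma l_perp: "x \<in> l \<Longrightarrow> B x e1 = 0 \<and> B x e2 = 0"
  by (auto simp: B_linear elim!: lin_memE)

lemma o_in_scheme_points: "lin o1 o2 \<in> scheme_points Q l"
proof -
  have "x = 0" if "x \<in> l" "x \<in> lin o1 o2" for x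
    using that(2) l_perp[OF that(1)] by (auto simp: B_linear elim!: lin_memE)
  moreover have "0 \<in> l" "0 \<in> lin o1 o2"
    by (auto intro: vec.subspace_0 subspace_lin)
  ultimately show ?thesis
    using o_singular by (auto simp: scheme_points_def)
qed

definition U\<^sub>0 where "U\<^sub>0 = {x. B x e1 = 0 \<and> B x e2 = 0 \<and> B x o1 = 0 \<and> B x o2 = 0}"

text \<open>The orthogonal projection onto \<open>U\<^sub>0\<close>: the coefficient of each frame
  vector is the product with its hyperbolic partner.\<close>

definition h where
  "h x = x - (B x o1 *s e1 + B x o2 *s e2 + B x e1 *s o1 + B x e2 *s o2)"

lemma decompose: "x = B x o1 *s e1 + B x o2 *s e2 + B x e1 *s o1 + B x e2 *s o2 + h x"
  by (simp add: h_def)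

lemma h_in_U [simp]: "h x \<in> U\<^sub>0"
  by (simp add: U\<^sub>0_def h_def B_linear)

lemma h_add: "h (x + y) = h x + h y"
  by (simp add: h_def B_linear vec.scale_left_distrib)

lemma h_scale: "h (c *s x) = c *s h x"
  by (simp add: h_def B_linear vec.scale_right_distrib vec.scale_right_diff_distrib)

lemma h_diff: "h (x - y) = h x - h y"
  by (simp add: h_def B_linear vec.scale_left_diff_distrib)

lemma h_U: "x \<in> U\<^sub>0 \<Longrightarrow> h x = x"
  by (simp add: h_def U\<^sub>0_def)

lemma h_l: "x \<in> l \<Longrightarrow> h x = 0"
  using l_coords[of x] by (simp add: h_def l_perp)

lemma h_zero_in_l: "h x = 0 \<Longrightarrow> B x e1 = 0 \<Longrightarrow> B x e2 = 0 \<Longrightarrow> x \<in> l"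
  using decompose[of x] lin_memI[of "B x o1" e1 "B x o2" e2] by simp

lemma subspace_U: "vec.subspace U\<^sub>0"
  by (rule vec.subspaceI) (auto simp: U\<^sub>0_def B_linear)

text \<open>Vectors of \<open>U\<^sub>0\<close> are orthogonal to \<open>l\<close>, so a singular
  one lies in \<open>l\<close>; its coordinates there are its products with \<open>o1\<close> and
  \<open>o2\<close>, which vanish.\<close>

lemma U_anisotropic:
  assumes "x \<in> U\<^sub>0" "Q x = 0"
  shows "x = 0"
proof -
  have "x \<in> l"
    using assms by (intro singular_in_line[OF l_singular]) (auto simp: perp_lin U\<^sub>0_def)
  then show ?thesis
    using l_coords[of x] assms by (simp add: U\<^sub>0_def)
qed

text \<open>The four frame vectors account for a factor q^4 of the q^6 vectors.\<close>

lemma card_U: "card U\<^sub>0 = CARD('a)\<^sup>2"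
proof -
  let ?f = "\<lambda>((a, b, c, d), w). a *s e1 + b *s e2 + c *s o1 + d *s o2 + w"
  have "bij_betw ?f (UNIV \<times> U\<^sub>0) UNIV"
    by (rule bij_betw_byWitness[where f' = "\<lambda>x. ((B x o1, B x o2, B x e1, B x e2), h x)"])
      (auto simp: U\<^sub>0_def B_linear h_def)
  then have "card ((UNIV :: ('a\<times>'a\<times>'a\<times>'a) set) \<times> U\<^sub>0) = CARD('a ^ 6)"
    by (rule bij_betw_same_card)
  then have "CARD('a) ^ 4 * card U\<^sub>0 = CARD('a) ^ (4 + 2)"
    by (simp add: card_cartesian_product) (simp add: eval_nat_numeral)
  then have "CARD('a) ^ 4 * card U\<^sub>0 = CARD('a) ^ 4 * CARD('a)\<^sup>2"
    by (simp only: power_add)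
  then show ?thesis
    by (simp only: mult_cancel1) simp
qed

section \<open>Dual bases of the lines disjoint from \<open>l\<close>\<close>

lemma scheme_pointD:
  assumes "m \<in> scheme_points Q l"
  shows "m \<in> singular_subspaces Q 2" "vec.subspace m" "vec.dim m = 2"
    "\<And>x. x \<in> m \<Longrightarrow> Q x = 0" "\<And>x. x \<in> m \<Longrightarrow> x \<in> l \<Longrightarrow> x = 0"
  using assms by (auto simp: scheme_points_def singular_subspaces_def)

lemma scheme_point_zero:
  assumes "m \<in> scheme_points Q l" "x \<in> m" "B x e1 = 0" "B x e2 = 0"
  shows "x = 0"
  using assms scheme_pointD[OF assms(1)] singular_in_line[OF l_singular] by (auto simp: perp_lin)

text \<open>A vector of \<open>m\<close> orthogonal to \<open>l\<close> lies in both lines and is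
  zero, so taking products with \<open>e1\<close> and \<open>e2\<close> is injective on
  \<open>m\<close>; both sides have q^2 elements.\<close>

lemma scheme_point_lift:
  assumes m: "m \<in> scheme_points Q l"
  shows "\<exists>!x. x \<in> m \<and> B x e1 = a \<and> B x e2 = b"
proof -
  let ?f = "\<lambda>x. (B x e1, B x e2)"
  have inj: "inj_on ?f m"
  proof (rule inj_onI)
    fix x y assume "x \<in> m" "y \<in> m" "?f x = ?f y"
    then show "x = y"
      using scheme_point_zero[OF m, of "x - y"] scheme_pointD(2)[OF m]
      by (simp add: B_linear vec.subspace_diff)
  qed
  have "card m = CARD('a)\<^sup>2"
    using scheme_pointD[OF m] by (simp add: card_subspace)
  then have "card (?f ` m) = CARD('a \<times> 'a)"
    using inj by (simp add: card_image power2_eq_square)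
  then have "?f ` m = UNIV"
    by (intro card_subset_eq) auto
  then have "(a, b) \<in> ?f ` m" by simp
  then obtain x where "x \<in> m" "?f x = (a, b)" by auto
  then show ?thesis
    using inj by (auto simp: inj_on_def)
qed

text \<open>Coordinatises all lines disjoint from \<open>l\<close> by the dual of \<open>l\<close>,
  and thereby identifies them with each other. The basis of \<open>m\<close> dual to
  \<open>e1, e2\<close> is \<open>lift m 1 0, lift m 0 1\<close>.\<close>

definition lift where "lift m a b = (THE x. x \<in> m \<and> B x e1 = a \<and> B x e2 = b)"

lemma lift:
  assumes "m \<in> scheme_points Q l"
  shows "lift m a b \<in> m" "B (lift m a b) e1 = a" "B (lift m a b) e2 = b"
  using theI'[OF scheme_point_lift[OF assms, of a b]] by (simp_all add: lift_def)

lemma lift_unique: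
  assumes "m \<in> scheme_points Q l" "x \<in> m"
  shows "x = lift m (B x e1) (B x e2)"
  using scheme_point_lift[OF assms(1)] lift[OF assms(1)] assms(2) by metis

lemma lift_linear:
  assumes "m \<in> scheme_points Q l"
  shows "lift m (a + a') (b + b') = lift m a b + lift m a' b'"
    "lift m (c * a) (c * b) = c *s lift m a b"
    "lift m (a - a') (b - b') = lift m a b - lift m a' b'"
    "lift m 0 0 = 0"
proof -
  have "x = lift m a b" if "x \<in> m" "B x e1 = a" "B x e2 = b" for x a b
    using lift_unique[OF assms that(1)] that by simp
  note * = this
  show "lift m (a + a') (b + b') = lift m a b + lift m a' b'"
    "lift m (c * a) (c * b) = c *s lift m a b"
    "lift m (a - a') (b - b') = lift m a b - lift m a' b'"
    "lift m 0 0 = 0"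
    by (rule *[symmetric]; simp add: lift[OF assms] B_linear scheme_pointD[OF assms]
        vec.subspace_add vec.subspace_scale vec.subspace_diff vec.subspace_0)+
qed

lemma lift_basis:
  assumes "m \<in> scheme_points Q l"
  shows "lift m a b = a *s lift m 1 0 + b *s lift m 0 1"
  using lift_linear(1)[OF assms, of a 0 0 b] lift_linear(2)[OF assms, of a 1 0]
    lift_linear(2)[OF assms, of b 0 1] by simp

lemma scheme_point_eq_lin:
  assumes "m \<in> scheme_points Q l"
  shows "m = lin (lift m 1 0) (lift m 0 1)"
proof
  show "m \<subseteq> lin (lift m 1 0) (lift m 0 1)"
  proof
    fix x assume "x \<in> m"
    then have "x = B x e1 *s lift m 1 0 + B x e2 *s lift m 0 1"
      using lift_unique[OF assms] lift_basis[OF assms, of "B x e1" "B x e2"] by simp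
    then show "x \<in> lin (lift m 1 0) (lift m 0 1)" by (metis lin_memI)
  qed
  show "lin (lift m 1 0) (lift m 0 1) \<subseteq> m"
    by (intro lin_subset lift scheme_pointD assms)
qed

lemma B_lift_same:
  assumes "m \<in> scheme_points Q l"
  shows "B (lift m a b) (lift m c d) = 0"
  using B_singular[OF scheme_pointD(1)[OF assms]] lift[OF assms] by blast

lemma B_l_lift:
  assumes "m \<in> scheme_points Q l" "x \<in> l"
  shows "B x (lift m a b) = a * B x o1 + b * B x o2"
  by (subst l_coords[OF assms(2)])
    (simp add: B_linear lift[OF assms(1)] B_commute[of e1] B_commute[of e2])

text \<open>The condition \<open>x - y \<in> perp Q l\<close> says that \<open>x\<close> and
  \<open>y\<close> have the same coordinates. What remains is symmetry of a 2 by 2 matrix, that is,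
  equality of its two off-diagonal entries.\<close>

lemma perspective_iff:
  assumes m: "m \<in> scheme_points Q l" and n: "n \<in> scheme_points Q l"
  shows "perspective Q l m n \<longleftrightarrow>
    B (lift m 1 0) (lift n 0 1) = B (lift m 0 1) (lift n 1 0)"
proof
  assume "perspective Q l m n"
  then show "B (lift m 1 0) (lift n 0 1) = B (lift m 0 1) (lift n 1 0)"
    unfolding perspective_def using lift[OF m] lift[OF n] by (auto simp: perp_lin B_linear)
next
  assume sym: "B (lift m 1 0) (lift n 0 1) = B (lift m 0 1) (lift n 1 0)"
  have *: "B (lift m a b) (lift n c d) = B (lift m c d) (lift n a b)" for a b c d
    using sym lift_basis[OF m, of a b] lift_basis[OF n, of c d] lift_basis[OF m, of c d]
      lift_basis[OF n, of a b] by (simp add: B_linear algebra_simps)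
  show "perspective Q l m n"
    unfolding perspective_def
  proof (intro ballI impI)
    fix x x' y y' assume "x \<in> m" "x' \<in> m" "y \<in> n" "y' \<in> n"
      and "x - y \<in> perp Q l \<and> x' - y' \<in> perp Q l"
    then show "B x y' = B x' y"
      using lift_unique[OF m, of x] lift_unique[OF m, of x'] lift_unique[OF n, of y]
        lift_unique[OF n, of y'] *[of "B x e1" "B x e2" "B x' e1" "B x' e2"]
      by (simp add: perp_lin B_linear)
  qed
qed

lemma perspectiveD:
  assumes "m \<in> scheme_points Q l" "n \<in> scheme_points Q l" "perspective Q l m n"
  shows "B (lift m a b) (lift n c d) = B (lift m c d) (lift n a b)"
  using assms(3) lift[OF assms(1)] lift[OF assms(2)]
  unfolding perspective_def by (auto simp: perp_lin B_linear)

lemma perspective_refl: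
  assumes "m \<in> scheme_points Q l"
  shows "perspective Q l m m"
  using assms by (simp add: perspective_iff B_lift_same)

text \<open>The kernel of \<open>l \<times> m \<times> n \<rightarrow> \<langle>l, m, n\<rangle>\<close>, in the coordinates of \<open>m\<close>.\<close>

definition coincidences where
  "coincidences m n = {(a, b). lift m a b - lift n a b \<in> l}"

text \<open>Writes the sum of the three lines as the image of an additive map on six coordinates, so
  that its size can be read off from the kernel.\<close>

lemma span_three:
  assumes m: "m \<in> scheme_points Q l" and n: "n \<in> scheme_points Q l"
  shows "vec.span (l \<union> m \<union> n) =
    range (\<lambda>((x, y), (a, b), (c, d)). x *s e1 + y *s e2 + (lift m a b + lift n c d))"
    (is "_ = range ?f")
proof
  have f: "?f s \<in> vec.span (l \<union> m \<union> n)" for s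
    using lift(1)[OF m] lift(1)[OF n] lin_memI[of _ e1 _ e2]
    by (cases s) (auto simp del: vec.span_Un intro!: vec.span_add[OF vec.span_base vec.span_add]
        intro: vec.span_base)
  then show "range ?f \<subseteq> vec.span (l \<union> m \<union> n)" by blast
  have add: "?f s + ?f t = ?f (s + t)" for s t
    by (auto split: prod.split simp: lift_linear[OF m] lift_linear[OF n] vec.scale_left_distrib)
  have scale: "\<exists>t. c *s ?f s = ?f t" for c s
  proof -
    obtain x y a b a' b' where "s = ((x, y), (a, b), (a', b'))" by (metis prod.exhaust)
    then show ?thesis
      by (intro exI[of _ "((c * x, c * y), (c * a, c * b), (c * a', c * b'))"])
        (simp add: lift_linear[OF m] lift_linear[OF n] vec.scale_right_distrib)
  qed
  have "vec.subspace (range ?f)"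
  proof (rule vec.subspaceI)
    show "0 \<in> range ?f"
      by (rule range_eqI[of _ _ "((0, 0), (0, 0), (0, 0))"])
        (simp add: lift_linear[OF m] lift_linear[OF n])
  next
    fix v w assume "v \<in> range ?f" "w \<in> range ?f"
    then obtain s t where "v = ?f s" "w = ?f t" by (elim rangeE)
    then have "v + w = ?f (s + t)" by (simp only: add)
    then show "v + w \<in> range ?f" by (rule range_eqI)
  next
    fix c v assume "v \<in> range ?f"
    then obtain s where "v = ?f s" by (elim rangeE)
    with scale[of c s] obtain t where "c *s v = ?f t" by (elim exE) simp
    then show "c *s v \<in> range ?f" by (rule range_eqI)
  qed
  moreover have "v \<in> range ?f" if "v \<in> l" for v
    using l_coords[OF that] by (intro range_eqI[of _ _ "((B v o1, B v o2), (0, 0), (0, 0))"])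
      (simp add: lift_linear[OF m] lift_linear[OF n])
  moreover have "v \<in> range ?f" if "v \<in> m" for v
    using lift_unique[OF m that]
    by (intro range_eqI[of _ _ "((0, 0), (B v e1, B v e2), (0, 0))"])
      (simp add: lift_linear[OF m] lift_linear[OF n])
  moreover have "v \<in> range ?f" if "v \<in> n" for v
    using lift_unique[OF n that]
    by (intro range_eqI[of _ _ "((0, 0), (0, 0), (B v e1, B v e2))"])
      (simp add: lift_linear[OF m] lift_linear[OF n])
  ultimately show "vec.span (l \<union> m \<union> n) \<subseteq> range ?f"
    by (intro vec.span_minimal) blast+
qed

lemma card_coincidences:
  assumes m: "m \<in> scheme_points Q l" and n: "n \<in> scheme_points Q l"
  shows "CARD('a) ^ 6 = CARD('a) ^ vec.dim (l \<union> m \<union> n) * card (coincidences m n)"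
proof -
  let ?f = "\<lambda>((x, y), (a, b), (c, d)). x *s e1 + y *s e2 + (lift m a b + lift n c d)"
  have add: "?f (s + t) = ?f s + ?f t" for s t
    by (auto split: prod.split simp: lift_linear[OF m] lift_linear[OF n] vec.scale_left_distrib)
  have "card (range ?f) = CARD('a) ^ vec.dim (l \<union> m \<union> n)"
    unfolding span_three[OF m n, symmetric] by (simp add: card_subspace)
  moreover have "card {s. ?f s = 0} = card (coincidences m n)"
  proof -
    let ?g = "\<lambda>(a, b). ((- B (lift m a b - lift n a b) o1, - B (lift m a b - lift n a b) o2),
      (a, b), (- a, - b))"
    have neg: "lift n (- a) (- b) = - lift n a b" for a b
      using lift_linear(3)[OF n, of 0 a 0 b] lift_linear(4)[OF n] by simp
    have z: "((x, y), (a, b), (c, d)) = ?g (a, b) \<and> (a, b) \<in> coincidences m n"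
      if eq: "?f ((x, y), (a, b), (c, d)) = 0" for x y a b c d
    proof -
      from eq have eq: "x *s e1 + y *s e2 + (lift m a b + lift n c d) = 0" by simp
      \<comment> \<open>Products with \<open>e1\<close> and \<open>e2\<close> do not see the summand
        in \<open>l\<close>. They force opposite coordinates in \<open>m\<close> and
        \<open>n\<close>, and then the summand in \<open>l\<close> is determined as well.\<close>
      have "a + c = 0" "b + d = 0"
        using arg_cong[OF eq, of "\<lambda>v. B v e1"] arg_cong[OF eq, of "\<lambda>v. B v e2"]
        by (simp_all add: B_linear lift[OF m] lift[OF n])
      then have cd: "c = - a" "d = - b" by (simp_all add: add_eq_0_iff)
      have "x *s e1 + y *s e2 + (lift m a b - lift n a b) = 0"
        using eq by (simp add: cd neg)
      then have "lift m a b - lift n a b = - (x *s e1 + y *s e2)"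
        by (rule minus_unique[symmetric])
      then have L: "lift m a b - lift n a b = (- x) *s e1 + (- y) *s e2" by simp
      then have "lift m a b - lift n a b \<in> l"
        by (subst L) (rule lin_memI)
      then have "(a, b) \<in> coincidences m n" by (simp add: coincidences_def)
      moreover have "B (lift m a b - lift n a b) o1 = - x" "B (lift m a b - lift n a b) o2 = - y"
        unfolding L by (simp_all add: B_linear)
      ultimately show ?thesis by (simp add: cd)
    qed
    have z': "?f (?g (a, b)) = 0" if "(a, b) \<in> coincidences m n" for a b
    proof -
      define d where "d = lift m a b - lift n a b"
      have d: "d = B d o1 *s e1 + B d o2 *s e2"
        using that by (intro l_coords) (simp add: d_def coincidences_def)
      have "- Y - X + d = 0" if "d = X + Y" for X Y using that by simp
      from this[OF d] have "- (B d o2 *s e2) - B d o1 *s e1 + d = 0" .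
      then show ?thesis by (simp add: neg d_def)
    qed
    have "{s. ?f s = 0} = ?g ` coincidences m n"
    proof (intro set_eqI iffI)
      fix s assume s: "s \<in> {s. ?f s = 0}"
      obtain x y a b c d where "s = ((x, y), (a, b), (c, d))"
        by (cases s rule: prod_cases3) (metis surj_pair)
      with s z[of x y a b c d] have "s = ?g (a, b)" "(a, b) \<in> coincidences m n"
        by simp_all
      then show "s \<in> ?g ` coincidences m n" by (rule image_eqI)
    next
      fix s assume "s \<in> ?g ` coincidences m n"
      then obtain p where p: "p \<in> coincidences m n" "s = ?g p" by (elim imageE)
      obtain a b where "p = (a, b)" by (rule prod.exhaust)
      with p z'[of a b] show "s \<in> {s. ?f s = 0}" by simp
    qed
    moreover have "inj_on ?g (coincidences m n)"
      by (auto simp: inj_on_def)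
    ultimately show ?thesis by (simp add: card_image)
  qed
  ultimately show ?thesis
    using card_eq_card_range_times_card_kernel[of ?f, OF add] by (simp add: eval_nat_numeral)
qed


section \<open>Coincidences, common vectors and perspective\<close>

lemma card_meet:
  assumes m: "m \<in> scheme_points Q l" and n: "n \<in> scheme_points Q l"
  shows "card (m \<inter> n) = card {(a, b). lift m a b = lift n a b}"
proof -
  have "bij_betw (\<lambda>x. (B x e1, B x e2)) (m \<inter> n) {(a, b). lift m a b = lift n a b}"
  proof (rule bij_betw_byWitness[where f' = "\<lambda>(a, b). lift m a b"])
    show "\<forall>x\<in>m \<inter> n. (case (B x e1, B x e2) of (a, b) \<Rightarrow> lift m a b) = x"
      using lift_unique[OF m] by simp
    show "\<forall>p\<in>{(a, b). lift m a b = lift n a b}.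
        (B (case p of (a, b) \<Rightarrow> lift m a b) e1, B (case p of (a, b) \<Rightarrow> lift m a b) e2) = p"
      using lift[OF m] lift[OF n] by auto
    show "(\<lambda>x. (B x e1, B x e2)) ` (m \<inter> n) \<subseteq> {(a, b). lift m a b = lift n a b}"
      using lift_unique[OF m] lift_unique[OF n] by auto
    show "(\<lambda>(a, b). lift m a b) ` {(a, b). lift m a b = lift n a b} \<subseteq> m \<inter> n"
      using lift(1)[OF m] lift(1)[OF n] by auto
  qed
  then show ?thesis by (rule bij_betw_same_card)
qed

text \<open>The difference of the two lifts lies in \<open>l\<close>, so its product with a lift to
  \<open>m\<close> or to \<open>n\<close> depends only on the coordinates of that lift. Since
  \<open>m\<close> and \<open>n\<close> are totally singular, only one cross term survives in each
  product, and the two have opposite signs.\<close>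

lemma coincidence_antisymmetric:
  assumes m: "m \<in> scheme_points Q l" and n: "n \<in> scheme_points Q l"
    and ab: "(a, b) \<in> coincidences m n"
  shows "B (lift m c d) (lift n a b) = - B (lift m a b) (lift n c d)"
proof -
  let ?D = "lift m a b - lift n a b"
  have "?D \<in> l" using ab by (simp add: coincidences_def)
  then have "B ?D (lift m c d) = B ?D (lift n c d)"
    by (simp add: B_l_lift[OF m] B_l_lift[OF n])
  then show ?thesis
    using B_commute[of "lift n a b" "lift m c d"]
    by (simp add: B_diff B_lift_same m n)
      (metis minus_minus)
qed

text \<open>Products that are both symmetric and antisymmetric vanish in odd characteristic. The
  difference of the lifts is then a vector of \<open>l\<close> orthogonal to \<open>n\<close>, hence
  zero by duality of \<open>l\<close> and \<open>n\<close>.\<close>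

lemma perspective_coincidence:
  assumes m: "m \<in> scheme_points Q l" and n: "n \<in> scheme_points Q l"
    and ab: "(a, b) \<in> coincidences m n" and P: "perspective Q l m n"
  shows "lift m a b = lift n a b"
proof -
  let ?D = "lift m a b - lift n a b"
  have D: "?D \<in> l" using ab by (simp add: coincidences_def)
  have "B (lift m a b) (lift n c d) = 0" for c d
    using coincidence_antisymmetric[OF m n ab, of c d] perspectiveD[OF m n P, of a b c d] two
    by (metis eq_neg_iff_add_eq_0 mult_2 mult_eq_0_iff)
  then have "B ?D (lift n c d) = 0" for c d
    by (simp add: B_diff B_lift_same n)
  then have "B ?D o1 = 0" "B ?D o2 = 0"
    using B_l_lift[OF n D, of 1 0] B_l_lift[OF n D, of 0 1] by simp_all
  then have "?D = 0"
    using l_coords[OF D] by simp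
  then show ?thesis by simp
qed

text \<open>The coordinates (a, b) of a common vector lie in the left and in the right kernel of the
  2 by 2 matrix of \<open>B\<close>. Comparing the two systems, a and b times the difference of the
  off-diagonal entries vanish.\<close>

lemma meet_perspective:
  assumes m: "m \<in> scheme_points Q l" and n: "n \<in> scheme_points Q l"
    and x: "x \<in> m" "x \<in> n" "x \<noteq> 0"
  shows "perspective Q l m n"
proof -
  define a b where "a = B x e1" and "b = B x e2"
  have ab: "a \<noteq> 0 \<or> b \<noteq> 0"
    using scheme_point_zero[OF m x(1)] x(3) by (auto simp: a_def b_def)
  have xm: "x = a *s lift m 1 0 + b *s lift m 0 1" and xn: "x = a *s lift n 1 0 + b *s lift n 0 1"
    using lift_unique[OF m x(1)] lift_unique[OF n x(2)] lift_basis[OF m, of a b]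
      lift_basis[OF n, of a b] by (simp_all add: a_def b_def)
  have "B x (lift n c d) = 0" "B (lift m c d) x = 0" for c d
    using B_singular[OF scheme_pointD(1)[OF n] x(2) lift(1)[OF n]]
      B_singular[OF scheme_pointD(1)[OF m] lift(1)[OF m] x(1)] by auto
  then have *: "a * B (lift m 1 0) (lift n c d) + b * B (lift m 0 1) (lift n c d) = 0"
    "a * B (lift m c d) (lift n 1 0) + b * B (lift m c d) (lift n 0 1) = 0" for c d
    using arg_cong[OF xm, of "\<lambda>x. B x (lift n c d)"] arg_cong[OF xn, of "B (lift m c d)"]
    by (simp_all add: B_linear)
  have "b * B (lift m 1 0) (lift n 0 1) = b * B (lift m 0 1) (lift n 1 0)"
    using *(1)[of 1 0] *(2)[of 1 0] by (metis add_left_imp_eq)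
  moreover have "a * B (lift m 1 0) (lift n 0 1) = a * B (lift m 0 1) (lift n 1 0)"
    using *(1)[of 0 1] *(2)[of 0 1] by (metis add_right_imp_eq)
  ultimately show ?thesis
    using ab by (auto simp: perspective_iff[OF m n])
qed

lemma card_meet_eq_coincidences:
  assumes m: "m \<in> scheme_points Q l" and n: "n \<in> scheme_points Q l"
    and P: "perspective Q l m n"
  shows "card (m \<inter> n) = card (coincidences m n)"
proof -
  have "coincidences m n = {(a, b). lift m a b = lift n a b}"
    using perspective_coincidence[OF m n _ P]
    by (auto simp: coincidences_def vec.subspace_0 subspace_lin)
  then show ?thesis using card_meet[OF m n] by simp
qed

text \<open>Here k is the dimension of the kernel counted by \<open>coincidences\<close>; it is at
  most 2 because the kernel embeds into pairs (a, b).\<close>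

lemma dim_coincidences:
  assumes m: "m \<in> scheme_points Q l" and n: "n \<in> scheme_points Q l"
  obtains k where "k \<le> 2" "card (coincidences m n) = CARD('a) ^ k"
    "vec.dim (l \<union> m \<union> n) = 6 - k"
proof -
  let ?d = "vec.dim (l \<union> m \<union> n)"
  have q: "1 < CARD('a)" by (rule card_gt_1)
  have eq: "CARD('a) ^ 6 = CARD('a) ^ ?d * card (coincidences m n)"
    by (rule card_coincidences[OF m n])
  have "?d \<le> vec.dim (UNIV :: ('a^6) set)" by (rule vec.dim_subset) simp
  also have "vec.dim (UNIV :: ('a^6) set) = 6"
    by (subst dim_eq_iff_card_eq) simp_all
  finally have d: "?d \<le> 6" .
  have "CARD('a) ^ ?d * CARD('a) ^ (6 - ?d) = CARD('a) ^ ?d * card (coincidences m n)"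
    using eq d by (simp flip: power_add)
  then have c: "card (coincidences m n) = CARD('a) ^ (6 - ?d)"
    by (simp only: mult_cancel1) simp
  have "card (coincidences m n) \<le> CARD('a \<times> 'a)"
    by (rule card_mono) auto
  then have "CARD('a) ^ (6 - ?d) \<le> CARD('a) ^ 2"
    by (simp add: c power2_eq_square)
  then have "6 - ?d \<le> 2"
    using q power_increasing_iff by blast
  with c d show thesis by (intro that[of "6 - ?d"]) auto
qed

lemma span_UNIV_iff:
  assumes m: "m \<in> scheme_points Q l" and n: "n \<in> scheme_points Q l"
  shows "vec.span (l \<union> m \<union> n) = UNIV \<longleftrightarrow> vec.dim (l \<union> m \<union> n) = 6"
proof -
  have 6: "vec.dim (UNIV :: ('a^6) set) = 6"
    by (subst dim_eq_iff_card_eq) simp_all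
  show ?thesis
  proof
    assume "vec.span (l \<union> m \<union> n) = UNIV"
    then show "vec.dim (l \<union> m \<union> n) = 6" using 6 by (metis vec.dim_span)
  next
    assume "vec.dim (l \<union> m \<union> n) = 6"
    then show "vec.span (l \<union> m \<union> n) = UNIV"
      using 6 by (intro vec.subspace_dim_equal) auto
  qed
qed

section \<open>Perspective of a spanning triple as symmetry\<close>

text \<open>Turns membership in a space \<Sigma>_k of the definition of perspective into an equality
  of products: a vector belongs to it iff some vector of the k-th line has the same products with
  the other two lines.\<close>

lemma span_perps:
  assumes "vec.subspace U"
  shows "v \<in> vec.span (perp Q V \<inter> perp Q W \<union> U) \<longleftrightarrow>
    (\<exists>x\<in>U. (\<forall>y\<in>V. B v y = B x y) \<and> (\<forall>y\<in>W. B v y = B x y))"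
proof -
  have s: "vec.subspace (perp Q V \<inter> perp Q W)"
    by (intro vec.subspace_inter subspace_perp)
  have sp: "vec.span (perp Q V \<inter> perp Q W \<union> U) = {x + y |x y. x \<in> perp Q V \<inter> perp Q W \<and> y \<in> U}"
    by (subst vec.span_Un) (auto simp: vec.span_eq_iff[THEN iffD2, OF s] vec.span_eq_iff[THEN iffD2, OF assms])
  show ?thesis
  proof
    assume "v \<in> vec.span (perp Q V \<inter> perp Q W \<union> U)"
    then show "\<exists>x\<in>U. (\<forall>y\<in>V. B v y = B x y) \<and> (\<forall>y\<in>W. B v y = B x y)"
      unfolding sp by (auto simp: perp_def B_linear)
  next
    assume "\<exists>x\<in>U. (\<forall>y\<in>V. B v y = B x y) \<and> (\<forall>y\<in>W. B v y = B x y)"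
    then obtain x where x: "x \<in> U" "\<forall>y\<in>V. B v y = B x y" "\<forall>y\<in>W. B v y = B x y" by blast
    then have "v - x \<in> perp Q V \<inter> perp Q W"
      by (auto simp: perp_def B_linear)
    with x(1) have "(v - x) + x \<in> vec.span (perp Q V \<inter> perp Q W \<union> U)"
      unfolding sp by blast
    then show "v \<in> vec.span (perp Q V \<inter> perp Q W \<union> U)" by simp
  qed
qed

lemma ball_scheme_point:
  assumes m: "m \<in> scheme_points Q l"
  shows "(\<forall>y\<in>m. R y) \<longleftrightarrow> (\<forall>a b. R (lift m a b))"
  using lift(1)[OF m] lift_unique[OF m] by metis

text \<open>The only vector of \<open>m\<close> with the same products with \<open>l\<close> as
  \<open>v\<close> is the lift of the coordinates of \<open>v\<close>, which removes the quantifier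
  left by \<open>span_perps\<close>.\<close>

lemma bex_scheme_point_coords:
  assumes m: "m \<in> scheme_points Q l"
  shows "(\<exists>y\<in>m. (\<forall>x\<in>l. B v x = B y x) \<and> R y) \<longleftrightarrow> R (lift m (B v e1) (B v e2))"
proof
  assume "\<exists>y\<in>m. (\<forall>x\<in>l. B v x = B y x) \<and> R y"
  then obtain y where y: "y \<in> m" "\<forall>x\<in>l. B v x = B y x" "R y" by blast
  then have "lift m (B v e1) (B v e2) = y"
    using lift_unique[OF m y(1)] lin_generators(1)[of e1 e2] lin_generators(2)[of e2 e1] by simp
  with y show "R (lift m (B v e1) (B v e2))" by simp
next
  assume "R (lift m (B v e1) (B v e2))"
  then show "\<exists>y\<in>m. (\<forall>x\<in>l. B v x = B y x) \<and> R y"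
    by (intro bexI[of _ "lift m (B v e1) (B v e2)"])
      (auto simp: lift[OF m] B_linear elim!: lin_memE)
qed

lemma B_e_lift:
  assumes "m \<in> scheme_points Q l"
  shows "B e1 (lift m a b) = a" "B e2 (lift m a b) = b"
  using lift[OF assms] by (metis B_commute)+

text \<open>A vector of \<open>l\<close> takes the same product with the lifts of (a, b) to
  \<open>m\<close> and to \<open>n\<close>, and every functional of (a, b) comes from a vector of
  \<open>l\<close>.\<close>

lemma bex_l_coords:
  assumes m: "m \<in> scheme_points Q l" and n: "n \<in> scheme_points Q l"
  shows "(\<exists>x\<in>l. (\<forall>y\<in>m. B v y = B x y) \<and> (\<forall>y\<in>n. B v y = B x y)) \<longleftrightarrow>
    (\<forall>a b. B v (lift m a b) = B v (lift n a b))"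
proof
  assume "\<exists>x\<in>l. (\<forall>y\<in>m. B v y = B x y) \<and> (\<forall>y\<in>n. B v y = B x y)"
  then show "\<forall>a b. B v (lift m a b) = B v (lift n a b)"
    by (auto simp: lift m n B_l_lift)
next
  assume *: "\<forall>a b. B v (lift m a b) = B v (lift n a b)"
  let ?x = "B v (lift m 1 0) *s e1 + B v (lift m 0 1) *s e2"
  have x: "?x \<in> l" by (rule lin_memI)
  have vm: "B v (lift m a b) = B ?x (lift m a b)" for a b
    using arg_cong[OF lift_basis[OF m, of a b], of "B v"] by (simp add: B_linear B_e_lift m)
  have "B v (lift n a b) = B ?x (lift n a b)" for a b
    using *[rule_format, of a b] vm[of a b] by (simp add: B_linear B_e_lift m n)
  with vm have "\<forall>y\<in>m. B v y = B ?x y" "\<forall>y\<in>n. B v y = B ?x y"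
    unfolding ball_scheme_point[OF m] ball_scheme_point[OF n] by blast+
  with x show "\<exists>x\<in>l. (\<forall>y\<in>m. B v y = B x y) \<and> (\<forall>y\<in>n. B v y = B x y)"
    by blast
qed

lemma coincidences_spanning:
  assumes m: "m \<in> scheme_points Q l" and n: "n \<in> scheme_points Q l"
    and span: "vec.span (l \<union> m \<union> n) = UNIV"
  shows "coincidences m n = {(0, 0)}"
proof -
  have d6: "vec.dim (l \<union> m \<union> n) = 6"
    using span span_UNIV_iff[OF m n] by simp
  have "card (coincidences m n) = 1"
    by (rule dim_coincidences[OF m n]) (use d6 in \<open>auto simp: numeral_eq_Suc\<close>)
  moreover have "(0, 0) \<in> coincidences m n"
    by (simp add: coincidences_def lift_linear m n vec.subspace_0 subspace_lin)
  ultimately show ?thesis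
    by (metis card_1_singletonE singletonD)
qed

text \<open>The common intersection consists of the vectors whose products with \<open>e1, e2\<close> lie in the kernel
  of the skew part of the matrix of \<open>B\<close> between the dual bases of \<open>m\<close> and \<open>n\<close>.\<close>

lemma in_perspective_iff:
  assumes m: "m \<in> scheme_points Q l" and n: "n \<in> scheme_points Q l"
    and span: "vec.span (l \<union> m \<union> n) = UNIV"
  shows "in_perspective Q l m n \<longleftrightarrow> perspective Q l m n"
proof -
  have coin: "coincidences m n = {(0, 0)}"
    by (rule coincidences_spanning[OF m n span])
  have "x = 0" if x: "x \<in> m" "x \<in> n" for x
  proof -
    have "(B x e1, B x e2) \<in> coincidences m n"
      using lift_unique[OF m x(1)] lift_unique[OF n x(2)]
      by (simp add: coincidences_def vec.subspace_0 subspace_lin)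
    then show ?thesis using coin scheme_point_zero[OF m x(1)] by simp
  qed
  then have mn: "m \<inter> n = {0}"
    using scheme_pointD(2)[OF m] scheme_pointD(2)[OF n] by (auto simp: vec.subspace_0)
  have lm: "l \<inter> m = {0}" "l \<inter> n = {0}"
    using m n by (simp_all add: scheme_points_def)
  define W where "W = vec.span (perp Q m \<inter> perp Q n \<union> l) \<inter>
    vec.span (perp Q l \<inter> perp Q n \<union> m) \<inter> vec.span (perp Q l \<inter> perp Q m \<union> n)"
  have W: "v \<in> W \<longleftrightarrow> (\<forall>a b. B v (lift m a b) = B v (lift n a b)) \<and>
      (\<forall>a b. B v (lift n a b) = B (lift m (B v e1) (B v e2)) (lift n a b)) \<and>
      (\<forall>a b. B v (lift m a b) = B (lift n (B v e1) (B v e2)) (lift m a b))" for v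
    unfolding W_def Int_iff span_perps[OF subspace_lin] span_perps[OF scheme_pointD(2)[OF m]]
      span_perps[OF scheme_pointD(2)[OF n]] bex_l_coords[OF m n]
      bex_scheme_point_coords[OF m] bex_scheme_point_coords[OF n]
    by (simp add: ball_scheme_point m n)
  have subW: "vec.subspace W"
    unfolding W_def by (intro vec.subspace_inter vec.subspace_span)
  \<comment> \<open>The products with bases of \<open>l\<close>, \<open>m\<close> and
    \<open>n\<close> are six coordinates on the whole space, because the three lines span
    it.\<close>
  let ?G = "\<lambda>v. ((B v e1, B v e2), (B v (lift m 1 0), B v (lift m 0 1)),
    (B v (lift n 1 0), B v (lift n 0 1)))"
  have zero: "v = 0" if v: "B v e1 = 0" "B v e2 = 0" "\<And>a b. B v (lift m a b) = 0"
      "\<And>a b. B v (lift n a b) = 0" for v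
  proof (rule radical)
    fix y
    have "l \<union> m \<union> n \<subseteq> perp Q {v}"
      using v lift_unique[OF m] lift_unique[OF n]
      by (auto simp: perp_def B_commute[of _ v] B_linear elim!: lin_memE) (metis v(3,4))+
    then have "vec.span (l \<union> m \<union> n) \<subseteq> perp Q {v}"
      by (intro vec.span_minimal subspace_perp)
    then show "B v y = 0"
      using span B_commute[of v y] by (auto simp: perp_def)
  qed
  have "inj ?G"
  proof (rule injI)
    fix v w assume G: "?G v = ?G w"
    have "B (v - w) (lift m a b) = 0" "B (v - w) (lift n a b) = 0" for a b
      by (subst lift_basis[OF m] lift_basis[OF n], use G in \<open>simp add: B_linear\<close>)+
    with G have "v - w = 0"
      by (intro zero) (simp_all add: B_linear)
    then show "v = w" by simp
  qed
  then have "card (range ?G) = CARD('a) ^ 6"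
    by (simp add: card_image)
  then have range: "range ?G = UNIV"
    by (intro card_subset_eq) (simp_all add: eval_nat_numeral)
  have surj: "\<exists>v. ?G v = g" for g
  proof -
    have "g \<in> range ?G" unfolding range by (rule UNIV_I)
    then obtain v where "g = ?G v" by (elim rangeE)
    then show ?thesis by (intro exI) (rule sym)
  qed
  have "vec.dim W = 2 \<longleftrightarrow> perspective Q l m n"
  proof
    assume P: "perspective Q l m n"
    have "bij_betw (\<lambda>v. (B v e1, B v e2)) W UNIV"
      unfolding bij_betw_def
    proof
      show "inj_on (\<lambda>v. (B v e1, B v e2)) W"
      proof (rule inj_onI)
        fix v w assume "v \<in> W" "w \<in> W" "(B v e1, B v e2) = (B w e1, B w e2)"
        then have "v - w = 0"
          by (intro zero) (auto simp: W B_linear)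
        then show "v = w" by simp
      qed
      have "(a, b) \<in> (\<lambda>v. (B v e1, B v e2)) ` W" for a b
      proof -
        \<comment> \<open>The second and third conditions in \<open>W\<close> dictate the products
          with \<open>m\<close> and \<open>n\<close>; the first one then follows from
          symmetry.\<close>
        obtain v where "?G v = ((a, b),
            (B (lift n a b) (lift m 1 0), B (lift n a b) (lift m 0 1)),
            (B (lift m a b) (lift n 1 0), B (lift m a b) (lift n 0 1)))"
          using surj by blast
        then have v: "B v e1 = a" "B v e2 = b"
          "B v (lift m 1 0) = B (lift n a b) (lift m 1 0)"
          "B v (lift m 0 1) = B (lift n a b) (lift m 0 1)"
          "B v (lift n 1 0) = B (lift m a b) (lift n 1 0)"
          "B v (lift n 0 1) = B (lift m a b) (lift n 0 1)" by simp_all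
        have vm: "B v (lift m c d) = B (lift n a b) (lift m c d)"
          and vn: "B v (lift n c d) = B (lift m a b) (lift n c d)" for c d
          by (subst (1 2) lift_basis[OF m], simp add: v B_right,
              subst (1 2) lift_basis[OF n], simp add: v B_right)
        have "v \<in> W"
          using perspectiveD[OF m n P] by (simp add: W v(1,2) vm vn) (metis B_commute)
        then show ?thesis using v(1,2) by force
      qed
      then show "(\<lambda>v. (B v e1, B v e2)) ` W = UNIV" by auto
    qed
    then have "card W = CARD('a \<times> 'a)" by (rule bij_betw_same_card)
    then show "vec.dim W = 2"
      by (simp add: dim_eq_iff_card_eq[OF subW] power2_eq_square)
  next
    assume dim: "vec.dim W = 2"
    show "perspective Q l m n"
    proof (rule ccontr)
      assume nP: "\<not> perspective Q l m n"
      have "v = 0" if v: "v \<in> W" for v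
      proof -
        define a b where "a = B v e1" and "b = B v e2"
        have eq: "B (lift m a b) (lift n c d) = B (lift m c d) (lift n a b)" for c d
          using v[unfolded W] B_commute[of "lift m c d" "lift n a b"]
          unfolding a_def b_def by metis
        \<comment> \<open>The skew part of a 2 by 2 matrix has this single entry, so it is
          invertible as soon as it is nonzero.\<close>
        let ?F = "B (lift m 1 0) (lift n 0 1) - B (lift m 0 1) (lift n 1 0)"
        have "?F \<noteq> 0" using nP by (simp add: perspective_iff[OF m n])
        moreover have "b * ?F = 0" "a * ?F = 0"
          using eq[of 1 0] eq[of 0 1] lift_basis[OF m, of a b] lift_basis[OF n, of a b]
          by (auto simp: B_linear algebra_simps)
        ultimately have "a = 0" "b = 0" by simp_all
        then show "v = 0"
          using v by (intro zero) (auto simp: W a_def b_def lift_linear m n)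
      qed
      then have "W \<subseteq> {0}" by blast
      then have "vec.dim W = 0" by simp
      then show False using dim by simp
    qed
  qed
  then show ?thesis
    using l_singular scheme_pointD(1)[OF m] scheme_pointD(1)[OF n] lm mn span
    by (simp add: in_perspective_def Let_def W_def)
qed


section \<open>Entries of the idempotents\<close>

text \<open>For distinct lines the index is read off from the kernel dimension k = 2, 1, 0 and from
  perspective. For k = 2 perspective is not consulted, since it would force the lines to be
  equal.\<close>

definition rel_index :: "('a ^ 6) set \<Rightarrow> ('a ^ 6) set \<Rightarrow> nat" where
  "rel_index m n =
    (if m = n then 0
     else if card (coincidences m n) = CARD('a)\<^sup>2 then 2
     else if card (coincidences m n) = CARD('a) then (if perspective Q l m n then 1 else 3)
     else (if perspective Q l m n then 5 else 4))"

lemma coincidences_refl: "coincidences m m = UNIV"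
  by (auto simp: coincidences_def vec.subspace_0 subspace_lin)

lemma dim_meet_perspective:
  assumes m: "m \<in> scheme_points Q l" and n: "n \<in> scheme_points Q l"
    and P: "perspective Q l m n" and k: "card (coincidences m n) = CARD('a) ^ k"
  shows "vec.dim (m \<inter> n) = k"
  using card_meet_eq_coincidences[OF m n P] k
  by (simp add: dim_eq_iff_card_eq vec.subspace_inter scheme_pointD(2) m n)

lemma not_perspective_disjoint:
  assumes m: "m \<in> scheme_points Q l" and n: "n \<in> scheme_points Q l"
    and P: "\<not> perspective Q l m n"
  shows "m \<inter> n = {0}"
  using meet_perspective[OF m n] P scheme_pointD(2)[OF m] scheme_pointD(2)[OF n]
  by (auto simp: vec.subspace_0)

text \<open>For lines in perspective each coincidence is a common vector, so q^2 coincidences fill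
  both lines.\<close>

lemma coincidences_full_not_perspective:
  assumes m: "m \<in> scheme_points Q l" and n: "n \<in> scheme_points Q l"
    and k: "card (coincidences m n) = CARD('a)\<^sup>2" and P: "perspective Q l m n"
  shows "m = n"
proof -
  have d: "vec.dim (m \<inter> n) = 2" by (rule dim_meet_perspective[OF m n P k])
  have s: "vec.subspace (m \<inter> n)"
    by (intro vec.subspace_inter scheme_pointD(2) m n)
  have "m \<inter> n = m"
    by (intro vec.subspace_dim_equal s scheme_pointD(2) m) (simp_all add: d scheme_pointD m)
  moreover have "m \<inter> n = n"
    by (intro vec.subspace_dim_equal s scheme_pointD(2) n) (simp_all add: d scheme_pointD n)
  ultimately show ?thesis by simp
qed

text \<open>Lines in perspective meet in dimension k and lines not in perspective are disjoint, so k
  and perspective decide every condition in \<open>scheme_rel\<close>.\<close>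

lemma scheme_rel_iff:
  assumes m: "m \<in> scheme_points Q l" and n: "n \<in> scheme_points Q l" and i: "i \<le> 5"
  shows "(m, n) \<in> scheme_rel Q l i \<longleftrightarrow> i = rel_index m n"
proof -
  obtain k where k: "k \<le> 2" "card (coincidences m n) = CARD('a) ^ k"
    "vec.dim (l \<union> m \<union> n) = 6 - k"
    by (rule dim_coincidences[OF m n])
  have q: "1 < CARD('a)" by (rule card_gt_1)
  have q': "CARD('a)\<^sup>2 \<noteq> CARD('a)" "CARD('a)\<^sup>2 \<noteq> 1" "CARD('a) \<noteq> 1"
    using q by (auto simp: power2_eq_square)
  have span: "vec.span (l \<union> m \<union> n) = UNIV \<longleftrightarrow> k = 0"
    using span_UNIV_iff[OF m n] k(1,3) by auto
  have persp: "in_perspective Q l m n \<longleftrightarrow> perspective Q l m n" if "k = 0"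
    using in_perspective_iff[OF m n] span that by simp
  have zero_dim: "vec.dim (m \<inter> n) = 0 \<longleftrightarrow> m \<inter> n = {0}"
    using scheme_pointD(2)[OF m] scheme_pointD(2)[OF n]
    by (auto simp: vec.dim_eq_0 vec.subspace_0)
  have k_cases: "k = 0 \<or> k = 1 \<or> k = 2" using k(1) by auto
  have i_cases: "i = 0 \<or> i = 1 \<or> i = 2 \<or> i = 3 \<or> i = 4 \<or> i = 5" using i by auto
  have rel: "(m, n) \<in> scheme_rel Q l i \<longleftrightarrow>
      [m = n, vec.dim (m \<inter> n) = 1, m \<noteq> n \<and> k = 2, m \<inter> n = {0} \<and> k = 1,
       k = 0 \<and> \<not> perspective Q l m n, k = 0 \<and> perspective Q l m n] ! i"
  proof -
    have "6 - k = 4 \<longleftrightarrow> k = 2" "6 - k = 5 \<longleftrightarrow> k = 1"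
      using k(1) by auto
    then show ?thesis
      using i_cases persp
      by (elim disjE) (simp_all add: scheme_rel_def m n k(3) span cong: conj_cong)
  qed
  show ?thesis
  proof (cases "m = n")
    case True
    then have "CARD('a) ^ k = CARD('a)\<^sup>2"
      using k(2) coincidences_refl[of n] by (simp add: power2_eq_square)
    then have "k = 2" using q by simp
    moreover have "vec.dim (m \<inter> n) = 2" "m \<inter> n \<noteq> {0}"
      using scheme_pointD(3)[OF m] True zero_dim by auto
    ultimately show ?thesis
      using i_cases True rel by (auto simp: rel_index_def)
  next
    case neq: False
    have idx: "rel_index m n = (if k = 2 then 2
      else if k = 1 then (if perspective Q l m n then 1 else 3)
      else (if perspective Q l m n then 5 else 4))"
      using k_cases q' q'[symmetric] by (elim disjE) (simp_all add: rel_index_def neq k(2))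
    show ?thesis
    proof (cases "perspective Q l m n")
      case True
      have d: "vec.dim (m \<inter> n) = k"
        by (rule dim_meet_perspective[OF m n True k(2)])
      have "k \<noteq> 2"
        using coincidences_full_not_perspective[OF m n _ True] neq k(2) by auto
      moreover have "m \<inter> n = {0} \<longleftrightarrow> k = 0"
        using zero_dim d by simp
      ultimately show ?thesis
        unfolding rel idx using i_cases k_cases by (elim disjE) (simp_all add: neq True d)
    next
      case False
      have meet: "m \<inter> n = {0}"
        by (rule not_perspective_disjoint[OF m n False])
      then have "vec.dim (m \<inter> n) = 0"
        using zero_dim by simp
      then show ?thesis
        unfolding rel idx using i_cases k_cases by (elim disjE) (simp_all add: neq False meet)
    qed
  qed
qed

lemma rel_index_le: "rel_index m n \<le> 5"
  by (simp add: rel_index_def)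

lemma idempotent_matrix_eq:
  assumes "m \<in> scheme_points Q l" "n \<in> scheme_points Q l"
  shows "idempotent_matrix Q l j m n =
    1 / real CARD('a) ^ 5 * dual_eigenmatrix (real CARD('a)) (rel_index m n) j"
proof -
  have "(\<Sum>i\<le>5. dual_eigenmatrix (real CARD('a)) i j * adj_matrix Q l i m n) =
      (\<Sum>i\<le>5. if i = rel_index m n then dual_eigenmatrix (real CARD('a)) i j else 0)"
    by (intro sum.cong) (auto simp: adj_matrix_def scheme_rel_iff assms)
  then show ?thesis
    using rel_index_le[of m n] by (simp add: idempotent_matrix_def)
qed

text \<open>Column 1 agrees on the relations 0 and 2, on 1 and 3, and on 4 and 5, so it depends only
  on the number q^k of coincidences, and affinely so.\<close>

lemma idempotent_1:
  assumes m: "m \<in> scheme_points Q l" and n: "n \<in> scheme_points Q l"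
  shows "idempotent_matrix Q l 1 m n = 1 / real CARD('a) ^ 5 *
    (real CARD('a) ^ 2 * (real (card (coincidences m n)) - 1) / (real CARD('a) - 1)
      - real CARD('a) - 1)"
proof -
  define q where "q = real CARD('a)"
  obtain k where k: "k \<le> 2" "card (coincidences m n) = CARD('a) ^ k"
    by (rule dim_coincidences[OF m n])
  have q1: "1 < CARD('a)" by (rule card_gt_1)
  have q': "CARD('a)\<^sup>2 \<noteq> CARD('a)" "CARD('a)\<^sup>2 \<noteq> 1" "CARD('a) \<noteq> 1"
    using q1 by (auto simp: power2_eq_square)
  have q2: "q - 1 \<noteq> 0" using q1 by (simp add: q_def)
  have k_cases: "k = 0 \<or> k = 1 \<or> k = 2" using k(1) by auto
  have self: "m = n \<Longrightarrow> k = 2"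
    using k(2) coincidences_refl[of n] q1 by (auto simp flip: power2_eq_square)
  have "dual_eigenmatrix q (rel_index m n) 1 = q ^ 2 * (q ^ k - 1) / (q - 1) - q - 1"
  proof (cases "m = n")
    case True
    then have "k = 2" by (rule self)
    with True q2 show ?thesis
      by (simp add: rel_index_def dual_eigenmatrix_def field_simps power2_eq_square)
  next
    case False
    then show ?thesis
      using k_cases k(2) q' q2
      by (auto simp: rel_index_def dual_eigenmatrix_def field_simps power2_eq_square)
  qed
  then show ?thesis
    using idempotent_matrix_eq[OF m n, of 1] k(2) by (simp add: q_def)
qed

text \<open>Column 5 becomes a linear combination of three indicators, which turns its sum over a
  set of lines into three counts.\<close>

lemma idempotent_5:
  assumes m: "m \<in> scheme_points Q l" and n: "n \<in> scheme_points Q l"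
  shows "idempotent_matrix Q l 5 m n = 1 / (2 * real CARD('a) ^ 3) *
    (1 - real CARD('a) * of_bool (perspective Q l m n) + real CARD('a) ^ 3 * of_bool (m = n)
      - real CARD('a) ^ 2 * of_bool (card (coincidences m n) = CARD('a)\<^sup>2))"
proof -
  define q where "q = real CARD('a)"
  obtain k where k: "k \<le> 2" "card (coincidences m n) = CARD('a) ^ k"
    by (rule dim_coincidences[OF m n])
  have q1: "1 < CARD('a)" by (rule card_gt_1)
  have q': "CARD('a)\<^sup>2 \<noteq> CARD('a)" "CARD('a)\<^sup>2 \<noteq> 1" "CARD('a) \<noteq> 1"
    using q1 by (auto simp: power2_eq_square)
  have q2: "q \<noteq> 0" using q1 by (simp add: q_def)
  have k_cases: "k = 0 \<or> k = 1 \<or> k = 2" using k(1) by auto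
  have "dual_eigenmatrix q (rel_index m n) 5 = q ^ 2 / 2 *
    (1 - q * of_bool (perspective Q l m n) + q ^ 3 * of_bool (m = n)
      - q ^ 2 * of_bool (card (coincidences m n) = CARD('a)\<^sup>2))"
  proof (cases "m = n")
    case True
    then have "card (coincidences m n) = CARD('a)\<^sup>2" "perspective Q l m n"
      using perspective_refl[OF m] by (simp_all add: coincidences_refl power2_eq_square)
    with True show ?thesis
      by (simp add: rel_index_def dual_eigenmatrix_def field_simps power2_eq_square power3_eq_cube)
  next
    case False
    moreover have "k = 2 \<Longrightarrow> \<not> perspective Q l m n"
      using coincidences_full_not_perspective[OF m n] False k(2) by auto
    ultimately show ?thesis
      using k_cases k(2) q'
      by (auto simp: rel_index_def dual_eigenmatrix_def field_simps power2_eq_square)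
  qed
  moreover have "1 / q ^ 5 * (q ^ 2 / 2 * x) = 1 / (2 * q ^ 3) * x" for x
    using q2 by (simp add: field_simps flip: power_add)
  ultimately show ?thesis
    unfolding idempotent_matrix_eq[OF m n, of 5] q_def[symmetric] by (simp only:)
qed


lemma scheme_clique_iff:
  assumes "Y \<noteq> {}" "Y \<subseteq> scheme_points Q l"
  shows "scheme_clique Q l M Y \<longleftrightarrow> (\<forall>m\<in>Y. \<forall>n\<in>Y. rel_index m n \<in> M)"
proof
  assume c: "scheme_clique Q l M Y"
  show "\<forall>m\<in>Y. \<forall>n\<in>Y. rel_index m n \<in> M"
  proof (intro ballI, rule ccontr)
    fix m n assume mn: "m \<in> Y" "n \<in> Y" "rel_index m n \<notin> M"
    then have "scheme_rel Q l (rel_index m n) \<inter> Y \<times> Y = {}"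
      using c rel_index_le[of m n] by (simp add: scheme_clique_def)
    moreover have "(m, n) \<in> scheme_rel Q l (rel_index m n)"
      using mn(1,2) assms(2) by (subst scheme_rel_iff) (auto simp: rel_index_le)
    ultimately show False using mn(1,2) by blast
  qed
next
  assume R: "\<forall>m\<in>Y. \<forall>n\<in>Y. rel_index m n \<in> M"
  have "(m, n) \<notin> scheme_rel Q l i" if "m \<in> Y" "n \<in> Y" "i \<in> {0..5} - M" for m n i
    using that R assms(2) scheme_rel_iff[of m n i] by auto
  then show "scheme_clique Q l M Y"
    using assms by (auto simp: scheme_clique_def)
qed

lemma scheme_design_iff:
  assumes "Y \<noteq> {}" "Y \<subseteq> scheme_points Q l"
  shows "scheme_design Q l T Y \<longleftrightarrow>
    (\<forall>j\<in>T. \<forall>n\<in>scheme_points Q l. (\<Sum>m\<in>Y. idempotent_matrix Q l j m n) = 0)"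
proof -
  have "(\<Sum>m\<in>scheme_points Q l. indicator Y m * idempotent_matrix Q l j m n) =
      (\<Sum>m\<in>Y. idempotent_matrix Q l j m n)" for j n
    using assms(2) by (intro sum.mono_neutral_cong_right) (auto simp: indicator_def)
  then show ?thesis using assms by (simp add: scheme_design_def)
qed

section \<open>Components in the anisotropic plane\<close>

text \<open>The difference of the two lifts is orthogonal to \<open>l\<close>, so it lies in
  \<open>l\<close> iff its component in \<open>U\<^sub>0\<close> vanishes.\<close>

lemma coincidences_h:
  assumes m: "m \<in> scheme_points Q l" and n: "n \<in> scheme_points Q l"
  shows "(a, b) \<in> coincidences m n \<longleftrightarrow> h (lift m a b) = h (lift n a b)"
proof
  assume "(a, b) \<in> coincidences m n"
  then show "h (lift m a b) = h (lift n a b)"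
    using h_l[of "lift m a b - lift n a b"] by (simp add: coincidences_def h_diff)
next
  assume "h (lift m a b) = h (lift n a b)"
  then have "lift m a b - lift n a b \<in> l"
    by (intro h_zero_in_l) (simp_all add: h_diff B_diff lift m n)
  then show "(a, b) \<in> coincidences m n" by (simp add: coincidences_def)
qed

lemma B_decompose:
  "B x y = B x o1 * B y e1 + B x o2 * B y e2 + B x e1 * B y o1 + B x e2 * B y o2 + B (h x) (h y)"
proof -
  have hy: "B e1 (h y) = 0" "B e2 (h y) = 0" "B o1 (h y) = 0" "B o2 (h y) = 0"
    using h_in_U[of y] B_commute by (auto simp: U\<^sub>0_def)
  have hx: "B (h x) (h y) = B (h x) y"
    using h_in_U[of x] by (subst decompose[of y]) (simp add: B_linear U\<^sub>0_def)
  have "B x y = B (B x o1 *s e1 + B x o2 *s e2 + B x e1 *s o1 + B x e2 *s o2 + h x) y"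
    using decompose[of x] by simp
  then show ?thesis
    by (simp add: B_linear hx B_commute[of _ y])
qed

definition h1 where "h1 m = h (lift m 1 0)"
definition h2 where "h2 m = h (lift m 0 1)"

lemma h1_U [simp]: "h1 m \<in> U\<^sub>0" and h2_U [simp]: "h2 m \<in> U\<^sub>0"
  by (simp_all add: h1_def h2_def)

lemma coincidences_UNIV:
  assumes m: "m \<in> scheme_points Q l" and n: "n \<in> scheme_points Q l"
  shows "card (coincidences m n) = CARD('a)\<^sup>2 \<longleftrightarrow> h1 m = h1 n \<and> h2 m = h2 n"
proof
  assume "card (coincidences m n) = CARD('a)\<^sup>2"
  then have "coincidences m n = UNIV"
    by (intro card_subset_eq) (simp_all add: power2_eq_square)
  then show "h1 m = h1 n \<and> h2 m = h2 n"
    using coincidences_h[OF m n] by (simp add: h1_def h2_def)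
next
  assume eq: "h1 m = h1 n \<and> h2 m = h2 n"
  have "h (lift m a b) = h (lift n a b)" for a b
    using arg_cong[OF lift_basis[OF m, of a b], of h] arg_cong[OF lift_basis[OF n, of a b], of h] eq
    by (simp add: h_add h_scale h1_def h2_def)
  then have "coincidences m n = UNIV"
    using coincidences_h[OF m n] by auto
  then show "card (coincidences m n) = CARD('a)\<^sup>2"
    by (simp add: power2_eq_square)
qed

lemma perspective_h:
  assumes m: "m \<in> scheme_points Q l" and n: "n \<in> scheme_points Q l"
  shows "perspective Q l m n \<longleftrightarrow>
    B (lift m 1 0) o2 + B (lift n 0 1) o1 + B (h1 m) (h2 n) =
    B (lift m 0 1) o1 + B (lift n 1 0) o2 + B (h2 m) (h1 n)"
  unfolding perspective_iff[OF m n]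
  by (subst (1 2) B_decompose) (simp add: lift m n h1_def h2_def)

text \<open>The two dual basis vectors of the totally singular line \<open>m\<close> are orthogonal;
  their product is expanded in the frame.\<close>

lemma h1_h2_product:
  assumes m: "m \<in> scheme_points Q l"
  shows "B (h1 m) (h2 m) = - B (lift m 1 0) o2 - B (lift m 0 1) o1"
proof -
  have "X = - b - a" if "0 = a + b + X" for X a b :: 'a
    using that by (metis add.commute diff_conv_add_uminus minus_add_distrib minus_unique)
  moreover have "0 = B (lift m 0 1) o1 + B (lift m 1 0) o2 + B (h1 m) (h2 m)"
    using B_lift_same[OF m, of 1 0 0 1] B_decompose[of "lift m 1 0" "lift m 0 1"]
    by (simp add: lift m h1_def h2_def add.commute)
  ultimately show ?thesis .
qed

text \<open>As \<open>u\<close> is not orthogonal to itself, a multiple of \<open>u\<close>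
  translates any fibre of \<open>x \<mapsto> B x u\<close> to the zero fibre; the q fibres share the
  q^2 vectors equally.\<close>

lemma card_U_affine:
  assumes u: "u \<in> U\<^sub>0" "u \<noteq> 0"
  shows "card {x \<in> U\<^sub>0. B x u = c} = CARD('a)"
proof -
  have Bu: "B u u \<noteq> 0"
    using U_anisotropic[OF u(1)] u(2) two by auto
  have *: "card {x \<in> U\<^sub>0. B x u = c} = card {x \<in> U\<^sub>0. B x u = 0}" for c
  proof (rule bij_betw_same_card)
    let ?w = "(c / B u u) *s u"
    have w: "?w \<in> U\<^sub>0" "B ?w u = c"
      using u(1) Bu subspace_U by (simp_all add: vec.subspace_scale B_left)
    show "bij_betw (\<lambda>x. x - ?w) {x \<in> U\<^sub>0. B x u = c} {x \<in> U\<^sub>0. B x u = 0}"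
      by (rule bij_betw_byWitness[where f' = "\<lambda>x. x + ?w"])
        (use w subspace_U in \<open>auto simp: B_diff B_left(1) vec.subspace_diff vec.subspace_add\<close>)
  qed
  have "card U\<^sub>0 = (\<Sum>c\<in>UNIV. card {x \<in> U\<^sub>0. B x u = c})"
    by (subst card_UN_disjoint[symmetric]) (auto intro!: arg_cong[where f = card])
  also have "\<dots> = (\<Sum>c\<in>(UNIV :: 'a set). card {x \<in> U\<^sub>0. B x u = 0})"
    by (intro sum.cong[OF refl] *)
  also have "\<dots> = CARD('a) * card {x \<in> U\<^sub>0. B x u = 0}"
    by simp
  finally have "CARD('a) * card {x \<in> U\<^sub>0. B x u = 0} = CARD('a) * CARD('a)"
    by (simp add: card_U power2_eq_square)
  then have "card {x \<in> U\<^sub>0. B x u = 0} = CARD('a)" by simp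
  then show ?thesis using *[of c] by simp
qed

end

section \<open>Cliques and designs from pseudo-ovals\<close>

locale frame_oval = frame Q e1 e2 o1 o2
  for Q :: "'a::{field,finite} ^ 6 \<Rightarrow> 'a" and e1 e2 o1 o2 +
  fixes Y :: "('a ^ 6) set set"
  assumes Y_points: "Y \<subseteq> scheme_points Q l"
    and card_Y: "card Y = CARD('a)\<^sup>2"
    and spanning: "\<And>m n. m \<in> Y \<Longrightarrow> n \<in> Y \<Longrightarrow> m \<noteq> n \<Longrightarrow> vec.span (l \<union> m \<union> n) = UNIV"
begin

lemma Y_point: "m \<in> Y \<Longrightarrow> m \<in> scheme_points Q l"
  using Y_points by blast

lemma Y_nonempty: "Y \<noteq> {}"
  using card_Y by auto

lemma coincidences_Y:
  assumes "m \<in> Y" "n \<in> Y" "m \<noteq> n"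
  shows "coincidences m n = {(0, 0)}"
  using coincidences_spanning[OF Y_point Y_point spanning] assms by blast

lemma rel_index_Y:
  assumes "m \<in> Y" "n \<in> Y"
  shows "rel_index m n = (if m = n then 0 else if perspective Q l m n then 5 else 4)"
proof -
  have "1 < CARD('a)" by (rule card_gt_1)
  then have "1 \<noteq> CARD('a)\<^sup>2" "1 \<noteq> CARD('a)" by (metis less_irrefl one_less_power zero_less_numeral, simp)
  then show ?thesis
    using coincidences_Y[OF assms] by (cases "m = n") (simp_all add: rel_index_def)
qed

lemma clique_045: "scheme_clique Q l {0, 4, 5} Y"
  by (auto simp: scheme_clique_iff Y_nonempty Y_points rel_index_Y)

lemma clique_05_iff: "scheme_clique Q l {0, 5} Y \<longleftrightarrow> (\<forall>m\<in>Y. \<forall>n\<in>Y. perspective Q l m n)"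
  using perspective_refl[OF Y_point]
  by (auto simp: scheme_clique_iff Y_nonempty Y_points rel_index_Y)

text \<open>Equal images would be a nontrivial coincidence of two lines that span the space with
  \<open>l\<close>; both sets have q^2 elements.\<close>

lemma bij_h_lift:
  assumes "(a, b) \<noteq> (0, 0)"
  shows "bij_betw (\<lambda>m. h (lift m a b)) Y U\<^sub>0"
proof -
  have inj: "inj_on (\<lambda>m. h (lift m a b)) Y"
  proof (rule inj_onI, rule ccontr)
    fix m n assume mn: "m \<in> Y" "n \<in> Y" "h (lift m a b) = h (lift n a b)" "m \<noteq> n"
    then have "(a, b) \<in> coincidences m n"
      by (simp add: coincidences_h Y_point)
    then show False using coincidences_Y[OF mn(1,2,4)] assms by simp
  qed
  moreover have "(\<lambda>m. h (lift m a b)) ` Y = U\<^sub>0"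
    by (intro card_subset_eq) (auto simp: card_image[OF inj] card_Y card_U)
  ultimately show ?thesis by (simp add: bij_betw_def)
qed

text \<open>Pairs of a line of \<open>Y\<close> and a nonzero coincidence with \<open>n\<close> are
  counted twice. By \<open>bij_h_lift\<close> each nonzero (a, b) occurs for exactly one line of
  \<open>Y\<close>, so the total is q^2 - 1 whatever \<open>n\<close> is, and this balances the
  constant term of \<open>idempotent_1\<close>.\<close>

lemma design_1: "scheme_design Q l {1} Y"
proof -
  have "(\<Sum>m\<in>Y. idempotent_matrix Q l 1 m n) = 0" if n: "n \<in> scheme_points Q l" for n
  proof -
    define q where "q = real CARD('a)"
    have q: "q > 1" using card_gt_1[where 'k='a] by (simp add: q_def)
    have zero: "(0, 0) \<in> coincidences m n" if "m \<in> Y" for m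
      using Y_point[OF that] n
      by (simp add: coincidences_def lift_linear vec.subspace_0 subspace_lin)
    have "(\<Sum>m\<in>Y. real (card (coincidences m n)) - 1) =
        (\<Sum>m\<in>Y. \<Sum>p\<in>UNIV - {(0, 0)}. of_bool (p \<in> coincidences m n))"
    proof (rule sum.cong[OF refl])
      fix m assume "m \<in> Y"
      have "(UNIV - {(0, 0)}) \<inter> {p. p \<in> coincidences m n} = coincidences m n - {(0, 0)}"
        by auto
      then have "(\<Sum>p\<in>UNIV - {(0, 0)}. of_bool (p \<in> coincidences m n)) =
          real (card (coincidences m n - {(0, 0)}))"
        by simp
      also have "\<dots> = real (card (coincidences m n)) - 1"
        using card_Suc_Diff1[OF _ zero[OF \<open>m \<in> Y\<close>]] by simp
      finally show "real (card (coincidences m n)) - 1 =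
          (\<Sum>p\<in>UNIV - {(0, 0)}. of_bool (p \<in> coincidences m n))" by simp
    qed
    also have "\<dots> = (\<Sum>p\<in>UNIV - {(0, 0)}. \<Sum>m\<in>Y. of_bool (p \<in> coincidences m n))"
      by (rule sum.swap)
    also have "\<dots> = (\<Sum>p\<in>(UNIV :: ('a \<times> 'a) set) - {(0, 0)}. 1)"
    proof (rule sum.cong[OF refl])
      fix p :: "'a \<times> 'a" assume p: "p \<in> UNIV - {(0, 0)}"
      obtain a b where ab: "p = (a, b)" by (rule prod.exhaust)
      have bij: "bij_betw (\<lambda>m. h (lift m a b)) Y U\<^sub>0"
        using p ab by (intro bij_h_lift) simp
      then have "h (lift n a b) \<in> (\<lambda>m. h (lift m a b)) ` Y"
        by (simp add: bij_betw_imp_surj_on)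
      then obtain m where m: "m \<in> Y" "h (lift m a b) = h (lift n a b)"
        by (elim imageE) simp
      have "(m' \<in> Y \<and> p \<in> coincidences m' n) \<longleftrightarrow> m' = m" for m'
        using bij m coincidences_h[OF Y_point n] by (auto simp: ab bij_betw_def inj_on_def)
      then have "Y \<inter> {m'. p \<in> coincidences m' n} = {m}" by auto
      then show "(\<Sum>m\<in>Y. of_bool (p \<in> coincidences m n)) = (1::real)" by simp
    qed
    also have "\<dots> = q ^ 2 - 1"
    proof -
      have "real (card ((UNIV :: ('a \<times> 'a) set) - {(0, 0)})) = real (CARD('a) * CARD('a)) - 1"
        by (subst card_Diff_singleton) (simp_all add: of_nat_diff Suc_leI)
      then show ?thesis by (simp add: q_def power2_eq_square)
    qed
    finally have s: "(\<Sum>m\<in>Y. real (card (coincidences m n)) - 1) = q ^ 2 - 1" .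
    have "(\<Sum>m\<in>Y. idempotent_matrix Q l 1 m n) = (\<Sum>m\<in>Y. 1 / q ^ 5 *
        (q ^ 2 / (q - 1) * (real (card (coincidences m n)) - 1) - (q + 1)))"
      by (intro sum.cong[OF refl]) (simp only: idempotent_1[OF Y_point n] q_def, simp add: algebra_simps)
    also have "\<dots> = 1 / q ^ 5 * (q ^ 2 / (q - 1) *
        (\<Sum>m\<in>Y. real (card (coincidences m n)) - 1) - real (card Y) * (q + 1))"
      by (simp only: sum_distrib_left[symmetric] sum_subtractf sum_constant)
    also have "\<dots> = 1 / q ^ 5 * (q ^ 2 / (q - 1) * (q ^ 2 - 1) - q ^ 2 * (q + 1))"
      by (simp add: s card_Y q_def)
    also have "\<dots> = 0"
      using q by (simp add: field_simps power2_eq_square)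
    finally show ?thesis .
  qed
  then show ?thesis by (simp add: scheme_design_iff Y_nonempty Y_points)
qed

lemma sum_idempotent_5:
  assumes n: "n \<in> scheme_points Q l"
  shows "(\<Sum>m\<in>Y. idempotent_matrix Q l 5 m n) = 1 / (2 * real CARD('a) ^ 3) *
    (real CARD('a) ^ 2 - real CARD('a) * real (card {m \<in> Y. perspective Q l m n})
      + real CARD('a) ^ 3 * of_bool (n \<in> Y)
      - real CARD('a) ^ 2 * real (card {m \<in> Y. h1 m = h1 n \<and> h2 m = h2 n}))"
proof -
  have "(\<Sum>m\<in>Y. idempotent_matrix Q l 5 m n) = (\<Sum>m\<in>Y. 1 / (2 * real CARD('a) ^ 3) *
    (1 - real CARD('a) * of_bool (perspective Q l m n) + real CARD('a) ^ 3 * of_bool (m = n)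
      - real CARD('a) ^ 2 * of_bool (h1 m = h1 n \<and> h2 m = h2 n)))"
    by (intro sum.cong[OF refl]) (simp only: idempotent_5[OF Y_point n] coincidences_UNIV[OF Y_point n])
  also have "\<dots> = 1 / (2 * real CARD('a) ^ 3) * (real (card Y)
      - real CARD('a) * (\<Sum>m\<in>Y. of_bool (perspective Q l m n))
      + real CARD('a) ^ 3 * (\<Sum>m\<in>Y. of_bool (m = n))
      - real CARD('a) ^ 2 * (\<Sum>m\<in>Y. of_bool (h1 m = h1 n \<and> h2 m = h2 n)))"
    by (simp only: sum_distrib_left[symmetric] sum_subtractf sum.distrib sum_constant mult_1_right)
  also have "(\<Sum>m\<in>Y. of_bool (perspective Q l m n)) = real (card {m \<in> Y. perspective Q l m n})"
    by (simp add: Int_def)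
  also have "(\<Sum>m\<in>Y. of_bool (h1 m = h1 n \<and> h2 m = h2 n)) =
      real (card {m \<in> Y. h1 m = h1 n \<and> h2 m = h2 n})"
    by (simp only: sum_of_bool_eq finite Int_def mem_Collect_eq)
  also have "(\<Sum>m\<in>Y. of_bool (m = n)) = (of_bool (n \<in> Y) :: real)"
    by (simp add: of_bool_def sum.delta)
  finally show ?thesis by (simp add: card_Y)
qed

lemma coincident_Y:
  assumes "n \<in> Y"
  shows "{m \<in> Y. h1 m = h1 n \<and> h2 m = h2 n} = {n}"
proof -
  have "m = n" if "m \<in> Y" "h1 m = h1 n" for m
    using bij_h_lift[of 1 0] that assms by (auto simp: bij_betw_def inj_on_def h1_def)
  then show ?thesis using assms by auto
qed

text \<open>At a line \<open>n\<close> of \<open>Y\<close> only \<open>n\<close> itself contributes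
  to the last two counts. The sum then vanishes only if q^2 lines, that is all of \<open>Y\<close>,
  are in perspective with \<open>n\<close>.\<close>

lemma design_5_imp_perspective:
  assumes "scheme_design Q l {1, 5} Y"
  shows "\<forall>m\<in>Y. \<forall>n\<in>Y. perspective Q l m n"
proof -
  have "{m \<in> Y. perspective Q l m n} = Y" if n: "n \<in> Y" for n
  proof -
    define q where "q = real CARD('a)"
    have q: "q > 1" using card_gt_1[where 'k='a] by (simp add: q_def)
    have "(\<Sum>m\<in>Y. idempotent_matrix Q l 5 m n) = 0"
      using assms Y_point[OF n] by (simp add: scheme_design_iff Y_nonempty Y_points)
    then have "q ^ 2 - q * real (card {m \<in> Y. perspective Q l m n}) + q ^ 3 - q ^ 2 = 0"
      unfolding sum_idempotent_5[OF Y_point[OF n]] coincident_Y[OF n] q_def[symmetric]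
      using n q by simp
    then have "q * real (card {m \<in> Y. perspective Q l m n}) = q ^ 3" by simp
    also have "\<dots> = q * q ^ 2" by (simp add: power3_eq_cube power2_eq_square)
    finally have "q * real (card {m \<in> Y. perspective Q l m n}) = q * q ^ 2" .
    then have "real (card {m \<in> Y. perspective Q l m n}) = q ^ 2"
      using q by (simp only: mult_cancel_left) simp
    then have "real (card {m \<in> Y. perspective Q l m n}) = real (card Y)"
      by (simp add: card_Y q_def)
    then show ?thesis by (intro card_subset_eq) auto
  qed
  then show ?thesis by blast
qed

end

section \<open>Ovals whose pairs are all in perspective\<close>

locale perspective_oval = frame_oval Q e1 e2 o1 o2 Y
  for Q :: "'a::{field,finite} ^ 6 \<Rightarrow> 'a" and e1 e2 o1 o2 Y +
  assumes o_in_Y: "lin o1 o2 \<in> Y"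
    and persp: "\<And>m n. m \<in> Y \<Longrightarrow> n \<in> Y \<Longrightarrow> perspective Q l m n"
begin

lemma lift_o: "lift (lin o1 o2) a b = a *s o1 + b *s o2"
  using lift_unique[OF o_in_scheme_points, of "a *s o1 + b *s o2"]
  by (simp add: B_linear lin_memI)

text \<open>Perspective with the frame line, a member of \<open>Y\<close>, makes the two products
  equal, and \<open>h1_h2_product\<close> gives their sum. Hence a line of \<open>Y\<close> is
  determined by its components in \<open>U\<^sub>0\<close>.\<close>

lemma products_o:
  assumes m: "m \<in> Y"
  shows "B (lift m 1 0) o2 = - B (h1 m) (h2 m) / 2" "B (lift m 0 1) o1 = - B (h1 m) (h2 m) / 2"
proof -
  have "B (lift m 1 0) o2 = B (lift m 0 1) o1"
    using perspectiveD[OF Y_point[OF m] Y_point[OF o_in_Y] persp[OF m o_in_Y], of 1 0 0 1]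
    by (simp add: lift_o)
  then show "B (lift m 1 0) o2 = - B (h1 m) (h2 m) / 2" "B (lift m 0 1) o1 = - B (h1 m) (h2 m) / 2"
    using h1_h2_product[OF Y_point[OF m]] two by (simp_all add: field_simps)
qed

definition \<tau> where "\<tau> x = h2 (the_inv_into Y h1 x)"

lemma bij_h1: "bij_betw h1 Y U\<^sub>0"
  using bij_h_lift[of 1 0] by (simp add: h1_def[abs_def])

lemma \<tau>_h1: "m \<in> Y \<Longrightarrow> \<tau> (h1 m) = h2 m"
  using bij_h1 by (simp add: \<tau>_def bij_betw_def the_inv_into_f_f)

lemma obtain_h1:
  assumes "x \<in> U\<^sub>0"
  obtains m where "m \<in> Y" "h1 m = x" "h2 m = \<tau> x"
proof -
  have "x \<in> h1 ` Y" using bij_h1 assms by (simp add: bij_betw_imp_surj_on)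
  then obtain m where "m \<in> Y" "x = h1 m" by (elim imageE)
  then show thesis using that \<tau>_h1 by simp
qed

lemma \<tau>_U [simp]: "\<tau> x \<in> U\<^sub>0"
  by (simp add: \<tau>_def)

text \<open>With the values from \<open>products_o\<close>, the frame terms on the two sides of
  \<open>perspective_h\<close> cancel.\<close>

lemma \<tau>_selfadjoint:
  assumes "x \<in> U\<^sub>0" "y \<in> U\<^sub>0"
  shows "B (\<tau> x) y = B x (\<tau> y)"
proof -
  obtain m where m: "m \<in> Y" "h1 m = x" "h2 m = \<tau> x" by (rule obtain_h1[OF assms(1)])
  obtain n where n: "n \<in> Y" "h1 n = y" "h2 n = \<tau> y" by (rule obtain_h1[OF assms(2)])
  show ?thesis
    using persp[OF m(1) n(1)] m(2,3) n(2,3)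
    unfolding perspective_h[OF Y_point[OF m(1)] Y_point[OF n(1)]]
    by (simp add: products_o m(1) n(1))
qed

text \<open>For a fixed line \<open>n\<close>, perspective with a line of \<open>Y\<close> is an
  affine condition on its component \<open>h1 m\<close>. Its solutions can therefore be counted as
  points of an affine line.\<close>

lemma perspective_\<tau>:
  assumes m: "m \<in> Y" and n: "n \<in> scheme_points Q l"
  shows "perspective Q l m n \<longleftrightarrow>
    B (h1 m) (h2 n - \<tau> (h1 n)) = B (lift n 1 0) o2 - B (lift n 0 1) o1"
  unfolding perspective_h[OF Y_point[OF m] n] products_o[OF m]
  using \<tau>_selfadjoint[of "h1 m" "h1 n"] \<tau>_h1[OF m]
  by (auto simp: B_diff algebra_simps)

lemma design_15: "scheme_design Q l {1, 5} Y"
proof -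
  define q where "q = real CARD('a)"
  have "(\<Sum>m\<in>Y. idempotent_matrix Q l 5 m n) = 0" if n: "n \<in> scheme_points Q l" for n
  proof -
    let ?P = "{m \<in> Y. perspective Q l m n}" and ?Z = "{m \<in> Y. h1 m = h1 n \<and> h2 m = h2 n}"
    have "q ^ 2 - q * real (card ?P) + q ^ 3 * of_bool (n \<in> Y) - q ^ 2 * real (card ?Z) = 0"
    proof (cases "n \<in> Y")
      case True
      then have "?P = Y" using persp by auto
      then have "card ?P = CARD('a)\<^sup>2" by (simp only: card_Y)
      with True show ?thesis
        by (simp add: coincident_Y q_def power3_eq_cube power2_eq_square)
    next
      case nY: False
      show ?thesis
      proof (cases "h2 n = \<tau> (h1 n)")
        case True
        obtain m where m: "m \<in> Y" "h1 m = h1 n" "h2 m = \<tau> (h1 n)"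
          by (rule obtain_h1[OF h1_U])
        have "?Z = {m' \<in> Y. h1 m' = h1 m \<and> h2 m' = h2 m}"
          by (simp add: m(2,3) True)
        also have "\<dots> = {m}" by (rule coincident_Y[OF m(1)])
        finally have Z: "card ?Z = 1" by simp
        \<comment> \<open>This \<open>m\<close> shares both components with \<open>n\<close> but
          differs from it, so the pair is not in perspective. The left side in
          \<open>perspective_\<tau>\<close> is 0 for every line of \<open>Y\<close>, so the failure
          at \<open>m\<close> is a failure everywhere.\<close>
        have "\<not> perspective Q l m n"
          using coincidences_full_not_perspective[OF Y_point[OF m(1)] n]
            coincidences_UNIV[OF Y_point[OF m(1)] n] m True nY by auto
        then have "?P = {}"
          using perspective_\<tau>[OF _ n] m(1) True by auto
        then have "card ?P = 0" by (simp only: card.empty)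
        then show ?thesis using Z nY by simp
      next
        case False
        let ?u = "h2 n - \<tau> (h1 n)" and ?c = "B (lift n 1 0) o2 - B (lift n 0 1) o1"
        have "?Z = {}" using False \<tau>_h1 by (auto, metis)
        then have Z: "card ?Z = 0" by (simp only: card.empty)
        \<comment> \<open>Now the linear part is nonzero, and the solutions correspond to an affine
          line with q points.\<close>
        have "h1 ` ?P = {x \<in> h1 ` Y. B x ?u = ?c}"
          using perspective_\<tau>[OF _ n] by blast
        then have "h1 ` ?P = {x \<in> U\<^sub>0. B x ?u = ?c}"
          using bij_h1 by (simp add: bij_betw_imp_surj_on)
        then have "card ?P = card {x \<in> U\<^sub>0. B x ?u = ?c}"
          using bij_h1 by (metis (no_types, lifting) bij_betw_def card_image inj_on_subset
              mem_Collect_eq subsetI)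
        also have "\<dots> = CARD('a)"
          using False by (intro card_U_affine) (simp_all add: vec.subspace_diff subspace_U)
        finally show ?thesis using Z nY by (simp add: q_def power2_eq_square)
      qed
    qed
    then show ?thesis
      unfolding sum_idempotent_5[OF n] q_def by simp
  qed
  then show ?thesis
    using design_1 by (simp add: scheme_design_iff Y_nonempty Y_points)
qed

end

section \<open>From perspective to conics\<close>

text \<open>The nonzero squares and their multiples by \<open>D\<close> are disjoint sets with (q -
  1) / 2 elements each, so they exhaust the nonzero elements.\<close>

lemma quotient_of_nonsquares:
  fixes D E :: "'k::{field,finite}"
  assumes two: "(2::'k) \<noteq> 0" and D: "\<And>x. D \<noteq> x\<^sup>2" and E: "\<And>x. E \<noteq> x\<^sup>2"
  shows "\<exists>x. E = D * x\<^sup>2"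
proof -
  let ?A = "(\<lambda>x. x\<^sup>2) ` (UNIV - {0::'k})" and ?A' = "(\<lambda>x. D * x\<^sup>2) ` (UNIV - {0::'k})"
  have D0: "D \<noteq> 0" using D[of 0] by simp
  have fibre: "card {x \<in> UNIV - {0}. x\<^sup>2 = s} = 2" if s: "s \<in> ?A" for s
  proof -
    obtain y where y: "y \<noteq> 0" "s = y\<^sup>2" using s by auto
    then have "{x \<in> UNIV - {0}. x\<^sup>2 = s} = {y, - y}"
      by (auto simp: power2_eq_iff)
    moreover have "y \<noteq> - y"
      using y(1) two by (metis eq_neg_iff_add_eq_0 mult_2 mult_eq_0_iff)
    ultimately show ?thesis by simp
  qed
  have "UNIV - {0::'k} = (\<Union>s\<in>?A. {x \<in> UNIV - {0}. x\<^sup>2 = s})"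
    by auto
  then have "card (UNIV - {0::'k}) = card (\<Union>s\<in>?A. {x \<in> UNIV - {0}. x\<^sup>2 = s})"
    by (rule arg_cong)
  also have "\<dots> = (\<Sum>s\<in>?A. card {x \<in> UNIV - {0}. x\<^sup>2 = s})"
    by (rule card_UN_disjoint) auto
  also have "\<dots> = 2 * card ?A"
    using fibre by simp
  finally have "card (UNIV - {0::'k}) = 2 * card ?A" .
  moreover have "card ?A' = card ?A"
  proof -
    have "?A' = (*) D ` ?A" by (simp add: image_image)
    moreover have "inj_on ((*) D) ?A" using D0 by (auto simp: inj_on_def)
    ultimately show ?thesis by (metis card_image)
  qed
  moreover have "?A \<inter> ?A' = {}"
  proof (rule ccontr)
    assume "?A \<inter> ?A' \<noteq> {}"
    then obtain x y where "x\<^sup>2 = D * y\<^sup>2" "y \<noteq> 0" by auto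
    then have "D = (x / y)\<^sup>2" by (simp add: power_divide)
    then show False using D by blast
  qed
  ultimately have "card (?A \<union> ?A') = card (UNIV - {0::'k})"
    by (simp add: card_Un_disjoint)
  moreover have "?A \<union> ?A' \<subseteq> UNIV - {0}" using D0 by auto
  ultimately have "?A \<union> ?A' = UNIV - {0}"
    by (intro card_subset_eq) auto
  moreover have "E \<noteq> 0" using E[of 0] by simp
  ultimately have "E \<in> ?A \<union> ?A'" by simp
  then show ?thesis using E by auto
qed

text \<open>A square root \<open>x\<close> of the discriminant would give the root (a + x) /
  2.\<close>

lemma discriminant_nonsquare:
  fixes a b :: "'k::field"
  assumes two: "(2::'k) \<noteq> 0" and "\<And>x. x\<^sup>2 \<noteq> a * x + b"
  shows "a\<^sup>2 + 4 * b \<noteq> x\<^sup>2"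
proof
  assume eq: "a\<^sup>2 + 4 * b = x\<^sup>2"
  define y where "y = (a + x) / 2"
  have y: "2 * y = a + x" using two by (simp add: y_def)
  have "4 * (y\<^sup>2 - (a * y + b)) = (2 * y)\<^sup>2 - 2 * a * (2 * y) - 4 * b"
    by (simp add: algebra_simps power2_eq_square)
  also have "\<dots> = x\<^sup>2 - (a\<^sup>2 + 4 * b)"
    unfolding y by (simp add: algebra_simps power2_eq_square)
  finally have "4 * (y\<^sup>2 - (a * y + b)) = x\<^sup>2 - (a\<^sup>2 + 4 * b)" .
  moreover have "(4::'k) \<noteq> 0"
    using two by (metis mult_2_right mult_eq_0_iff numeral_Bit0 one_add_one)
  ultimately have "y\<^sup>2 = a * y + b"
    using eq by (metis diff_self eq_iff_diff_eq_0 mult_eq_0_iff)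
  then show False using assms(2) by blast
qed

text \<open>Any two irreducible monic quadratics generate the same extension: \<open>\<alpha> + \<beta> X\<close> is a root of
  \<open>X\<^sup>2 - u X - v\<close> modulo \<open>X\<^sup>2 - a X - b\<close>.\<close>

lemma quadratic_generator_change:
  fixes a b u v :: "'k::{field,finite}"
  assumes two: "(2::'k) \<noteq> 0" and ab: "\<And>x. x\<^sup>2 \<noteq> a * x + b" and uv: "\<And>x. x\<^sup>2 \<noteq> u * x + v"
  obtains \<alpha> \<beta> where "\<beta> \<noteq> 0" "\<beta> * a + 2 * \<alpha> = u" "\<beta>\<^sup>2 * b + \<alpha>\<^sup>2 = u * \<alpha> + v"
proof -
  obtain \<beta> where \<beta>: "u\<^sup>2 + 4 * v = (a\<^sup>2 + 4 * b) * \<beta>\<^sup>2"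
    using quotient_of_nonsquares[OF two discriminant_nonsquare[OF two ab]
        discriminant_nonsquare[OF two uv]] by blast
  define \<alpha> where "\<alpha> = (u - \<beta> * a) / 2"
  have four: "(4::'k) \<noteq> 0"
    using two by (metis mult_2_right mult_eq_0_iff numeral_Bit0 one_add_one)
  have "2 * \<alpha> = u - \<beta> * a" unfolding \<alpha>_def using two by (simp del: right_diff_distrib_numeral)
  then have u: "u = \<beta> * a + 2 * \<alpha>" by simp
  have "4 * (\<beta>\<^sup>2 * b + \<alpha>\<^sup>2) = 4 * (u * \<alpha> + v)"
    using \<beta> unfolding u by (simp add: algebra_simps power2_eq_square)
  then have "\<beta>\<^sup>2 * b + \<alpha>\<^sup>2 = u * \<alpha> + v"
    using four by (metis mult_left_cancel)
  moreover have "\<beta> \<noteq> 0"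
    using \<beta> discriminant_nonsquare[OF two uv, of 0] by auto
  ultimately show thesis using that u by blast
qed

section \<open>Points over the quadratic extension as lines\<close>

lemma Quad_times [simp]: "Quad a b * Quad c d =
    Quad (a * c + snd quad_par * (b * d)) (a * d + b * c + fst quad_par * (b * d))"
  by (simp add: times_quad_ext_def)

lemma Quad_plus [simp]: "Quad a b + Quad c d = Quad (a + c) (b + d)"
  by (simp add: plus_quad_ext_def)

lemma Quad_eq_0_iff [simp]: "Quad a b = 0 \<longleftrightarrow> a = 0 \<and> b = 0"
  by (simp add: zero_quad_ext_def)

lemma quad_ext_two: "(2::'a::{field,finite}) \<noteq> 0 \<Longrightarrow> (2::'a quad_ext) \<noteq> 0"
proof -
  have "(2::'a quad_ext) = Quad 2 0"
    unfolding one_add_one[symmetric] by (simp add: one_quad_ext_def)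
  then show "(2::'a) \<noteq> 0 \<Longrightarrow> (2::'a quad_ext) \<noteq> 0" by (metis Quad_eq_0_iff)
qed

lemma restr_scale_decompose: "Quad a b *s w = restr_scale a w + restr_scale b (Quad 0 1 *s w)"
  by (simp add: restr_scale_def flip: vec.scale_left_distrib)

text \<open>The extension has basis 1 and X = \<open>Quad 0 1\<close> over GF(q), so a point becomes
  the line generated by the images of \<open>w\<close> and X \<open>w\<close>.\<close>

lemma image_point:
  assumes lin: "Vector_Spaces.linear restr_scale (*s) (\<phi> :: 'a::{field,finite} quad_ext ^ 'n \<Rightarrow> 'a ^ 'm)"
  shows "\<phi> ` range (\<lambda>c. c *s w) = lin (\<phi> w) (\<phi> (Quad 0 1 *s w))"
proof -
  have "\<phi> (Quad a b *s w) = a *s \<phi> w + b *s \<phi> (Quad 0 1 *s w)" for a b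
    using lin by (subst restr_scale_decompose) (simp add: Vector_Spaces.linear_iff)
  note eq = this
  show ?thesis
  proof (intro set_eqI iffI)
    fix v assume "v \<in> \<phi> ` range (\<lambda>c. c *s w)"
    then obtain c where "v = \<phi> (c *s w)" by auto
    moreover obtain a b where "c = Quad a b" by (cases c)
    ultimately have "v = a *s \<phi> w + b *s \<phi> (Quad 0 1 *s w)"
      using eq[of a b] by simp
    then show "v \<in> lin (\<phi> w) (\<phi> (Quad 0 1 *s w))"
      by (simp only: lin_memI)
  next
    fix v assume "v \<in> lin (\<phi> w) (\<phi> (Quad 0 1 *s w))"
    then obtain a b where "v = a *s \<phi> w + b *s \<phi> (Quad 0 1 *s w)"
      by (rule lin_memE)
    then have v: "v = \<phi> (Quad a b *s w)" using eq[of a b] by simp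
    have "Quad a b *s w \<in> range (\<lambda>c. c *s w)" by (rule range_eqI[of _ _ "Quad a b"]) simp
    then show "v \<in> \<phi> ` range (\<lambda>c. c *s w)" unfolding v by (rule imageI)
  qed
qed

lemma subspace_range_scale: "vec.subspace (range (\<lambda>c. c *s w))"
proof (rule vec.subspaceI)
  show "0 \<in> range (\<lambda>c. c *s w)"
    by (rule range_eqI[of _ _ 0]) simp
next
  fix x y assume "x \<in> range (\<lambda>c. c *s w)" "y \<in> range (\<lambda>c. c *s w)"
  then obtain c d where "x + y = (c + d) *s w"
    by (auto simp: vec.scale_left_distrib)
  then show "x + y \<in> range (\<lambda>c. c *s w)" by blast
next
  fix c x assume "x \<in> range (\<lambda>c. c *s w)"
  then obtain d where "x = d *s w" by blast
  then have "c *s x = (c * d) *s w" by simp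
  then show "c *s x \<in> range (\<lambda>c. c *s w)" by blast
qed

lemma singular_points:
  fixes C :: "'k::{field,finite} ^ 'n \<Rightarrow> 'k"
  assumes "quadratic_form C"
  shows "singular_subspaces C 1 = {range (\<lambda>c. c *s w) |w. w \<noteq> 0 \<and> C w = 0}"
proof (intro set_eqI iffI)
  fix U assume "U \<in> singular_subspaces C 1"
  then have U: "vec.subspace U" "vec.dim U = 1" "\<And>x. x \<in> U \<Longrightarrow> C x = 0"
    by (auto simp: singular_subspaces_def)
  then have "\<not> U \<subseteq> {0}" by (metis vec.dim_eq_0 zero_neq_one)
  then obtain w where w: "w \<in> U" "w \<noteq> 0" by blast
  have "inj (\<lambda>c. c *s w)" using w(2) by (simp add: inj_on_def)
  then have "card (range (\<lambda>c. c *s w)) = CARD('k)" by (simp add: card_image)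
  moreover have "card U = CARD('k)" using U(1,2) by (simp add: card_subspace)
  moreover have "range (\<lambda>c. c *s w) \<subseteq> U" using U(1) w(1) by (auto intro: vec.subspace_scale)
  ultimately have "range (\<lambda>c. c *s w) = U" by (intro card_subset_eq) auto
  then show "U \<in> {range (\<lambda>c. c *s w) |w. w \<noteq> 0 \<and> C w = 0}"
    using w U(3) by blast
next
  fix U assume "U \<in> {range (\<lambda>c. c *s w) |w. w \<noteq> 0 \<and> C w = 0}"
  then obtain w where w: "U = range (\<lambda>c. c *s w)" "w \<noteq> 0" "C w = 0" by blast
  have "inj (\<lambda>c. c *s w)" using w(2) by (simp add: inj_on_def)
  then have "card U = CARD('k)" by (simp add: w(1) card_image)
  then have "vec.dim U = 1"
    by (simp add: dim_eq_iff_card_eq w(1) subspace_range_scale)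
  then show "U \<in> singular_subspaces C 1"
    using assms w by (auto simp: singular_subspaces_def subspace_range_scale quadratic_form_def)
qed

section \<open>The self-adjoint map and its quadratic equation\<close>

context perspective_oval
begin

lemma U_radical:
  assumes "x \<in> U\<^sub>0" "\<And>z. z \<in> U\<^sub>0 \<Longrightarrow> B x z = 0"
  shows "x = 0"
  using assms U_anisotropic[of x] two by (metis B_self mult_eq_0_iff)

text \<open>Linearity of \<open>\<tau>\<close> comes from self-adjointness: the defect is orthogonal
  to all of the anisotropic plane \<open>U\<^sub>0\<close>.\<close>

lemma \<tau>_add:
  assumes "x \<in> U\<^sub>0" "y \<in> U\<^sub>0"
  shows "\<tau> (x + y) = \<tau> x + \<tau> y"
proof -
  have "\<tau> (x + y) - (\<tau> x + \<tau> y) = 0"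
    by (rule U_radical)
      (simp_all add: assms subspace_U vec.subspace_add vec.subspace_diff B_linear \<tau>_selfadjoint)
  then show ?thesis by simp
qed

lemma \<tau>_scale:
  assumes "x \<in> U\<^sub>0"
  shows "\<tau> (c *s x) = c *s \<tau> x"
proof -
  have "\<tau> (c *s x) - c *s \<tau> x = 0"
    by (rule U_radical)
      (simp_all add: assms subspace_U vec.subspace_scale vec.subspace_diff B_linear \<tau>_selfadjoint)
  then show ?thesis by simp
qed

text \<open>An eigenvector gives a line of \<open>Y\<close> whose lift of (-c, 1) has no component
  in \<open>U\<^sub>0\<close>. The frame line has this property too, and \<open>bij_h_lift\<close>
  identifies the two.\<close>

lemma \<tau>_no_eigenvector:
  assumes x: "x \<in> U\<^sub>0" "\<tau> x = c *s x"
  shows "x = 0"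
proof -
  obtain m where m: "m \<in> Y" "h1 m = x" "h2 m = \<tau> x" by (rule obtain_h1[OF x(1)])
  have "h (lift m (- c) 1) = 0"
    using arg_cong[OF lift_basis[OF Y_point[OF m(1)], of "- c" 1], of h] m(2,3) x(2)
    by (simp add: h_add h_scale h1_def h2_def h_diff)
  moreover have ho: "h o1 = 0" "h o2 = 0" by (simp_all add: h_def)
  then have "h (lift (lin o1 o2) (- c) 1) = 0"
    by (subst lift_o) (simp add: h_add h_scale h_diff)
  ultimately have "m = lin o1 o2"
    using bij_h_lift[of "- c" 1] m(1) o_in_Y by (auto simp: bij_betw_def inj_on_def)
  then show ?thesis
    using m(2) ho lift_o[of 1 0] by (simp add: h1_def)
qed

lemma obtain_nonzero_U:
  obtains u where "u \<in> U\<^sub>0" "u \<noteq> 0"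
proof -
  have "card U\<^sub>0 \<noteq> card {0::'a^6}"
    using card_U card_gt_1[where 'k='a] by (simp add: power2_eq_square)
  then have "U\<^sub>0 \<noteq> {0}" by metis
  then show thesis using that subspace_U vec.subspace_0 by blast
qed

lemma \<tau>_independent:
  assumes "u \<in> U\<^sub>0" "u \<noteq> 0" "x *s u + y *s \<tau> u = 0"
  shows "x = 0 \<and> y = 0"
proof -
  have "y = 0"
  proof (rule ccontr)
    assume "y \<noteq> 0"
    then have "\<tau> u = (1 / y) *s (y *s \<tau> u)" by simp
    also have "y *s \<tau> u = (- x) *s u"
      using assms(3) by (metis add_eq_0_iff vec.scale_minus_left)
    finally have "\<tau> u = (1 / y * - x) *s u" by simp
    then show False using \<tau>_no_eigenvector[OF assms(1)] assms(2) by blast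
  qed
  then show ?thesis using assms(2,3) by simp
qed

lemma U_eq_lin:
  assumes "u \<in> U\<^sub>0" "u \<noteq> 0"
  shows "U\<^sub>0 = lin u (\<tau> u)"
  using \<tau>_independent[OF assms] card_U assms(1)
  by (intro lin_eq) (auto simp: subspace_U dim_eq_iff_card_eq)

lemma \<tau>_quadratic:
  obtains a b where "\<And>x. x \<in> U\<^sub>0 \<Longrightarrow> \<tau> (\<tau> x) = a *s \<tau> x + b *s x" "\<And>c. c\<^sup>2 \<noteq> a * c + b"
proof -
  obtain u where u: "u \<in> U\<^sub>0" "u \<noteq> 0" by (rule obtain_nonzero_U)
  have "\<tau> (\<tau> u) \<in> lin u (\<tau> u)" using U_eq_lin[OF u] by (metis \<tau>_U)
  then obtain a b where ab: "\<tau> (\<tau> u) = b *s u + a *s \<tau> u" by (elim lin_memE)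
  have "\<tau> (\<tau> x) = a *s \<tau> x + b *s x" if x: "x \<in> U\<^sub>0" for x
  proof -
    obtain c d where "x = c *s u + d *s \<tau> u"
      using x U_eq_lin[OF u] by (auto elim!: lin_memE)
    then show ?thesis
      using u(1) subspace_U
      by (simp add: \<tau>_add \<tau>_scale vec.subspace_scale vec.subspace_add ab)
        (simp add: vec_eq_iff algebra_simps)
  qed
  moreover have "c\<^sup>2 \<noteq> a * c + b" for c
  proof
    assume c: "c\<^sup>2 = a * c + b"
    \<comment> \<open>If \<open>c\<close> is a root, the other root is \<open>a - c\<close>;
      applying \<open>\<tau> - (a - c)\<close> to \<open>u\<close> gives an eigenvector for
      \<open>c\<close>.\<close>
    let ?w = "\<tau> u + (c - a) *s u"
    have w: "?w \<in> U\<^sub>0"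
      by (intro vec.subspace_add vec.subspace_scale subspace_U \<tau>_U u(1))
    have "\<tau> ?w = \<tau> (\<tau> u) + (c - a) *s \<tau> u"
      using \<tau>_add[OF \<tau>_U, of "(c - a) *s u" u] \<tau>_scale[OF u(1), of "c - a"]
        vec.subspace_scale[OF subspace_U u(1), of "c - a"] by simp
    also have "\<dots> = c *s \<tau> u + b *s u"
      by (simp add: ab vec_eq_iff algebra_simps)
    also have "b = c * (c - a)" using c by (simp add: algebra_simps power2_eq_square)
    finally have "\<tau> ?w = c *s ?w" by (simp add: vec_eq_iff algebra_simps)
    then have "?w = 0" by (rule \<tau>_no_eigenvector[OF w])
    then have "(c - a) *s u + 1 *s \<tau> u = 0" by (simp add: add.commute)
    then show False using \<tau>_independent[OF u, of "c - a" 1] by simp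
  qed
  ultimately show thesis using that by blast
qed

text \<open>Replaces \<open>\<tau>\<close> by \<alpha> + \<beta> \<open>\<tau>\<close>, so that it
  satisfies the equation of X in \<open>quad_ext\<close> and can serve as multiplication by X. Only
  the dual bases change; both frame lines stay the same.\<close>

lemma change_frame:
  obtains e1' e2' o2' where "perspective_oval Q e1' e2' o1 o2' Y" "lin e1' e2' = l"
    "\<forall>x\<in>frame.U\<^sub>0 Q e1' e2' o1 o2'.
      perspective_oval.\<tau> Q e1' e2' o1 o2' Y (perspective_oval.\<tau> Q e1' e2' o1 o2' Y x) =
      fst quad_par *s perspective_oval.\<tau> Q e1' e2' o1 o2' Y x + snd quad_par *s x"
proof -
  obtain a b where ab: "\<And>x. x \<in> U\<^sub>0 \<Longrightarrow> \<tau> (\<tau> x) = a *s \<tau> x + b *s x"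
    "\<And>c. c\<^sup>2 \<noteq> a * c + b" by (rule \<tau>_quadratic) blast
  obtain \<alpha> \<beta> where \<beta>: "\<beta> \<noteq> 0" "\<beta> * a + 2 * \<alpha> = fst (quad_par :: 'a \<times> 'a)"
    "\<beta>\<^sup>2 * b + \<alpha>\<^sup>2 = fst quad_par * \<alpha> + snd (quad_par :: 'a \<times> 'a)"
    by (rule quadratic_generator_change[OF two ab(2) quad_par_no_root])
  \<comment> \<open>The vector \<open>o2'\<close> has the coordinates (\<alpha>, \<beta>) with
    respect to \<open>e1, e2\<close>, and \<open>e1', e2'\<close> is the basis of \<open>l\<close>
    dual to \<open>o1, o2'\<close>.\<close>
  define e1' e2' o2' where "e1' = e1 - (\<alpha> / \<beta>) *s e2" and "e2' = (1 / \<beta>) *s e2"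
    and "o2' = \<alpha> *s o1 + \<beta> *s o2"
  have l': "lin e1' e2' = l"
  proof
    show "lin e1' e2' \<subseteq> l"
      unfolding e1'_def e2'_def
      by (intro lin_subset subspace_lin vec.subspace_diff vec.subspace_scale lin_generators)
    have "e1 = 1 *s e1' + \<alpha> *s e2'" "e2 = 0 *s e1' + \<beta> *s e2'"
      using \<beta>(1) by (simp_all add: e1'_def e2'_def vec_eq_iff field_simps)
    then have "e1 \<in> lin e1' e2'" "e2 \<in> lin e1' e2'" by (metis lin_memI)+
    then show "l \<subseteq> lin e1' e2'" by (intro lin_subset subspace_lin)
  qed
  have o': "lin o1 o2' = lin o1 o2"
  proof
    show "lin o1 o2' \<subseteq> lin o1 o2"
      unfolding o2'_def
      by (intro lin_subset subspace_lin vec.subspace_add vec.subspace_scale lin_generators)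
    have "o2 = (- \<alpha> / \<beta>) *s o1 + (1 / \<beta>) *s o2'"
      using \<beta>(1) by (simp add: o2'_def vec_eq_iff field_simps)
    then have "o2 \<in> lin o1 o2'" by (metis lin_memI)
    then show "lin o1 o2 \<subseteq> lin o1 o2'" by (intro lin_subset subspace_lin lin_generators)
  qed
  have F: "frame Q e1' e2' o1 o2'"
    by unfold_locales
      (use \<beta>(1) in \<open>simp_all add: B_linear Q_add Q_diff e1'_def e2'_def o2'_def\<close>)
  interpret F: perspective_oval Q e1' e2' o1 o2' Y
    by (intro perspective_oval.intro frame_oval.intro F frame_oval_axioms.intro
        perspective_oval_axioms.intro)
      (use Y_points card_Y spanning o_in_Y persp in \<open>simp_all only: l' o' simp_thms\<close>)
  have h': "F.h x = h x" for x
    unfolding F.h_def h_def using \<beta>(1)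
    by (simp add: B_linear e1'_def e2'_def o2'_def vec_eq_iff field_simps)
  have U': "F.U\<^sub>0 = U\<^sub>0"
  proof
    show "F.U\<^sub>0 \<subseteq> U\<^sub>0"
      using F.h_U h' h_in_U by (metis subsetI)
    show "U\<^sub>0 \<subseteq> F.U\<^sub>0"
      using h_U h' F.h_in_U by (metis subsetI)
  qed
  have \<tau>': "F.\<tau> x = \<alpha> *s x + \<beta> *s \<tau> x" if x: "x \<in> U\<^sub>0" for x
  proof -
    obtain m where m: "m \<in> Y" "h1 m = x" "h2 m = \<tau> x" by (rule obtain_h1[OF x])
    have "lift m 1 0 = F.lift m (B (lift m 1 0) e1') (B (lift m 1 0) e2')"
      "lift m \<alpha> \<beta> = F.lift m (B (lift m \<alpha> \<beta>) e1') (B (lift m \<alpha> \<beta>) e2')"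
      by (rule F.lift_unique[OF F.Y_point[OF m(1)] lift(1)[OF Y_point[OF m(1)]]])+
    \<comment> \<open>The second vector of the new dual basis of \<open>m\<close> is the old lift of
      (\<alpha>, \<beta>), which accounts for \<alpha> + \<beta> \<open>\<tau>\<close>.\<close>
    then have "F.lift m 1 0 = lift m 1 0" "F.lift m 0 1 = lift m \<alpha> \<beta>"
      using \<beta>(1) by (simp_all add: e1'_def e2'_def B_linear lift Y_point m(1))
    then have "F.h1 m = x" "F.h2 m = \<alpha> *s x + \<beta> *s \<tau> x"
      using m(2,3) lift_basis[OF Y_point[OF m(1)], of \<alpha> \<beta>]
      by (simp_all add: F.h1_def F.h2_def h' h1_def h2_def h_add h_scale)
    then show ?thesis using F.\<tau>_h1[OF m(1)] by simp
  qed
  have "F.\<tau> (F.\<tau> x) = fst quad_par *s F.\<tau> x + snd quad_par *s x" if "x \<in> F.U\<^sub>0" for x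
  proof -
    have x: "x \<in> U\<^sub>0" using that U' by simp
    then have "F.\<tau> (F.\<tau> x) = \<alpha> *s (\<alpha> *s x + \<beta> *s \<tau> x) + \<beta> *s (\<alpha> *s \<tau> x + \<beta> *s (a *s \<tau> x + b *s x))"
      using subspace_U
      by (simp add: \<tau>' \<tau>_add \<tau>_scale vec.subspace_add vec.subspace_scale ab(1))
    also have "\<dots> = (\<beta> * (\<beta> * a + 2 * \<alpha>)) *s \<tau> x + (\<beta>\<^sup>2 * b + \<alpha>\<^sup>2) *s x"
      by (simp add: vec_eq_iff algebra_simps power2_eq_square)
    also have "\<dots> = fst quad_par *s F.\<tau> x + snd quad_par *s x"
      unfolding \<beta> \<tau>'[OF x] by (simp add: vec_eq_iff algebra_simps)
    finally show ?thesis .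
  qed
  then show thesis
    using that[OF F.perspective_oval_axioms l'] by blast
qed

end

section \<open>The conic x z = g y^2\<close>

definition conic_form :: "'k::field \<Rightarrow> 'k ^ 3 \<Rightarrow> 'k"
  where "conic_form g p = p $ 1 * p $ 3 - g * (p $ 2)\<^sup>2"

lemma polar_conic_form:
  "polar (conic_form g) p r = p $ 1 * r $ 3 + r $ 1 * p $ 3 - 2 * g * (p $ 2) * (r $ 2)"
  by (simp add: polar_def conic_form_def algebra_simps power2_eq_square)

lemma quadratic_form_conic: "quadratic_form (conic_form g)"
  unfolding quadratic_form_def
proof (intro conjI allI)
  show "conic_form g (c *s x) = c\<^sup>2 * conic_form g x" for c x
    by (simp add: conic_form_def algebra_simps power2_eq_square)
  show "Vector_Spaces.linear (*s) (*) (\<lambda>x. polar (conic_form g) x y)" for y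
    by unfold_locales (simp_all add: polar_conic_form algebra_simps)
qed

lemma nondegenerate_conic:
  assumes two: "(2::'k::field) \<noteq> 0" and g: "(g::'k) \<noteq> 0"
  shows "nondegenerate (conic_form g)"
  unfolding nondegenerate_def
proof (intro allI impI)
  fix x assume "conic_form g x = 0 \<and> (\<forall>y. polar (conic_form g) x y = 0)"
  then have *: "polar (conic_form g) x y = 0" for y by blast
  have "x $ 1 = 0" "x $ 2 = 0" "x $ 3 = 0"
    using *[of "vector [0, 0, 1]"] *[of "vector [0, 1, 0]"] *[of "vector [1, 0, 0]"] two g
    by (simp_all add: polar_conic_form vector_3)
  then show "x = 0" by (simp add: vec_eq_iff forall_3)
qed

lemma range_scale_unit:
  fixes w :: "'k::field ^ 'n"
  assumes "c \<noteq> 0"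
  shows "range (\<lambda>d. d *s (c *s w)) = range (\<lambda>d. d *s w)"
proof (intro set_eqI iffI)
  fix x assume "x \<in> range (\<lambda>d. d *s (c *s w))"
  then obtain d where "x = (d * c) *s w" by auto
  then show "x \<in> range (\<lambda>d. d *s w)" by blast
next
  fix x assume "x \<in> range (\<lambda>d. d *s w)"
  then obtain d where "x = d *s w" by blast
  then have "x = (d / c) *s (c *s w)" using assms by simp
  then show "x \<in> range (\<lambda>d. d *s (c *s w))" by blast
qed

lemma singular_points_conic:
  fixes g :: "'k::{field,finite}"
  assumes g: "g \<noteq> 0"
  shows "singular_subspaces (conic_form g) 1 =
    insert (range (\<lambda>c. c *s vector [0, 0, 1]))
      (range (\<lambda>y. range (\<lambda>c. c *s vector [1, y, g * y\<^sup>2])))"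
  unfolding singular_points[OF quadratic_form_conic]
proof (intro set_eqI iffI)
  fix U :: "('k ^ 3) set" assume "U \<in> {range (\<lambda>c. c *s w) |w. w \<noteq> 0 \<and> conic_form g w = 0}"
  then obtain w where w: "U = range (\<lambda>c. c *s w)" "w \<noteq> 0" "w $ 1 * w $ 3 = g * (w $ 2)\<^sup>2"
    by (auto simp: conic_form_def)
  show "U \<in> insert (range (\<lambda>c. c *s vector [0, 0, 1]))
      (range (\<lambda>y. range (\<lambda>c. c *s vector [1, y, g * y\<^sup>2])))"
  proof (cases "w $ 1 = 0")
    case True
    then have "w $ 2 = 0" using w(3) g by simp
    with True have "w = (w $ 3) *s vector [0, 0, 1]"
      by (simp add: vec_eq_iff forall_3 vector_3)
    moreover from this have "w $ 3 \<noteq> 0" using w(2) by auto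
    ultimately have "U = range (\<lambda>c. c *s vector [0, 0, 1])"
      using w(1) range_scale_unit by metis
    then show ?thesis by simp
  next
    case False
    define y where "y = w $ 2 / w $ 1"
    have "w $ 3 = w $ 1 * (g * y\<^sup>2)"
      using False w(3) by (simp add: y_def field_simps power2_eq_square)
    then have "w = (w $ 1) *s vector [1, y, g * y\<^sup>2]"
      using False by (simp add: vec_eq_iff forall_3 vector_3 y_def)
    then have "U = range (\<lambda>c. c *s vector [1, y, g * y\<^sup>2])"
      using w(1) range_scale_unit[OF False] by metis
    then show ?thesis by blast
  qed
next
  fix U :: "('k ^ 3) set" assume "U \<in> insert (range (\<lambda>c. c *s vector [0, 0, 1]))
      (range (\<lambda>y. range (\<lambda>c. c *s vector [1, y, g * y\<^sup>2])))"
  then consider "U = range (\<lambda>c. c *s vector [0, 0, 1])"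
    | y where "U = range (\<lambda>c. c *s vector [1, y, g * y\<^sup>2])" by blast
  then show "U \<in> {range (\<lambda>c. c *s w) |w. w \<noteq> 0 \<and> conic_form g w = 0}"
  proof cases
    case 1
    moreover have "(vector [0, 0, 1] :: 'k ^ 3) \<noteq> 0" "conic_form g (vector [0, 0, 1]) = 0"
      by (simp_all add: vec_eq_iff forall_3 vector_3 conic_form_def)
    ultimately show ?thesis by blast
  next
    case 2
    moreover have "(vector [1, y, g * y\<^sup>2] :: 'k ^ 3) \<noteq> 0" "conic_form g (vector [1, y, g * y\<^sup>2]) = 0"
      by (simp_all add: vec_eq_iff forall_3 vector_3 conic_form_def)
    ultimately show ?thesis by blast
  qed
qed

section \<open>The oval as an image of the conic\<close>

context perspective_oval
begin

text \<open>The diagonal coefficients along \<open>e1\<close> and \<open>e2\<close> are fixed by the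
  lifts being singular, the mixed ones by \<open>products_o\<close>.\<close>

lemma lift_explicit:
  assumes m: "m \<in> Y"
  shows "lift m 1 0 = (- Q (h1 m)) *s e1 + (- B (h1 m) (h2 m) / 2) *s e2 + o1 + h1 m"
    and "lift m 0 1 = (- B (h1 m) (h2 m) / 2) *s e1 + (- Q (h2 m)) *s e2 + o2 + h2 m"
proof -
  note mp = Y_point[OF m]
  have "2 * (B (lift m 1 0) o1 + Q (h1 m)) = 0"
    using B_lift_same[OF mp, of 1 0 1 0] B_decompose[of "lift m 1 0" "lift m 1 0"]
    by (simp only: lift[OF mp] B_self) (simp add: h1_def algebra_simps)
  then have 1: "B (lift m 1 0) o1 = - Q (h1 m)"
    using two by (simp add: eq_neg_iff_add_eq_0 del: distrib_left_numeral)
  have "2 * (B (lift m 0 1) o2 + Q (h2 m)) = 0"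
    using B_lift_same[OF mp, of 0 1 0 1] B_decompose[of "lift m 0 1" "lift m 0 1"]
    by (simp only: lift[OF mp] B_self) (simp add: h2_def algebra_simps)
  then have 2: "B (lift m 0 1) o2 = - Q (h2 m)"
    using two by (simp add: eq_neg_iff_add_eq_0 del: distrib_left_numeral)
  show "lift m 1 0 = (- Q (h1 m)) *s e1 + (- B (h1 m) (h2 m) / 2) *s e2 + o1 + h1 m"
    using decompose[of "lift m 1 0"] by (simp add: lift[OF mp] 1 products_o[OF m] h1_def[symmetric])
  show "lift m 0 1 = (- B (h1 m) (h2 m) / 2) *s e1 + (- Q (h2 m)) *s e2 + o2 + h2 m"
    using decompose[of "lift m 0 1"] by (simp add: lift[OF mp] 2 products_o[OF m] h2_def[symmetric])
qed

text \<open>The three coordinates over GF(q^2) parametrise the second frame line,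
  \<open>U\<^sub>0\<close> and \<open>l\<close>. The line of \<open>Y\<close> with
  \<open>h1 m\<close> corresponding to y is the point (1, y, g y^2), and \<open>l\<close> is (0, 0,
  1).\<close>

lemma conic_of_normal_form:
  assumes sq: "\<And>x. x \<in> U\<^sub>0 \<Longrightarrow> \<tau> (\<tau> x) = fst quad_par *s \<tau> x + snd quad_par *s x"
  shows "\<exists>(C :: 'a quad_ext ^ 3 \<Rightarrow> 'a quad_ext) \<phi>. quadratic_form C \<and> nondegenerate C \<and>
    Vector_Spaces.linear restr_scale (*s) \<phi> \<and> bij \<phi> \<and>
    insert l Y = (\<lambda>p. \<phi> ` p) ` singular_subspaces C 1"
proof -
  define u v where "u = fst (quad_par :: 'a \<times> 'a)" and "v = snd (quad_par :: 'a \<times> 'a)"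
  obtain w where w: "w \<in> U\<^sub>0" "w \<noteq> 0" by (rule obtain_nonzero_U)
  define p r where "p = Q w" and "r = B w (\<tau> w) / 2"
  have p0: "p \<noteq> 0" using U_anisotropic w by (auto simp: p_def)
  \<comment> \<open>The third coordinate required at y = 1, that is, for the line of
    \<open>Y\<close> with component \<open>h1 m = w\<close>.\<close>
  define g where "g = Quad (u * p - r) (- p)"
  have g0: "g \<noteq> 0" using p0 by (simp add: g_def)
  \<comment> \<open>On \<open>U\<^sub>0\<close> multiplication by X is \<open>\<tau>\<close>. The
    basis \<open>e2, e1 + u *s e2\<close> of \<open>l\<close> makes multiplication by X on
    \<open>l\<close> adjoint under \<open>B\<close> to multiplication by X on the second frame
    line.\<close>
  define \<phi> where "\<phi> x = quad_fst (x $ 1) *s o1 + quad_snd (x $ 1) *s o2 +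
    (quad_fst (x $ 2) *s w + quad_snd (x $ 2) *s \<tau> w) +
    quad_fst (x $ 3) *s e2 + quad_snd (x $ 3) *s (e1 + u *s e2)" for x :: "'a quad_ext ^ 3"
  have lin: "Vector_Spaces.linear restr_scale (*s) \<phi>"
    unfolding Vector_Spaces.linear_iff
    using vector_space_restr_scale vec.vector_space_axioms
    by (auto simp: \<phi>_def plus_quad_ext_def times_quad_ext_def restr_scale_def vec_eq_iff
        algebra_simps)
  have "x = 0" if x: "\<phi> x = 0" for x
  proof -
    have w0: "B w e1 = 0" "B w e2 = 0" "B w o1 = 0" "B w o2 = 0"
      "B (\<tau> w) e1 = 0" "B (\<tau> w) e2 = 0" "B (\<tau> w) o1 = 0" "B (\<tau> w) o2 = 0"
      using w(1) \<tau>_U[of w] by (auto simp: U\<^sub>0_def)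
    have x1: "quad_fst (x $ 1) = 0" "quad_snd (x $ 1) = 0"
      using arg_cong[OF x, of "\<lambda>v. B v e1"] arg_cong[OF x, of "\<lambda>v. B v e2"]
      by (simp_all add: \<phi>_def B_linear w0)
    have "quad_snd (x $ 3) = 0" "quad_fst (x $ 3) + quad_snd (x $ 3) * u = 0"
      using arg_cong[OF x, of "\<lambda>v. B v o1"] arg_cong[OF x, of "\<lambda>v. B v o2"]
      by (simp_all add: \<phi>_def B_linear w0)
    then have x3: "quad_snd (x $ 3) = 0" "quad_fst (x $ 3) = 0" by simp_all
    then have "quad_fst (x $ 2) = 0 \<and> quad_snd (x $ 2) = 0"
      using x x1 by (intro \<tau>_independent[OF w]) (simp add: \<phi>_def)
    with x1 x3 show "x = 0"
      by (simp add: vec_eq_iff forall_3 zero_quad_ext_def quad_ext.expand)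
  qed
  then have "inj \<phi>"
    using linear_injective_0 lin by (subst vector_space_pair.linear_inj_iff_eq_0)
      (auto intro: vector_space_pair.intro vector_space_restr_scale vec.vector_space_axioms)
  moreover have "surj \<phi>"
  proof (rule card_subset_eq)
    have "card (range \<phi>) = CARD('a quad_ext ^ 3)" using \<open>inj \<phi>\<close> by (rule card_image)
    also have "\<dots> = CARD('a ^ 6)" by (simp add: card_quad_ext flip: power_mult)
    finally show "card (range \<phi>) = CARD('a ^ 6)" .
  qed simp_all
  ultimately have bij: "bij \<phi>" by (rule bijI)
  have img_l: "\<phi> ` range (\<lambda>c. c *s vector [0, 0, 1]) = l"
  proof -
    have "\<phi> (vector [0, 0, 1]) = e2" "\<phi> (Quad 0 1 *s vector [0, 0, 1]) = e1 + u *s e2"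
      by (simp_all add: \<phi>_def vector_3 zero_quad_ext_def one_quad_ext_def)
    then have "\<phi> ` range (\<lambda>c. c *s vector [0, 0, 1]) = lin e2 (e1 + u *s e2)"
      using image_point[OF lin] by simp
    also have "\<dots> = l"
    proof
      show "lin e2 (e1 + u *s e2) \<subseteq> l"
        by (intro lin_subset subspace_lin vec.subspace_add vec.subspace_scale lin_generators)
      have "e1 = (- u) *s e2 + 1 *s (e1 + u *s e2)" by simp
      then have "e1 \<in> lin e2 (e1 + u *s e2)" by (metis lin_memI)
      then show "l \<subseteq> lin e2 (e1 + u *s e2)" by (intro lin_subset subspace_lin lin_generators)
    qed
    finally show ?thesis .
  qed
  have img_m: "\<phi> ` range (\<lambda>c. c *s vector [1, Quad a b, g * (Quad a b)\<^sup>2]) = m"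
    if m: "m \<in> Y" "h1 m = a *s w + b *s \<tau> w" for a b m
  proof -
    have \<tau>w: "\<tau> (\<tau> w) = u *s \<tau> w + v *s w" using sq[OF w(1)] by (simp add: u_def v_def)
    have h2: "h2 m = a *s \<tau> w + b *s (u *s \<tau> w + v *s w)"
      using \<tau>_h1[OF m(1)] m(2) w(1) subspace_U
      by (simp add: \<tau>_add \<tau>_scale vec.subspace_scale \<tau>w)
    have r: "B w (\<tau> w) = 2 * r" "B (\<tau> w) w = 2 * r" "Q w = p"
      using two by (simp_all add: r_def p_def B_commute)
    \<comment> \<open>Self-adjointness moves one \<open>\<tau>\<close> across the product, and the
      quadratic equation reduces \<open>\<tau> (\<tau> w)\<close>.\<close>
    have "2 * Q (\<tau> w) = 2 * (u * r + v * p)"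
      using \<tau>_selfadjoint[OF w(1) \<tau>_U, of w] by (simp add: \<tau>w B_linear r algebra_simps)
    then have Q\<tau>: "Q (\<tau> w) = u * r + v * p"
      using two by (simp only: mult_cancel_left) simp
    have qh1: "Q (h1 m) = a\<^sup>2 * p + a * b * (2 * r) + b\<^sup>2 * (u * r + v * p)"
      unfolding m(2) by (simp add: Q_add B_linear r Q\<tau> algebra_simps)
    have "B (h1 m) (h2 m) =
        2 * (a\<^sup>2 * r + 2 * a * b * (u * r + v * p) + b\<^sup>2 * (u * (u * r + v * p) + v * r))"
      unfolding m(2) h2 by (simp add: B_linear r Q\<tau> algebra_simps power2_eq_square)
    then have bh: "B (h1 m) (h2 m) / 2 =
        a\<^sup>2 * r + 2 * a * b * (u * r + v * p) + b\<^sup>2 * (u * (u * r + v * p) + v * r)"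
      using two by (metis nonzero_mult_div_cancel_left)
    have qh2: "Q (h2 m) = u * (B (h1 m) (h2 m) / 2) + v * Q (h1 m)"
      unfolding bh qh1 unfolding h2
      by (simp add: Q_add B_linear r Q\<tau> algebra_simps power2_eq_square)
    have z: "g * (Quad a b)\<^sup>2 = Quad (u * Q (h1 m) - B (h1 m) (h2 m) / 2) (- Q (h1 m))"
      unfolding bh qh1 g_def power2_eq_square
      by (simp add: algebra_simps flip: u_def v_def)
    have 1: "\<phi> (vector [1, Quad a b, g * (Quad a b)\<^sup>2]) = lift m 1 0"
      unfolding z lift_explicit(1)[OF m(1)]
      by (simp add: \<phi>_def vector_3 one_quad_ext_def m(2) vec_eq_iff algebra_simps)
    have 2: "\<phi> (Quad 0 1 *s vector [1, Quad a b, g * (Quad a b)\<^sup>2]) = lift m 0 1"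
      unfolding z lift_explicit(2)[OF m(1)] qh2
      by (simp add: \<phi>_def vector_3 one_quad_ext_def h2 vec_eq_iff algebra_simps flip: u_def v_def)
    show ?thesis
      unfolding image_point[OF lin] 1 2 by (rule scheme_point_eq_lin[OF Y_point[OF m(1)], symmetric])
  qed
  have "(\<lambda>p. \<phi> ` p) ` singular_subspaces (conic_form g) 1 =
      insert l (range (\<lambda>y. \<phi> ` range (\<lambda>c. c *s vector [1, y, g * y\<^sup>2])))"
    unfolding singular_points_conic[OF g0] image_insert img_l
    by (rule arg_cong[where f = "insert l"]) (rule image_image)
  also have "range (\<lambda>y. \<phi> ` range (\<lambda>c. c *s vector [1, y, g * y\<^sup>2])) = Y"
  proof (intro set_eqI iffI)
    fix m assume "m \<in> range (\<lambda>y. \<phi> ` range (\<lambda>c. c *s vector [1, y, g * y\<^sup>2]))"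
    then obtain y where y: "m = \<phi> ` range (\<lambda>c. c *s vector [1, y, g * y\<^sup>2])" by (rule rangeE)
    obtain a b where ab: "y = Quad a b" by (cases y)
    have "a *s w + b *s \<tau> w \<in> U\<^sub>0"
      by (intro vec.subspace_add vec.subspace_scale subspace_U w \<tau>_U)
    then obtain m' where "m' \<in> Y" "h1 m' = a *s w + b *s \<tau> w" by (rule obtain_h1)
    then show "m \<in> Y" using img_m y ab by simp
  next
    fix m assume m: "m \<in> Y"
    have "h1 m \<in> lin w (\<tau> w)" using U_eq_lin[OF w] h1_U by blast
    then obtain a b where "h1 m = a *s w + b *s \<tau> w" by (rule lin_memE)
    from img_m[OF m this]
    show "m \<in> range (\<lambda>y. \<phi> ` range (\<lambda>c. c *s vector [1, y, g * y\<^sup>2]))"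
      by (intro range_eqI) (rule sym)
  qed
  finally have "insert l Y = (\<lambda>p. \<phi> ` p) ` singular_subspaces (conic_form g) 1" by (rule sym)
  then show ?thesis
    using quadratic_form_conic nondegenerate_conic[OF quad_ext_two[OF two] g0] lin bij by blast
qed

lemma insert_Y_pseudo_conic:
  "\<exists>(C :: 'a quad_ext ^ 3 \<Rightarrow> 'a quad_ext) \<phi>. quadratic_form C \<and> nondegenerate C \<and>
    Vector_Spaces.linear restr_scale (*s) \<phi> \<and> bij \<phi> \<and>
    insert l Y = (\<lambda>p. \<phi> ` p) ` singular_subspaces C 1"
proof -
  obtain e1' e2' o2' where F: "perspective_oval Q e1' e2' o1 o2' Y" and l: "lin e1' e2' = l"
    and sq: "\<forall>x\<in>frame.U\<^sub>0 Q e1' e2' o1 o2'.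
      perspective_oval.\<tau> Q e1' e2' o1 o2' Y (perspective_oval.\<tau> Q e1' e2' o1 o2' Y x) =
      fst quad_par *s perspective_oval.\<tau> Q e1' e2' o1 o2' Y x + snd quad_par *s x"
    by (rule change_frame)
  show ?thesis
    using perspective_oval.conic_of_normal_form[OF F sq[rule_format]] unfolding l .
qed

end

section \<open>From conics to perspective\<close>

lemma (in quadratic_space) ker_pair_card:
  "CARD('k) ^ CARD('n) \<le> CARD('k)\<^sup>2 * card {x. B x a = 0 \<and> B x b = 0}"
proof -
  let ?f = "\<lambda>x. (B x a, B x b)"
  have "card (range ?f) \<le> CARD('k \<times> 'k)" by (rule card_mono) auto
  moreover have "CARD('k ^ 'n) = card (range ?f) * card {x. ?f x = 0}"
    by (rule card_eq_card_range_times_card_kernel) (simp add: B_linear)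
  moreover have "{x. ?f x = 0} = {x. B x a = 0 \<and> B x b = 0}"
    by (simp add: zero_prod_def)
  ultimately show ?thesis by (simp add: power2_eq_square)
qed

lemma (in quadratic_space) perp_spanI:
  assumes "\<And>y. y \<in> X \<Longrightarrow> B x y = 0" and "U \<subseteq> vec.span X"
  shows "x \<in> perp Q U"
proof -
  have "vec.subspace {y. B x y = 0}"
    by (rule vec.subspaceI) (simp_all add: B_linear)
  then have "vec.span X \<subseteq> {y. B x y = 0}"
    using assms(1) by (intro vec.span_minimal) auto
  then show ?thesis
    using assms(2) by (auto simp: perp_def)
qed

section \<open>Coordinates of a conic adapted to two of its points\<close>

locale conic_space = quadratic_space C for C :: "'k::{field,finite} ^ 3 \<Rightarrow> 'k"
begin

text \<open>If \<open>s\<close> and \<open>e\<close> were orthogonal, counting would make their span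
  the perp of \<open>e\<close>, so the functional of \<open>s\<close> would vanish on the kernel of
  that of \<open>e\<close>. It would be a multiple of it, and \<open>s\<close> a multiple of
  \<open>e\<close> by non-degeneracy.\<close>

lemma singular_not_orthogonal:
  assumes e: "C e = 0" "e \<noteq> 0" and s: "C s = 0" and ind: "\<And>c. s \<noteq> c *s e"
  shows "B s e \<noteq> 0"
proof
  assume se: "B s e = 0"
  let ?H = "{x. B x e = 0}"
  obtain y where y: "B y e \<noteq> 0"
    using radical[of e] e(2) B_commute by metis
  have "x \<in> range (\<lambda>x. B x e)" for x
    using y by (intro range_eqI[of _ _ "(x / B y e) *s y"]) (simp add: B_left)
  then have "range (\<lambda>x. B x e) = UNIV" by blast
  then have "CARD('k ^ 3) = CARD('k) * card ?H"
    using card_eq_card_range_times_card_kernel[of "\<lambda>x. B x e"] by (simp add: B_left)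
  then have "CARD('k) * CARD('k)\<^sup>2 = CARD('k) * card ?H"
    by (simp add: power3_eq_cube power2_eq_square)
  then have H: "card ?H = CARD('k)\<^sup>2"
    by (simp only: mult_cancel1) simp
  have "x = 0 \<and> c = 0" if xc: "x *s e + c *s s = 0" for x c
  proof -
    have "c = 0"
    proof (rule ccontr)
      assume c: "c \<noteq> 0"
      have "c *s s = (- x) *s e"
        using xc by (metis add_eq_0_iff vec.scale_minus_left)
      then have "s = (- x / c) *s e"
        using c by (metis (no_types, lifting) divide_inverse_commute left_inverse vec.scale_one
            vec.scale_scale)
      then show False using ind by blast
    qed
    then show ?thesis using xc e(2) by simp
  qed
  then have "card (lin e s) = card ?H" using H card_lin by metis
  moreover have "lin e s \<subseteq> ?H"
    using e s se by (auto simp: B_linear elim!: lin_memE)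
  ultimately have lin: "lin e s = ?H" by (intro card_subset_eq) auto
  have Hs: "B x s = 0" if "B x e = 0" for x
  proof -
    have "x \<in> lin e s" using lin that by simp
    then show ?thesis using s se by (auto simp: B_linear B_commute[of e s] elim!: lin_memE)
  qed
  define c where "c = B y s / B y e"
  have "B (s - c *s e) x = 0" for x
  proof -
    have "B (x - (B x e / B y e) *s y) s = 0"
      using y by (intro Hs) (simp add: B_linear)
    then have "B x s = c * B x e"
      by (simp add: B_linear c_def)
    then show ?thesis by (simp add: B_linear B_commute[of _ x])
  qed
  then have "s = c *s e" using radical[of "s - c *s e"] by simp
  then show False using ind by blast
qed

lemma conic_coordinates:
  assumes e: "C e = 0" "e \<noteq> 0" and s: "C s = 0" and ind: "\<And>c. s \<noteq> c *s e"
  obtains c u g where "c \<noteq> 0" "g \<noteq> 0" "\<forall>x. \<exists>\<alpha> \<beta> \<gamma>. x = \<alpha> *s s + \<beta> *s u + \<gamma> *s (c *s e)"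
    "\<forall>\<alpha> \<beta> \<gamma>. C (\<alpha> *s s + \<beta> *s u + \<gamma> *s (c *s e)) = g * (\<beta>\<^sup>2 - \<alpha> * \<gamma>)"
proof -
  define d where "d = B s e"
  have d: "d \<noteq> 0" using singular_not_orthogonal[OF assms] by (simp add: d_def)
  let ?K = "{x. B x e = 0 \<and> B x s = 0}"
  have q: "1 < CARD('k)" by (rule card_gt_1)
  have "CARD('k)\<^sup>2 * CARD('k) \<le> CARD('k)\<^sup>2 * card ?K"
    using ker_pair_card[of e s] by (simp add: power3_eq_cube power2_eq_square)
  then have "CARD('k) \<le> card ?K" by simp
  then have "card ?K \<noteq> card {0::'k^3}" using q by simp
  moreover have "0 \<in> ?K" by simp
  ultimately obtain u where u: "u \<in> ?K" "u \<noteq> 0" by (metis (no_types, lifting) empty_iff insert_iff subsetI subset_singleton_iff)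
  have "range (\<lambda>x. (B x e, B x s)) = UNIV"
  proof -
    have "(a, b) \<in> range (\<lambda>x. (B x e, B x s))" for a b
      using d e s by (intro range_eqI[of _ _ "(a / d) *s s + (b / d) *s e"])
        (simp add: B_linear d_def B_commute[of e s])
    then show ?thesis by auto
  qed
  then have "CARD('k ^ 3) = CARD('k \<times> 'k) * card {x. (B x e, B x s) = 0}"
    using card_eq_card_range_times_card_kernel[of "\<lambda>x. (B x e, B x s)"] by (simp add: B_left)
  then have "CARD('k)\<^sup>2 * CARD('k) = CARD('k)\<^sup>2 * card ?K"
    by (simp add: power3_eq_cube power2_eq_square zero_prod_def)
  then have "card ?K = CARD('k)" by simp
  moreover have "card (range (\<lambda>c. c *s u)) = CARD('k)"
    using u(2) by (intro card_image) (simp add: inj_on_def)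
  moreover have "range (\<lambda>c. c *s u) \<subseteq> ?K"
    using u(1) by (auto simp: B_left)
  ultimately have K: "range (\<lambda>c. c *s u) = ?K"
    by (intro card_subset_eq) auto
  have span: "\<exists>\<alpha> \<beta> \<gamma>. x = \<alpha> *s s + \<beta> *s u + \<gamma> *s e" for x
  proof -
    let ?w = "x - (B x e / d) *s s - (B x s / d) *s e"
    have "?w \<in> ?K" using d e s by (simp add: B_linear d_def B_commute[of e s])
    then obtain \<beta> where "?w = \<beta> *s u" using K by blast
    then have "x = (B x e / d) *s s + \<beta> *s u + (B x s / d) *s e"
      by (simp add: algebra_simps)
    then show ?thesis by blast
  qed
  have form: "C (\<alpha> *s s + \<beta> *s u + \<gamma> *s e) = \<beta>\<^sup>2 * C u + \<alpha> * \<gamma> * d" for \<alpha> \<beta> \<gamma>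
    using u(1) e(1) s by (simp add: Q_add B_linear d_def B_commute[of _ u])
  have g: "C u \<noteq> 0"
  proof
    assume "C u = 0"
    have "B u x = 0" for x
    proof -
      obtain \<alpha> \<beta> \<gamma> where "x = \<alpha> *s s + \<beta> *s u + \<gamma> *s e" using span by blast
      then show ?thesis using u(1) \<open>C u = 0\<close> by (simp add: B_linear)
    qed
    then show False using radical u(2) by blast
  qed
  \<comment> \<open>Rescaling \<open>e\<close> by this factor turns the coefficient d of \<alpha>
    \<gamma> into - \<open>C u\<close>, so that \<open>C u\<close> can be factored out as g.\<close>
  define c where "c = - C u / d"
  have c: "c \<noteq> 0" using g d by (simp add: c_def)
  show thesis
  proof (rule that[OF c g]; intro allI)
    fix x
    obtain \<alpha> \<beta> \<gamma> where "x = \<alpha> *s s + \<beta> *s u + \<gamma> *s e" using span by blast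
    then have "x = \<alpha> *s s + \<beta> *s u + (\<gamma> / c) *s (c *s e)" using c by simp
    then show "\<exists>\<alpha> \<beta> \<gamma>. x = \<alpha> *s s + \<beta> *s u + \<gamma> *s (c *s e)" by blast
  next
    fix \<alpha> \<beta> \<gamma>
    have "C (\<alpha> *s s + \<beta> *s u + (\<gamma> * c) *s e) = \<beta>\<^sup>2 * C u + \<alpha> * (\<gamma> * c) * d"
      by (rule form)
    also have "\<dots> = C u * (\<beta>\<^sup>2 - \<alpha> * \<gamma>)"
      using d by (simp add: c_def algebra_simps)
    finally show "C (\<alpha> *s s + \<beta> *s u + \<gamma> *s (c *s e)) = C u * (\<beta>\<^sup>2 - \<alpha> * \<gamma>)" by simp
  qed
qed

end

section \<open>The quadric in the coordinates of a conic\<close>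

locale conic_model = elliptic_quadric Q
  for Q :: "'a::{field,finite} ^ 6 \<Rightarrow> 'a" +
  fixes \<phi> :: "'a quad_ext ^ 3 \<Rightarrow> 'a ^ 6" and C :: "'a quad_ext ^ 3 \<Rightarrow> 'a quad_ext"
    and e s u :: "'a quad_ext ^ 3" and g :: "'a quad_ext"
  assumes \<phi>_add: "\<And>x y. \<phi> (x + y) = \<phi> x + \<phi> y" and bij: "bij \<phi>"
    and g: "g \<noteq> 0"
    and spanning: "\<And>x. \<exists>\<alpha> \<beta> \<gamma>. x = \<alpha> *s s + \<beta> *s u + \<gamma> *s e"
    and conic: "\<And>\<alpha> \<beta> \<gamma>. C (\<alpha> *s s + \<beta> *s u + \<gamma> *s e) = g * (\<beta>\<^sup>2 - \<alpha> * \<gamma>)"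
    and singular: "\<And>x. C x = 0 \<Longrightarrow> Q (\<phi> x) = 0"
    and lines: "\<phi> ` range (\<lambda>c. c *s e) \<in> singular_subspaces Q 2"
      "\<phi> ` range (\<lambda>c. c *s s) \<in> singular_subspaces Q 2"
begin

text \<open>The form g (\<beta>^2 - \<alpha> \<gamma>) is symmetric in \<alpha> and \<gamma>; this
  transfers the orthogonality at \<open>e\<close> to \<open>s\<close>.\<close>

lemma swap: "conic_model Q \<phi> C s e u g"
proof unfold_locales
  show "\<exists>\<alpha> \<beta> \<gamma>. x = \<alpha> *s e + \<beta> *s u + \<gamma> *s s" for x
    using spanning[of x] by (metis add.commute add.left_commute)
  show "C (\<alpha> *s e + \<beta> *s u + \<gamma> *s s) = g * (\<beta>\<^sup>2 - \<alpha> * \<gamma>)" for \<alpha> \<beta> \<gamma>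
    using conic[of \<gamma> \<beta> \<alpha>] by (simp add: ac_simps)
qed (use \<phi>_add bij g singular lines in auto)

lemma e_singular: "C (c *s e) = 0"
  using conic[of 0 0 c] by simp

text \<open>The perp of \<open>l\<close> is \<open>GF(q\<^sup>2)\<close>-linear: a vector of it with nonzero \<open>s\<close>-coordinate could be
  moved along \<open>l\<close> onto the conic, but all other lines of the oval are disjoint from the perp of \<open>l\<close>.\<close>

lemma perp_tangent: "B (\<phi> (\<beta> *s u)) (\<phi> (\<gamma> *s e)) = 0"
proof -
  let ?l = "\<phi> ` range (\<lambda>c. c *s e)" and ?W = "range (\<lambda>(\<beta>, \<gamma>). \<beta> *s u + \<gamma> *s e)"
  have "perp Q ?l \<subseteq> \<phi> ` ?W"
  proof
    fix v assume v: "v \<in> perp Q ?l"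
    obtain x where x: "v = \<phi> x" using bij by (metis bij_pointE)
    obtain \<alpha> \<beta> \<gamma> where abc: "x = \<alpha> *s s + \<beta> *s u + \<gamma> *s e" using spanning by blast
    have "\<alpha> = 0"
    proof (rule ccontr)
      assume a: "\<alpha> \<noteq> 0"
      \<comment> \<open>The third coordinate that puts the point on the conic; changing it adds a
        vector of the line of \<open>e\<close>.\<close>
      define \<delta> where "\<delta> = \<beta>\<^sup>2 / \<alpha>"
      let ?y = "\<alpha> *s s + \<beta> *s u + \<delta> *s e"
      have "Q (\<phi> ?y) = 0"
        using a by (intro singular) (simp add: conic \<delta>_def)
      moreover have "\<phi> ?y \<in> perp Q ?l"
      proof -
        have "?y = x + (\<delta> - \<gamma>) *s e" by (simp add: abc vec.scale_left_diff_distrib)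
        then have "\<phi> ?y = \<phi> (x + (\<delta> - \<gamma>) *s e)" by (rule arg_cong)
        also have "\<dots> = v + \<phi> ((\<delta> - \<gamma>) *s e)" by (simp only: \<phi>_add x)
        finally have "\<phi> ?y = v + \<phi> ((\<delta> - \<gamma>) *s e)" .
        moreover have "B (\<phi> ((\<delta> - \<gamma>) *s e)) y = 0" if "y \<in> ?l" for y
          using that by (intro B_singular[OF lines(1)] imageI rangeI)
        ultimately show ?thesis
          using v unfolding perp_def by (simp only: mem_Collect_eq B_left) simp
      qed
      ultimately have "\<phi> ?y \<in> ?l" by (rule singular_in_line[OF lines(1)])
      then obtain c where "\<phi> ?y = \<phi> (c *s e)" by blast
      then have "?y = c *s e" using bij by (simp add: bij_def inj_eq)
      \<comment> \<open>Adding \<open>e\<close> to both sides separates them by the form: the right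
        side stays singular, while the left side takes the value - g \<alpha>.\<close>
      then have "\<alpha> *s s + \<beta> *s u + (\<delta> + 1) *s e = (c + 1) *s e"
        by (metis (no_types, lifting) add.assoc vec.scale_left_distrib)
      then have "g * (\<beta>\<^sup>2 - \<alpha> * (\<delta> + 1)) = 0" using conic e_singular by metis
      then show False using g a by (simp add: \<delta>_def algebra_simps)
    qed
    then have "x \<in> ?W"
      by (intro range_eqI[of _ _ "(\<beta>, \<gamma>)"]) (simp add: abc)
    then show "v \<in> \<phi> ` ?W" unfolding x by (rule imageI)
  qed
  \<comment> \<open>The perp of a line has at least q^4 vectors and the image of \<open>?W\<close>
    at most q^4, so the inclusion above is an equality.\<close>
  moreover have "card (\<phi> ` ?W) \<le> card (perp Q ?l)"
  proof -
    have sub: "vec.subspace ?l" and dim: "vec.dim ?l = 2"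
      using lines(1) by (auto simp: singular_subspaces_def)
    obtain X where X: "X \<subseteq> ?l" "vec.independent X" "?l \<subseteq> vec.span X" "card X = 2"
      using vec.basis_exists dim by metis
    obtain a b where ab: "X = {a, b}" using X(4) by (auto simp: card_2_iff)
    have "{x. B x a = 0 \<and> B x b = 0} \<subseteq> perp Q ?l"
      using perp_spanI[OF _ X(3)] by (auto simp: ab)
    then have "card {x. B x a = 0 \<and> B x b = 0} \<le> card (perp Q ?l)"
      by (intro card_mono) auto
    then have "CARD('a)\<^sup>2 * card {x. B x a = 0 \<and> B x b = 0} \<le> CARD('a)\<^sup>2 * card (perp Q ?l)"
      by (rule mult_le_mono2)
    moreover have "CARD('a)\<^sup>2 * CARD('a) ^ 4 \<le> CARD('a)\<^sup>2 * card {x. B x a = 0 \<and> B x b = 0}"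
      using ker_pair_card[of a b] by (simp flip: power_add)
    ultimately have "CARD('a)\<^sup>2 * CARD('a) ^ 4 \<le> CARD('a)\<^sup>2 * card (perp Q ?l)"
      by (rule order_trans[rotated])
    then have "CARD('a) ^ 4 \<le> card (perp Q ?l)"
      by (simp only: mult_le_cancel1) simp
    moreover have "card (\<phi> ` ?W) \<le> CARD('a quad_ext \<times> 'a quad_ext)"
      by (intro order_trans[OF card_image_le] card_image_le) auto
    then have "card (\<phi> ` ?W) \<le> CARD('a) ^ 4"
      by (simp add: card_quad_ext flip: power_add)
    ultimately show ?thesis by simp
  qed
  ultimately have "perp Q ?l = \<phi> ` ?W" by (intro card_seteq) auto
  moreover have "\<beta> *s u \<in> ?W" by (rule range_eqI[of _ _ "(\<beta>, 0)"]) simp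
  ultimately have "\<phi> (\<beta> *s u) \<in> perp Q ?l" by (simp only: imageI)
  then show ?thesis by (auto simp: perp_def)
qed

lemma perp_tangent': "B (\<phi> (\<gamma> *s s)) (\<phi> (\<beta> *s u)) = 0"
  using conic_model.perp_tangent[OF swap] B_commute by metis

text \<open>The pairing between the lines of \<open>s\<close> and \<open>e\<close>, each
  coordinatised by GF(q^2). By \<open>f_mult\<close> it depends only on the product of the
  coordinates.\<close>

definition f where "f x y = B (\<phi> (x *s s)) (\<phi> (y *s e))"

lemma f_add: "f x (y + z) = f x y + f x z" "f (x + y) z = f x z + f y z"
  by (simp_all add: f_def vec.scale_left_distrib \<phi>_add B_linear)

lemma f_diff: "f x (y - z) = f x y - f x z" "f (x - y) z = f x z - f y z"
  using f_add(1)[of x "y - z" z] f_add(2)[of "x - y" y z] by simp_all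

text \<open>As \<open>Q (\<phi> (c *s u))\<close> does not involve \<open>a\<close>, the value \<open>f a (r / a)\<close> does not depend on \<open>a\<close> for squares
  \<open>r\<close>, hence for all \<open>r\<close>, every element being a difference of two squares.\<close>

lemma f_square:
  assumes "a \<noteq> 0"
  shows "Q (\<phi> (c *s u)) + f a (c\<^sup>2 / a) = 0"
proof -
  let ?x = "a *s s" and ?y = "c *s u" and ?z = "(c\<^sup>2 / a) *s e"
  have "Q (\<phi> (?x + ?y + ?z)) = 0"
    using assms by (intro singular) (simp add: conic)
  moreover have "Q (\<phi> ?x) = 0" "Q (\<phi> ?z) = 0"
    using conic[of a 0 0] e_singular by (auto intro!: singular)
  ultimately show ?thesis
    by (simp add: \<phi>_add Q_add B_linear perp_tangent perp_tangent' f_def)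
qed

lemma f_mult: "f a y = f 1 (a * y)"
proof (cases "a = 0")
  case True
  then show ?thesis using f_diff(1)[of 1 0 0] f_diff(2)[of 0 0 y] by simp
next
  case False
  have sq: "f a (c\<^sup>2 / a) = f 1 (c\<^sup>2)" for c
    using f_square[OF False, of c] f_square[of 1 c] by (metis add_left_imp_eq div_by_1 one_neq_zero)
  have two': "(2::'a quad_ext) \<noteq> 0" by (rule quad_ext_two[OF two])
  define r p t where "r = a * y" and "p = (r + 1) / 2" and "t = (r - 1) / 2"
  have "p - t = 2 / 2" "p + t = 2 * r / 2"
    by (simp_all add: p_def t_def flip: diff_divide_distrib add_divide_distrib)
  then have pt: "p - t = 1" "p + t = r" using two' by simp_all
  have r: "r = p\<^sup>2 - t\<^sup>2"
    using pt by (metis mult_1 power2_eq_square square_diff_square_factored mult.commute)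
  have "y = p\<^sup>2 / a - t\<^sup>2 / a"
    using False r by (simp add: r_def field_simps)
  then have "f a y = f 1 (p\<^sup>2) - f 1 (t\<^sup>2)" by (simp add: f_diff sq)
  then show ?thesis using r by (simp add: f_diff r_def)
qed

text \<open>By \<open>f_mult\<close>, vanishing for one nonzero \<open>a\<close> implies vanishing
  for 1. The singular vector \<open>\<phi> s\<close> would then be orthogonal to the line of
  \<open>e\<close> and so lie on it.\<close>

lemma f_nondegenerate:
  assumes "\<And>y. f a y = 0"
  shows "a = 0"
proof (rule ccontr)
  assume a: "a \<noteq> 0"
  have "f 1 y = 0" for y
    using assms[of "y / a"] a f_mult[of a "y / a"] by simp
  then have "\<phi> (1 *s s) \<in> perp Q (\<phi> ` range (\<lambda>c. c *s e))"
    by (auto simp: perp_def f_def)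
  moreover have "Q (\<phi> (1 *s s)) = 0"
    using conic[of 1 0 0] by (auto intro!: singular)
  ultimately have "\<phi> (1 *s s) \<in> \<phi> ` range (\<lambda>c. c *s e)"
    by (intro singular_in_line[OF lines(1)])
  then obtain c where "\<phi> (1 *s s) = \<phi> (c *s e)" by blast
  then have "1 *s s = c *s e" using bij by (metis bij_def injD)
  \<comment> \<open>Again \<open>e\<close> is added: the left side takes the value - g under
    \<open>C\<close>, the right side 0.\<close>
  then have "1 *s s + 0 *s u + 1 *s e = (c + 1) *s e"
    by (simp add: vec.scale_left_distrib)
  then have "g * (0\<^sup>2 - 1 * 1) = 0" using conic e_singular by metis
  then show False using g by simp
qed

text \<open>A point of the conic other than that of \<open>e\<close> is spanned by
  \<open>s + k *s u + k\<^sup>2 *s e\<close>. Vectors of the other two lines with the same products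
  with the line of \<open>e\<close> have the same coordinate in GF(q^2), and their cross products
  are \<open>f 1 (a * (b * k\<^sup>2))\<close>, symmetric in a and b.\<close>

lemma perspective_points:
  assumes w: "C w = 0" "\<And>c. w \<noteq> c *s e"
  shows "perspective Q (\<phi> ` range (\<lambda>c. c *s e)) (\<phi> ` range (\<lambda>c. c *s s)) (\<phi> ` range (\<lambda>c. c *s w))"
proof -
  obtain \<alpha> \<beta> \<gamma> where abc: "w = \<alpha> *s s + \<beta> *s u + \<gamma> *s e" using spanning by blast
  have eq: "\<beta>\<^sup>2 = \<alpha> * \<gamma>" using w(1) conic g by (simp add: abc)
  have a: "\<alpha> \<noteq> 0"
  proof
    assume "\<alpha> = 0"
    then have "w = \<gamma> *s e" using eq abc by simp
    then show False using w(2) by blast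
  qed
  define k where "k = \<beta> / \<alpha>"
  let ?n = "s + k *s u + k\<^sup>2 *s e"
  have "w = \<alpha> *s ?n"
    using a eq by (simp add: abc k_def vec.scale_right_distrib power_divide) (simp add: power2_eq_square)
  then have n: "range (\<lambda>c. c *s w) = range (\<lambda>c. c *s ?n)"
    using range_scale_unit[OF a, of ?n] by simp
  have \<phi>n: "\<phi> (c *s ?n) = \<phi> (c *s s) + \<phi> ((c * k) *s u) + \<phi> ((c * k\<^sup>2) *s e)" for c
    by (simp add: \<phi>_add vec.scale_right_distrib)
  have ee: "B (\<phi> (c *s e)) (\<phi> (d *s e)) = 0" and ss: "B (\<phi> (c *s s)) (\<phi> (d *s s)) = 0" for c d
    by (rule B_singular[OF lines(1)] B_singular[OF lines(2)]; blast)+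
  have cancel: "a = b" if "\<phi> (a *s s) - \<phi> (b *s ?n) \<in> perp Q (\<phi> ` range (\<lambda>c. c *s e))" for a b
  proof -
    have "f (a - b) y = 0" for y
    proof -
      have "B (\<phi> (a *s s) - \<phi> (b *s ?n)) (\<phi> (y *s e)) = 0"
        using that by (auto simp: perp_def)
      then show ?thesis
        unfolding \<phi>n f_diff by (simp add: B_linear perp_tangent ee f_def)
    qed
    then show ?thesis using f_nondegenerate[of "a - b"] by simp
  qed
  have product: "B (\<phi> (a *s s)) (\<phi> (b *s ?n)) = f 1 (a * (b * k\<^sup>2))" for a b
    unfolding \<phi>n B_right by (simp add: perp_tangent' ss f_def[symmetric] f_mult[of a])
  show ?thesis
    unfolding n perspective_def
  proof (intro ballI impI)
    fix x x' y y'
    assume "x \<in> \<phi> ` range (\<lambda>c. c *s s)" "x' \<in> \<phi> ` range (\<lambda>c. c *s s)"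
      "y \<in> \<phi> ` range (\<lambda>c. c *s ?n)" "y' \<in> \<phi> ` range (\<lambda>c. c *s ?n)"
    then obtain a a' b b' where xy: "x = \<phi> (a *s s)" "x' = \<phi> (a' *s s)"
      "y = \<phi> (b *s ?n)" "y' = \<phi> (b' *s ?n)" by blast
    assume "x - y \<in> perp Q (\<phi> ` range (\<lambda>c. c *s e)) \<and> x' - y' \<in> perp Q (\<phi> ` range (\<lambda>c. c *s e))"
    then have "a = b" "a' = b'" using cancel unfolding xy by blast+
    then show "B x y' = B x' y"
      unfolding xy product by (simp add: ac_simps)
  qed
qed

end

context elliptic_quadric
begin

lemma conic_perspective:
  fixes C :: "'a quad_ext ^ 3 \<Rightarrow> 'a quad_ext" and \<phi> :: "'a quad_ext ^ 3 \<Rightarrow> 'a ^ 6"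
  assumes C: "quadratic_form C" "nondegenerate C"
    and \<phi>: "Vector_Spaces.linear restr_scale (*s) \<phi>" "bij \<phi>"
    and S: "S = (\<lambda>p. \<phi> ` p) ` singular_subspaces C 1" "S \<subseteq> singular_subspaces Q 2"
    and lmn: "l \<in> S" "m \<in> S" "n \<in> S" "m \<noteq> l" "n \<noteq> l"
  shows "perspective Q l m n"
proof -
  interpret C: conic_space C
    using C quad_ext_two[OF two] by unfold_locales
  have points: "\<exists>w. k = \<phi> ` range (\<lambda>c. c *s w) \<and> w \<noteq> 0 \<and> C w = 0" if "k \<in> S" for k
    using that unfolding S(1) singular_points[OF C(1)] by blast
  obtain e where e: "l = \<phi> ` range (\<lambda>c. c *s e)" "e \<noteq> 0" "C e = 0" using points[OF lmn(1)] by blast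
  obtain s where s: "m = \<phi> ` range (\<lambda>c. c *s s)" "s \<noteq> 0" "C s = 0" using points[OF lmn(2)] by blast
  obtain w where w: "n = \<phi> ` range (\<lambda>c. c *s w)" "w \<noteq> 0" "C w = 0" using points[OF lmn(3)] by blast
  have ind: "x \<noteq> c *s e" if x: "k = \<phi> ` range (\<lambda>c. c *s x)" "x \<noteq> 0" "k \<noteq> l" for c k x
  proof
    assume xe: "x = c *s e"
    then have "c \<noteq> 0" using x(2) by auto
    then show False using range_scale_unit[of c e] x(1,3) xe e(1) by simp
  qed
  obtain c u g where c: "c \<noteq> 0" "g \<noteq> 0" "\<forall>x. \<exists>\<alpha> \<beta> \<gamma>. x = \<alpha> *s s + \<beta> *s u + \<gamma> *s (c *s e)"
    "\<forall>\<alpha> \<beta> \<gamma>. C (\<alpha> *s s + \<beta> *s u + \<gamma> *s (c *s e)) = g * (\<beta>\<^sup>2 - \<alpha> * \<gamma>)"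
    by (rule C.conic_coordinates[OF e(3,2) s(3) ind[OF s(1,2) lmn(4)]])
  have l: "l = \<phi> ` range (\<lambda>d. d *s (c *s e))"
    unfolding e(1) range_scale_unit[OF c(1)] ..
  have sing: "Q (\<phi> x) = 0" if "C x = 0" for x
  proof (cases "x = 0")
    case True
    have "\<phi> (0 + 0) = \<phi> 0 + \<phi> 0" using \<phi>(1) unfolding Vector_Spaces.linear_iff by blast
    then show ?thesis using True by simp
  next
    case False
    then have "\<phi> ` range (\<lambda>c. c *s x) \<in> S"
      using that unfolding S(1) singular_points[OF C(1)] by blast
    then have "\<forall>y\<in>\<phi> ` range (\<lambda>c. c *s x). Q y = 0"
      using S(2) by (auto simp: singular_subspaces_def)
    moreover have "x \<in> range (\<lambda>c. c *s x)" by (rule range_eqI[of _ _ 1]) simp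
    ultimately show ?thesis by blast
  qed
  interpret M: conic_model Q \<phi> C "c *s e" s u g
  proof unfold_locales
    show "\<phi> (x + y) = \<phi> x + \<phi> y" for x y
      using \<phi>(1) unfolding Vector_Spaces.linear_iff by blast
    show "\<phi> ` range (\<lambda>d. d *s (c *s e)) \<in> singular_subspaces Q 2"
      "\<phi> ` range (\<lambda>c. c *s s) \<in> singular_subspaces Q 2"
      using lmn(1,2) S(2) l s(1) by auto
  qed (use \<phi>(2) c sing in blast)+
  have "w \<noteq> d *s (c *s e)" for d
    using ind[OF w(1,2) lmn(5), of "d * c"] by simp
  then show ?thesis
    using M.perspective_points[OF w(3)] unfolding l s(1) w(1) by blast
qed

text \<open>A vector of \<open>m\<close> orthogonal to \<open>l\<close> lies in \<open>l\<close> and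
  is zero, so \<open>B\<close> pairs the two lines perfectly and any basis of \<open>l\<close> has a
  dual basis in \<open>m\<close>.\<close>

lemma obtain_frame:
  assumes l: "l \<in> singular_subspaces Q 2" and m: "m \<in> singular_subspaces Q 2"
    and lm: "l \<inter> m = {0}"
  obtains e1 e2 o1 o2 where "frame Q e1 e2 o1 o2" "lin e1 e2 = l" "lin o1 o2 = m"
proof -
  have ls: "vec.subspace l" "vec.dim l = 2" "\<And>x. x \<in> l \<Longrightarrow> Q x = 0"
    and ms: "vec.subspace m" "vec.dim m = 2" "\<And>x. x \<in> m \<Longrightarrow> Q x = 0"
    using l m by (auto simp: singular_subspaces_def)
  obtain X where X: "X \<subseteq> l" "vec.independent X" "l \<subseteq> vec.span X" "card X = 2"
    using vec.basis_exists ls(2) by metis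
  obtain e1 e2 where e: "X = {e1, e2}" using X(4) by (auto simp: card_2_iff)
  have el: "e1 \<in> l" "e2 \<in> l" using X(1) e by auto
  let ?f = "\<lambda>x. (B x e1, B x e2)"
  have "inj_on ?f m"
  proof (rule inj_onI)
    fix x y assume xy: "x \<in> m" "y \<in> m" "?f x = ?f y"
    then have m': "x - y \<in> m" using ms(1) by (simp add: vec.subspace_diff)
    have "x - y \<in> perp Q l"
      using xy(3) by (intro perp_spanI[OF _ X(3)]) (auto simp: e B_diff)
    then have "x - y \<in> l" using singular_in_line[OF l] ms(3)[OF m'] by blast
    then have "x - y \<in> {0}" using m' unfolding lm[symmetric] by blast
    then show "x = y" by simp
  qed
  moreover have "card m = CARD('a)\<^sup>2" using ms by (simp add: card_subspace)
  ultimately have "card (?f ` m) = CARD('a \<times> 'a)"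
    by (simp add: card_image power2_eq_square)
  then have surj: "?f ` m = UNIV" by (intro card_subset_eq) auto
  have "(1, 0) \<in> ?f ` m" "(0, 1) \<in> ?f ` m" unfolding surj by simp_all
  then obtain o1 o2 where o: "o1 \<in> m" "B o1 e1 = 1" "B o1 e2 = 0" "o2 \<in> m" "B o2 e1 = 0" "B o2 e2 = 1"
    by auto
  have F: "frame Q e1 e2 o1 o2"
    using ls(3)[OF el(1)] ls(3)[OF el(2)] ms(3)[OF o(1)] ms(3)[OF o(4)]
      B_singular[OF l el] B_singular[OF m o(1,4)] o B_commute
    by unfold_locales metis+
  interpret frame Q e1 e2 o1 o2 by (rule F)
  have "lin e1 e2 = l" using lin_eq[OF ls(1,2) el e_independent] by simp
  moreover have "lin o1 o2 = m" using lin_eq[OF ms(1,2) o(1,4) o_independent] by simp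
  ultimately show thesis using that F by blast
qed

end

section \<open>Pseudo-ovals of the elliptic quadric\<close>

lemma dim_Un_plus_dim_Int:
  fixes U V :: "('k::field ^ 'n) set"
  shows "vec.dim (U \<union> V) + vec.dim (vec.span U \<inter> vec.span V) = vec.dim U + vec.dim V"
proof -
  have "vec.dim (U \<union> V) = vec.dim (vec.span (U \<union> V))" by simp
  also have "vec.span (U \<union> V) = {x + y |x y. x \<in> vec.span U \<and> y \<in> vec.span V}"
    by (auto simp: vec.span_Un)
  finally show ?thesis
    using vec.dim_sums_Int[of "vec.span U" "vec.span V"] by simp
qed

locale elliptic_pseudo_oval = elliptic_quadric Q
  for Q :: "'a::{field,finite} ^ 6 \<Rightarrow> 'a" +
  fixes S :: "('a ^ 6) set set"
  assumes oval: "pseudo_oval S" and singular_lines: "S \<subseteq> singular_subspaces Q 2"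
begin

lemma card_S: "card S = CARD('a)\<^sup>2 + 1"
  using oval by (simp add: pseudo_oval_def)

text \<open>As q^2 + 1 > 2 there is a third line, and three subspaces of dimension 2 can span
  dimension 6 only if any two of them meet trivially.\<close>

lemma lines_disjoint:
  assumes "l \<in> S" "m \<in> S" "l \<noteq> m"
  shows "l \<inter> m = {0}"
proof -
  have q: "1 < CARD('a)" by (rule card_gt_1)
  have "card {l, m} < card S"
    using assms(3) q card_S by (simp add: power2_eq_square less_Suc_eq_le)
      (metis One_nat_def Suc_leI mult_le_mono numeral_2_eq_2 one_less_numeral_iff
        le_trans mult_2 nat_mult_1 trans_less_add1 less_imp_le)
  then obtain n where n: "n \<in> S" "n \<noteq> l" "n \<noteq> m"
    using card_mono[of "{l, m}" S] by (metis finite.emptyI finite.insertI insert_iff leD subsetI)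
  have d: "vec.subspace l" "vec.dim l = 2" "vec.subspace m" "vec.dim m = 2" "vec.dim n = 2"
    and span: "vec.span (l \<union> m \<union> n) = UNIV"
    using oval assms n unfolding pseudo_oval_def by auto
  have "vec.dim (l \<union> m \<union> n) = vec.dim (UNIV :: ('a^6) set)"
    using span by (metis vec.dim_span)
  also have "\<dots> = 6" by (subst dim_eq_iff_card_eq) simp_all
  finally have "vec.dim (l \<union> m \<union> n) = 6" .
  moreover have ss: "vec.span l \<inter> vec.span m = l \<inter> m"
    using d(1,3) by (metis vec.span_eq_iff)
  ultimately have "vec.dim (l \<inter> m) = 0"
    using dim_Un_plus_dim_Int[of "l \<union> m" n] dim_Un_plus_dim_Int[of l m, unfolded ss] d(2,4,5)
    by linarith
  then show ?thesis using d(1,3) by (auto simp: vec.subspace_0)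
qed

lemma obtain_frame_oval:
  assumes l: "l \<in> S"
  obtains e1 e2 o1 o2 where "frame_oval Q e1 e2 o1 o2 (S - {l})" "lin e1 e2 = l" "lin o1 o2 \<in> S - {l}"
proof -
  have "card (S - {l}) = CARD('a)\<^sup>2" using l card_S by simp
  moreover from this have "S - {l} \<noteq> {}" by (metis card.empty power_not_zero zero_less_card_finite less_irrefl)
  then obtain m where m: "m \<in> S - {l}" by blast
  obtain e1 e2 o1 o2 where F: "frame Q e1 e2 o1 o2" "lin e1 e2 = l" "lin o1 o2 = m"
    using obtain_frame[of l m] l m singular_lines lines_disjoint by (metis DiffE insertI1 subsetD)
  moreover have "S - {l} \<subseteq> scheme_points Q l"
    using singular_lines lines_disjoint l by (auto simp: scheme_points_def)
  moreover have "vec.span (l \<union> m \<union> n) = UNIV" if "m \<in> S - {l}" "n \<in> S - {l}" "m \<noteq> n" for m n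
    using that l oval unfolding pseudo_oval_def by blast
  ultimately have "frame_oval Q e1 e2 o1 o2 (S - {l})"
    by (intro frame_oval.intro frame_oval_axioms.intro) auto
  then show thesis using that F m by blast
qed

text \<open>The clique and the design condition at \<open>l\<close> are both equivalent to
  perspective of all pairs, which reduces the rest to comparing perspective with conics.\<close>

lemma clique_design:
  assumes "l \<in> S"
  shows "scheme_clique Q l {0, 4, 5} (S - {l})" "scheme_design Q l {1} (S - {l})"
    "scheme_clique Q l {0, 5} (S - {l}) \<longleftrightarrow> (\<forall>m\<in>S - {l}. \<forall>n\<in>S - {l}. perspective Q l m n)"
    "scheme_design Q l {1, 5} (S - {l}) \<longleftrightarrow> (\<forall>m\<in>S - {l}. \<forall>n\<in>S - {l}. perspective Q l m n)"
proof -
  obtain e1 e2 o1 o2 where F: "frame_oval Q e1 e2 o1 o2 (S - {l})" "lin e1 e2 = l"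
    "lin o1 o2 \<in> S - {l}"
    by (rule obtain_frame_oval[OF assms])
  interpret F: frame_oval Q e1 e2 o1 o2 "S - {l}" by (rule F(1))
  show "scheme_clique Q l {0, 4, 5} (S - {l})" "scheme_design Q l {1} (S - {l})"
    "scheme_clique Q l {0, 5} (S - {l}) \<longleftrightarrow> (\<forall>m\<in>S - {l}. \<forall>n\<in>S - {l}. perspective Q l m n)"
    using F.clique_045 F.design_1 F.clique_05_iff unfolding F(2) by blast+
  have "scheme_design Q l {1, 5} (S - {l})"
    if "\<forall>m\<in>S - {l}. \<forall>n\<in>S - {l}. perspective Q l m n"
  proof -
    have "perspective_oval Q e1 e2 o1 o2 (S - {l})"
      using F that by (intro perspective_oval.intro perspective_oval_axioms.intro) auto
    then show ?thesis using perspective_oval.design_15 F(2) by metis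
  qed
  then show "scheme_design Q l {1, 5} (S - {l}) \<longleftrightarrow>
      (\<forall>m\<in>S - {l}. \<forall>n\<in>S - {l}. perspective Q l m n)"
    using F.design_5_imp_perspective unfolding F(2) by blast
qed

text \<open>A pseudo-conic looks the same from each of its lines, so
  \<open>conic_perspective\<close> applies at every \<open>l\<close>. The converse builds the conic
  from one chosen line.\<close>

lemma pseudo_conic_iff:
  "pseudo_conic S \<longleftrightarrow> (\<forall>l\<in>S. \<forall>m\<in>S - {l}. \<forall>n\<in>S - {l}. perspective Q l m n)"
proof
  assume "pseudo_conic S"
  then show "\<forall>l\<in>S. \<forall>m\<in>S - {l}. \<forall>n\<in>S - {l}. perspective Q l m n"
    unfolding pseudo_conic_def using conic_perspective[OF _ _ _ _ _ singular_lines] by blast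
next
  assume persp: "\<forall>l\<in>S. \<forall>m\<in>S - {l}. \<forall>n\<in>S - {l}. perspective Q l m n"
  obtain l where l: "l \<in> S" using card_S by fastforce
  obtain e1 e2 o1 o2 where F: "frame_oval Q e1 e2 o1 o2 (S - {l})" "lin e1 e2 = l"
    "lin o1 o2 \<in> S - {l}"
    by (rule obtain_frame_oval[OF l])
  have "perspective_oval Q e1 e2 o1 o2 (S - {l})"
    using F l persp by (intro perspective_oval.intro perspective_oval_axioms.intro) auto
  from perspective_oval.insert_Y_pseudo_conic[OF this]
  show "pseudo_conic S"
    unfolding pseudo_conic_def F(2) insert_Diff[OF l] using oval by blast
qed

end

theorem theorem5p6:
  fixes Q :: "'a::{field,finite} ^ 6 \<Rightarrow> 'a"
    and S :: "('a ^ 6) set set"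
  assumes "odd CARD('a)"
    and "elliptic Q"
    and "pseudo_oval S"
    and "S \<subseteq> singular_subspaces Q 2"
  shows "(\<forall>l\<in>S. scheme_clique Q l {0, 4, 5} (S - {l}) \<and> scheme_design Q l {1} (S - {l})) \<and>
    ((\<forall>l\<in>S. scheme_clique Q l {0, 5} (S - {l})) \<longleftrightarrow>
      (\<forall>l\<in>S. scheme_design Q l {1, 5} (S - {l}))) \<and>
    ((\<forall>l\<in>S. scheme_design Q l {1, 5} (S - {l})) \<longleftrightarrow> pseudo_conic S)"
proof -
  interpret elliptic_pseudo_oval Q S
    using assms by unfold_locales
  show ?thesis
    using clique_design pseudo_conic_iff by auto
qed

end
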